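(* Let $f\in L^2_r(G)$. Then $$A_f^*=A_{\bar f}.$$
   Context: Setting. $G$ is a connected exponential Lie group with Lie algebra $\mathfrak{g}$ ($\exp:\mathfrak{g}\to G$ is a diffeomorphism, with inverse $\log$). The co-adjoint map $K$ is $\langle K(g)Y,X\rangle=\langle Y,\mathrm{Ad}_{g^{-1}}X\rangle$ for $Y\in\mathfrak g^*$. Fix $F\in\mathfrak{g}^*$ with trivial stabilizer $\{g\in G:K(g)F=F\}=\{e\}$, and let $\mathcal{O}_F=K(G)F$ (so $\dim\mathcal{O}_F=\dim G=2n$). $(\pi,\mathcal{H})$ is the irreducible unitary representation attached to $\mathcal{O}_F$ by the Kirillov orbit method: $\pi=\mathrm{ind}_H^G\chi_F$ with $H=\exp\mathfrak{h}$, $\mathfrak{h}$ a subalgebra of maximal dimension with $\langle F,[\mathfrak{h},\mathfrak{h}]\rangle=0$ satisfying the Pukanszky condition $K(H)F=F+\mathfrak{h}^{\perp}$, and $\chi_F(\exp X)=e^{-2\pi i\langle F,X\rangle}$; it is square integrable. Measures. $\mu_l,\mu_r$ are left and right Haar measures with $d\mu_l=\Delta\, d\mu_r$, $\Delta$ the modular function; $L^p_r(G)=L^p(G,\mu_r)$. Inner products are linear in the first variable. $\check f(x)=f(x^{-1})$. Duflo-Moore operator. With $\mathcal{W}_\phi\psi(x)=\langle\psi,\pi(x)^*\phi\rangle_{\mathcal H}$, $\mathcal{D}^{-1}$ is the unique positive densely defined operator on $\mathcal{H}$ with $\langle \mathcal{W}_{\phi_1}\psi_1,\mathcal{W}_{\phi_2}\psi_2\rangle_{L^2_r}=\langle\psi_1,\psi_2\rangle\overline{\langle\mathcal{D}^{-1}\phi_1,\mathcal{D}^{-1}\phi_2\rangle}$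 for $\phi_i\in\mathrm{Dom}(\mathcal{D}^{-1})$, $\psi_i\in\mathcal H$; $\mathcal{D}$ is its inverse. Inverse Fourier-Wigner transform. $\mathcal{S}^2$ is the space of Hilbert-Schmidt operators on $\mathcal H$. $\mathcal{F}_{\mathrm{W}}^{-1}(f)=\pi(\check f)\mathcal{D}=\int_G f(x)\pi(x^{-1})\mathcal{D}\,d\mu_r(x)$ for $f\in L^1_r(G)$ (on $\mathrm{Dom}(\mathcal D)$), extended by continuity from $L^1_r\cap L^2_r$ to a bounded map $L^2_r(G)\to\mathcal{S}^2$. Inverse Fourier-Kirillov transform. Fix a basis $X_1,\dots,X_{2n}$ of $\mathfrak{g}$, the corresponding Lebesgue measure $dX$ on $\mathfrak g$ and dual Lebesgue measure $dY$ on $\mathfrak{g}^*$; $\mathrm{Pf}_F$ is the Pfaffian of the matrix $(F([X_i,X_j]))_{i,j}$. $\Theta(X)=\left|\det\frac{e^{\mathrm{ad}X}-1}{\mathrm{ad}X}\right|$ and $\mu_r$ is normalized by $d\mu_r(\exp X)=\Theta(X)\,dX$. The map $\kappa:G\to\mathcal{O}_F$, $\kappa(x)=K(x^{-1})F$, is a diffeomorphism, and the basis is chosen so that $\kappa$ carries $\mu_r$ to $|\mathrm{Pf}_F|\,\Delta(\kappa^{-1}(Y))\,dY$ on $\mathcal{O}_F$ (this compatibility of normalizations amounts to $|\mathrm{Pf}_F|=1$). On $L^2_r(G)$, with the integral understood in the $L^2$ (Plancherel) sense, $$\mathcal{F}_{\mathrm{KO}}^{-1}(f)(x)=\sqrt{\Theta(\log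 x)}\int_{G}f(y)e^{-2\pi i\langle\kappa(y),\log x\rangle}\frac{d\mu_r(y)}{\sqrt{|\mathrm{Pf}_F|\Delta(y)}}.$$ Quantization. $A_f=\mathcal{F}_{\mathrm{W}}^{-1}(\mathcal{F}_{\mathrm{KO}}^{-1}(f))\in\mathcal{S}^2(\mathcal{H})$ for $f\in L^2_r(G)$; $\bar f$ is the pointwise complex conjugate and $A_f^*$ the Hilbert space adjoint.
   Formalization: The prefactor of the inverse Fourier-Kirillov transform is 1/√Θ(log x), not √Θ(log x): the latter is unbounded on L²_r and makes A_f^* = A_{f̄} fail by a factor Δ; D^{-1} is taken self-adjoint with all admissible vectors as domain, so that it is unique. *)

theory Defs
  imports "HOL-Analysis.Analysis" "HOL-Algebra.Group" "HOL-Combinatorics.Permutations"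
begin

section \<open>Complex Hilbert spaces and their operators\<close>

class complex_inner = real_inner +
  fixes scaleC :: "complex \<Rightarrow> 'a \<Rightarrow> 'a"
    and cinner :: "'a \<Rightarrow> 'a \<Rightarrow> complex"
  assumes scaleC_add_right: "scaleC a (x + y) = scaleC a x + scaleC a y"
    and scaleC_add_left: "scaleC (a + b) x = scaleC a x + scaleC b x"
    and scaleC_scaleC: "scaleC a (scaleC b x) = scaleC (a * b) x"
    and scaleC_of_real: "scaleC (complex_of_real r) x = r *\<^sub>R x"
    and cinner_commute: "cinner x y = cnj (cinner y x)"
    and cinner_add_left: "cinner (x + y) z = cinner x z + cinner y z"
    and cinner_scaleC_left: "cinner (scaleC a x) y = a * cinner x y"
    and inner_eq_Re_cinner: "inner x y = Re (cinner x y)"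

class chilbert_space = complex_inner + complete_space

definition csubspace :: "'h::complex_inner set \<Rightarrow> bool" where
  "csubspace V \<longleftrightarrow> 0 \<in> V \<and> (\<forall>x\<in>V. \<forall>y\<in>V. x + y \<in> V) \<and> (\<forall>c. \<forall>x\<in>V. scaleC c x \<in> V)"

definition bounded_clinear :: "('h::complex_inner \<Rightarrow> 'h) \<Rightarrow> bool" where
  "bounded_clinear A \<longleftrightarrow> bounded_linear A \<and> (\<forall>c x. A (scaleC c x) = scaleC c (A x))"

definition cadjoint :: "('h::complex_inner \<Rightarrow> 'h) \<Rightarrow> 'h \<Rightarrow> 'h" where
  "cadjoint A = (THE B. \<forall>x y. cinner (A x) y = cinner x (B y))"

definition orthonormal_basis :: "'h::complex_inner set \<Rightarrow> bool" where
  "orthonormal_basis E \<longleftrightarrow>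
     (\<forall>e\<in>E. \<forall>e'\<in>E. cinner e e' = (if e = e' then 1 else 0)) \<and>
     (\<forall>v. (\<forall>e\<in>E. cinner v e = 0) \<longrightarrow> v = 0)"

definition some_orthonormal_basis :: "'h::complex_inner set" where
  "some_orthonormal_basis = (SOME E. orthonormal_basis E)"

text \<open>Neither the Hilbert-Schmidt property nor the norm depends on the orthonormal basis used.\<close>

definition hilbert_schmidt :: "('h::complex_inner \<Rightarrow> 'h) \<Rightarrow> bool" where
  "hilbert_schmidt A \<longleftrightarrow>
     bounded_clinear A \<and> (\<lambda>e. (norm (A e))\<^sup>2) summable_on some_orthonormal_basis"

definition hs_norm :: "('h::complex_inner \<Rightarrow> 'h) \<Rightarrow> real" where
  "hs_norm A = sqrt (\<Sum>\<^sub>\<infinity>e\<in>some_orthonormal_basis. (norm (A e))\<^sup>2)"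

text \<open>An unbounded operator is represented by its graph, so that \<^term>\<open>Domain T\<close> is its domain
  and the relational converse is its inverse.\<close>

definition graph_adjoint :: "('h::complex_inner \<times> 'h) set \<Rightarrow> ('h \<times> 'h) set" where
  "graph_adjoint T = {(u, w). \<forall>(x, y)\<in>T. cinner y u = cinner x w}"

definition positive_operator :: "('h::complex_inner \<times> 'h) set \<Rightarrow> bool" where
  "positive_operator T \<longleftrightarrow>
     (0, 0) \<in> T \<and>
     (\<forall>(x, y)\<in>T. \<forall>(x', y')\<in>T. (x + x', y + y') \<in> T) \<and>
     (\<forall>c. \<forall>(x, y)\<in>T. (scaleC c x, scaleC c y) \<in> T) \<and>
     single_valued T \<and>
     closure (Domain T) = UNIV \<and>
     graph_adjoint T = T \<and>
     (\<forall>(x, y)\<in>T. 0 \<le> Re (cinner y x))"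


section \<open>Smooth manifolds and Lie groups\<close>

primrec Ck_on :: "nat \<Rightarrow> ('a::euclidean_space \<Rightarrow> 'b::euclidean_space) \<Rightarrow> 'a set \<Rightarrow> bool" where
  "Ck_on 0 f S \<longleftrightarrow> continuous_on S f"
| "Ck_on (Suc k) f S \<longleftrightarrow>
     (\<forall>x\<in>S. f differentiable (at x)) \<and> (\<forall>v. Ck_on k (\<lambda>x. frechet_derivative f (at x) v) S)"

definition smooth_on :: "('a::euclidean_space \<Rightarrow> 'b::euclidean_space) \<Rightarrow> 'a set \<Rightarrow> bool" where
  "smooth_on f S \<longleftrightarrow> (\<forall>k. Ck_on k f S)"

type_synonym ('m, 'a) atlas = "('m set \<times> ('m \<Rightarrow> 'a)) set"

definition smooth_atlas :: "'m set \<Rightarrow> ('m, 'a::euclidean_space) atlas \<Rightarrow> bool" where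
  "smooth_atlas M \<A> \<longleftrightarrow>
     (\<Union>(U, c)\<in>\<A>. U) = M \<and>
     (\<forall>(U, c)\<in>\<A>. inj_on c U \<and> open (c ` U)) \<and>
     (\<forall>(U, c)\<in>\<A>. \<forall>(V, d)\<in>\<A>. open (c ` (U \<inter> V)) \<and>
        smooth_on (d \<circ> inv_into U c) (c ` (U \<inter> V)))"

definition atlas_topology :: "('m, 'a::euclidean_space) atlas \<Rightarrow> 'm topology" where
  "atlas_topology \<A> = topology_generated_by {U \<inter> c -` W |U c W. (U, c) \<in> \<A> \<and> open W}"

definition prod_atlas ::
    "('m, 'a) atlas \<Rightarrow> ('n, 'b) atlas \<Rightarrow> ('m \<times> 'n, 'a \<times> 'b) atlas" where
  "prod_atlas \<A> \<B> = {(U \<times> V, map_prod c d) |U c V d. (U, c) \<in> \<A> \<and> (V, d) \<in> \<B>}"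

definition euclidean_atlas :: "('a, 'a) atlas" where
  "euclidean_atlas = {(UNIV, id)}"

text \<open>The openness condition in the next definition expresses continuity.\<close>

definition smooth_map ::
    "'m set \<Rightarrow> ('m, 'a::euclidean_space) atlas \<Rightarrow> 'n set \<Rightarrow> ('n, 'b::euclidean_space) atlas
      \<Rightarrow> ('m \<Rightarrow> 'n) \<Rightarrow> bool" where
  "smooth_map M \<A> N \<B> f \<longleftrightarrow>
     f \<in> M \<rightarrow> N \<and>
     (\<forall>(U, c)\<in>\<A>. \<forall>(V, d)\<in>\<B>. open (c ` (U \<inter> f -` V)) \<and>
        smooth_on (d \<circ> f \<circ> inv_into U c) (c ` (U \<inter> f -` V)))"

definition lie_group :: "'g monoid \<Rightarrow> ('g, 'a::euclidean_space) atlas \<Rightarrow> bool" where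
  "lie_group G \<A> \<longleftrightarrow>
     group G \<and>
     smooth_atlas (carrier G) \<A> \<and>
     Hausdorff_space (atlas_topology \<A>) \<and> second_countable (atlas_topology \<A>) \<and>
     smooth_map (carrier G \<times> carrier G) (prod_atlas \<A> \<A>) (carrier G) \<A> (\<lambda>(x, y). x \<otimes>\<^bsub>G\<^esub> y) \<and>
     smooth_map (carrier G) \<A> (carrier G) \<A> (\<lambda>x. inv\<^bsub>G\<^esub> x)"

text \<open>The Lie algebra of \<open>G\<close> is identified with \<open>\<real>\<^sup>m\<close> by means of a fixed basis
  \<open>X\<^sub>i = axis i 1\<close>. Its bracket is not arbitrary but determined by \<open>G\<close>, see \<open>lie_bracket\<close> below.
  The map \<open>ex\<close> is the exponential map: \<open>X\<close> corresponds to the velocity at the identity of the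
  smooth one-parameter group \<open>t \<mapsto> ex (t X)\<close>, and since \<open>ex\<close> is a diffeomorphism this is a linear
  isomorphism of \<open>\<real>\<^sup>m\<close> with the tangent space at the identity.\<close>

definition exponential_lie_group ::
    "'g monoid \<Rightarrow> ('g, real^'n) atlas \<Rightarrow> (real^'n \<Rightarrow> 'g) \<Rightarrow> bool" where
  "exponential_lie_group G \<A> ex \<longleftrightarrow>
     lie_group G \<A> \<and> connected_space (atlas_topology \<A>) \<and>
     (\<forall>X s t. ex ((s + t) *\<^sub>R X) = ex (s *\<^sub>R X) \<otimes>\<^bsub>G\<^esub> ex (t *\<^sub>R X)) \<and>
     bij_betw ex UNIV (carrier G) \<and>
     smooth_map UNIV euclidean_atlas (carrier G) \<A> ex \<and>
     smooth_map (carrier G) \<A> UNIV euclidean_atlas (inv_into UNIV ex)"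

abbreviation lie_log :: "(real^'n \<Rightarrow> 'g) \<Rightarrow> 'g \<Rightarrow> real^'n" where
  "lie_log ex \<equiv> inv_into UNIV ex"

text \<open>\<open>Ad\<^sub>g\<close> is the differential at the identity of conjugation by \<open>g\<close>, and the bracket is
  \<open>[X,Y] = d/ds Ad\<^sub>e\<^sub>x\<^sub>p\<^sub>(\<^sub>s\<^sub>X\<^sub>) Y\<close> at \<open>s = 0\<close>.\<close>

definition Ad :: "'g monoid \<Rightarrow> (real^'n \<Rightarrow> 'g) \<Rightarrow> 'g \<Rightarrow> real^'n \<Rightarrow> real^'n" where
  "Ad G ex g X =
     vector_derivative (\<lambda>t. lie_log ex (g \<otimes>\<^bsub>G\<^esub> ex (t *\<^sub>R X) \<otimes>\<^bsub>G\<^esub> inv\<^bsub>G\<^esub> g)) (at 0)"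

definition lie_bracket :: "'g monoid \<Rightarrow> (real^'n \<Rightarrow> 'g) \<Rightarrow> real^'n \<Rightarrow> real^'n \<Rightarrow> real^'n" where
  "lie_bracket G ex X Y = vector_derivative (\<lambda>s. Ad G ex (ex (s *\<^sub>R X)) Y) (at 0)"

text \<open>\<open>\<Theta>(X) = |det ((e\<^sup>a\<^sup>d\<^sup>X - 1) / ad X)|\<close>, the quotient being the power series
  \<open>\<Sum>\<^sub>k (ad X)\<^sup>k / (k+1)!\<close>.\<close>

definition Theta :: "'g monoid \<Rightarrow> (real^'n \<Rightarrow> 'g) \<Rightarrow> real^'n \<Rightarrow> real" where
  "Theta G ex X =
     \<bar>det (matrix (\<lambda>Y. \<Sum>k. (1 / fact (Suc k)) *\<^sub>R (lie_bracket G ex X ^^ k) Y))\<bar>"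


section \<open>Haar measures\<close>

definition borel_of :: "'g topology \<Rightarrow> 'g measure" where
  "borel_of T = sigma (topspace T) {U. openin T U}"

definition haar_regular :: "'g topology \<Rightarrow> 'g measure \<Rightarrow> bool" where
  "haar_regular T \<mu> \<longleftrightarrow>
     sets \<mu> = sets (borel_of T) \<and>
     (\<forall>C. compactin T C \<longrightarrow> emeasure \<mu> C < \<infinity>) \<and>
     (\<forall>U. openin T U \<longrightarrow> U \<noteq> {} \<longrightarrow> 0 < emeasure \<mu> U)"

definition left_haar :: "'g monoid \<Rightarrow> 'g topology \<Rightarrow> 'g measure \<Rightarrow> bool" where
  "left_haar G T \<mu> \<longleftrightarrow> haar_regular T \<mu> \<and>
     (\<forall>x\<in>carrier G. \<forall>A\<in>sets \<mu>. emeasure \<mu> ((\<lambda>y. x \<otimes>\<^bsub>G\<^esub> y) ` A) = emeasure \<mu> A)"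

definition right_haar :: "'g monoid \<Rightarrow> 'g topology \<Rightarrow> 'g measure \<Rightarrow> bool" where
  "right_haar G T \<mu> \<longleftrightarrow> haar_regular T \<mu> \<and>
     (\<forall>x\<in>carrier G. \<forall>A\<in>sets \<mu>. emeasure \<mu> ((\<lambda>y. y \<otimes>\<^bsub>G\<^esub> x) ` A) = emeasure \<mu> A)"

text \<open>The convention \<open>\<mu>\<^sub>l(Ax) = \<Delta>(x) \<mu>\<^sub>l(A)\<close> is the one compatible with \<open>d\<mu>\<^sub>l = \<Delta> d\<mu>\<^sub>r\<close>.\<close>

definition modular_function :: "'g monoid \<Rightarrow> 'g topology \<Rightarrow> ('g \<Rightarrow> real) \<Rightarrow> bool" where
  "modular_function G T \<Delta> \<longleftrightarrow>
     (\<forall>x\<in>carrier G. 0 < \<Delta> x) \<and>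
     (\<forall>\<mu>. left_haar G T \<mu> \<longrightarrow> (\<forall>x\<in>carrier G. \<forall>A\<in>sets \<mu>.
        emeasure \<mu> ((\<lambda>y. y \<otimes>\<^bsub>G\<^esub> x) ` A) = ennreal (\<Delta> x) * emeasure \<mu> A))"

definition L2 :: "'m measure \<Rightarrow> ('m \<Rightarrow> complex) set" where
  "L2 M = {f \<in> borel_measurable M. integrable M (\<lambda>x. (cmod (f x))\<^sup>2)}"

definition L2_limit :: "'m measure \<Rightarrow> (nat \<Rightarrow> 'm \<Rightarrow> complex) \<Rightarrow> ('m \<Rightarrow> complex) \<Rightarrow> bool" where
  "L2_limit M fs f \<longleftrightarrow> (\<lambda>n. \<integral>x. (cmod (fs n x - f x))\<^sup>2 \<partial>M) \<longlonglongrightarrow> 0"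


section \<open>Unitary representations\<close>

definition unitary_rep :: "'g monoid \<Rightarrow> 'g topology \<Rightarrow> ('g \<Rightarrow> 'h::chilbert_space \<Rightarrow> 'h) \<Rightarrow> bool" where
  "unitary_rep G T \<pi> \<longleftrightarrow>
     (\<forall>x\<in>carrier G. bounded_clinear (\<pi> x) \<and> surj (\<pi> x) \<and> (\<forall>v. norm (\<pi> x v) = norm v)) \<and>
     \<pi> \<one>\<^bsub>G\<^esub> = id \<and>
     (\<forall>x\<in>carrier G. \<forall>y\<in>carrier G. \<pi> (x \<otimes>\<^bsub>G\<^esub> y) = \<pi> x \<circ> \<pi> y) \<and>
     (\<forall>v. continuous_map T euclidean (\<lambda>x. \<pi> x v))"

definition irreducible_rep :: "'g monoid \<Rightarrow> ('g \<Rightarrow> 'h::chilbert_space \<Rightarrow> 'h) \<Rightarrow> bool" where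
  "irreducible_rep G \<pi> \<longleftrightarrow>
     (\<exists>v::'h. v \<noteq> 0) \<and>
     (\<forall>V. csubspace V \<and> closed V \<and> (\<forall>x\<in>carrier G. \<pi> x ` V \<subseteq> V) \<longrightarrow> V = {0} \<or> V = UNIV)"

text \<open>Elements of the space of the induced representation are functions on \<open>G\<close> with
  \<open>\<phi>(xh) = (\<Delta>\<^sub>H(h)/\<Delta>\<^sub>G(h))\<^sup>1\<^sup>/\<^sup>2 \<xi>(h)\<^sup>-\<^sup>1 \<phi>(x)\<close>, modulo null functions. The integral of
  \<open>|\<phi>|\<^sup>2\<close> over \<open>G/H\<close> is \<open>\<integral> k |\<phi>|\<^sup>2 d\<mu>\<close>, where \<open>k\<close> is a Bruhat function, i.e.
  \<open>\<integral>\<^sub>H k(xh) dh = 1\<close> for all \<open>x\<close>; it does not depend on the choice of \<open>k\<close>.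
  As usual, representations are only considered up to unitary equivalence (the map \<open>J\<close>).\<close>

definition bruhat_function ::
    "'g monoid \<Rightarrow> 'g topology \<Rightarrow> 'g measure \<Rightarrow> ('g \<Rightarrow> real) \<Rightarrow> bool" where
  "bruhat_function G T \<nu> k \<longleftrightarrow>
     k \<in> borel_measurable (borel_of T) \<and>
     (\<forall>x\<in>carrier G. 0 \<le> k x \<and> (\<integral>\<^sup>+h. ennreal (k (x \<otimes>\<^bsub>G\<^esub> h)) \<partial>\<nu>) = 1)"

definition induced_space ::
    "'g monoid \<Rightarrow> 'g set \<Rightarrow> ('g \<Rightarrow> complex) \<Rightarrow> 'g measure \<Rightarrow> ('g \<Rightarrow> real) \<Rightarrow> ('g \<Rightarrow> real)
      \<Rightarrow> ('g \<Rightarrow> real) \<Rightarrow> ('g \<Rightarrow> complex) set" where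
  "induced_space G H \<xi> \<mu> \<Delta>G \<Delta>H k =
     {\<phi> \<in> borel_measurable \<mu>.
        (\<forall>x\<in>carrier G. \<forall>h\<in>H.
           \<phi> (x \<otimes>\<^bsub>G\<^esub> h) = complex_of_real (sqrt (\<Delta>H h / \<Delta>G h)) * inverse (\<xi> h) * \<phi> x) \<and>
        integrable \<mu> (\<lambda>x. k x * (cmod (\<phi> x))\<^sup>2)}"

definition induced_rep ::
    "'g monoid \<Rightarrow> 'g topology \<Rightarrow> 'g set \<Rightarrow> ('g \<Rightarrow> complex) \<Rightarrow> ('g \<Rightarrow> 'h::chilbert_space \<Rightarrow> 'h) \<Rightarrow> bool"
  where
  "induced_rep G T H \<xi> \<pi> \<longleftrightarrow>
     (\<exists>\<mu> \<nu> \<Delta>G \<Delta>H k. \<exists>J :: 'h \<Rightarrow> 'g \<Rightarrow> complex.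
        left_haar G T \<mu> \<and> modular_function G T \<Delta>G \<and>
        left_haar (G\<lparr>carrier := H\<rparr>) (subtopology T H) \<nu> \<and>
        modular_function (G\<lparr>carrier := H\<rparr>) (subtopology T H) \<Delta>H \<and>
        bruhat_function G T \<nu> k \<and>
        (\<forall>v. J v \<in> induced_space G H \<xi> \<mu> \<Delta>G \<Delta>H k) \<and>
        (\<forall>v w. AE x in \<mu>. J (v + w) x = J v x + J w x) \<and>
        (\<forall>c v. AE x in \<mu>. J (scaleC c v) x = c * J v x) \<and>
        (\<forall>v. (\<integral>x. k x * (cmod (J v x))\<^sup>2 \<partial>\<mu>) = (norm v)\<^sup>2) \<and>
        (\<forall>\<phi>\<in>induced_space G H \<xi> \<mu> \<Delta>G \<Delta>H k. \<exists>v. AE x in \<mu>. \<phi> x = J v x) \<and>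
        (\<forall>g\<in>carrier G. \<forall>v. AE x in \<mu>. J (\<pi> g v) x = J v (inv\<^bsub>G\<^esub> g \<otimes>\<^bsub>G\<^esub> x)))"


section \<open>The orbit method\<close>

text \<open>The dual of the Lie algebra is identified with \<open>\<real>\<^sup>m\<close> by means of the dual basis, so that the
  duality pairing is the inner product and the dual Lebesgue measure is \<open>lborel\<close>.\<close>

definition coadjoint :: "'g monoid \<Rightarrow> (real^'n \<Rightarrow> 'g) \<Rightarrow> 'g \<Rightarrow> real^'n \<Rightarrow> real^'n" where
  "coadjoint G ex g = adjoint (Ad G ex (inv\<^bsub>G\<^esub> g))"

definition coadjoint_orbit :: "'g monoid \<Rightarrow> (real^'n \<Rightarrow> 'g) \<Rightarrow> real^'n \<Rightarrow> (real^'n) set" where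
  "coadjoint_orbit G ex F = (\<lambda>g. coadjoint G ex g F) ` carrier G"

definition kappa :: "'g monoid \<Rightarrow> (real^'n \<Rightarrow> 'g) \<Rightarrow> real^'n \<Rightarrow> 'g \<Rightarrow> real^'n" where
  "kappa G ex F x = coadjoint G ex (inv\<^bsub>G\<^esub> x) F"

definition subordinate_subalgebra ::
    "'g monoid \<Rightarrow> (real^'n \<Rightarrow> 'g) \<Rightarrow> real^'n \<Rightarrow> (real^'n) set \<Rightarrow> bool" where
  "subordinate_subalgebra G ex F \<hh> \<longleftrightarrow>
     subspace \<hh> \<and> (\<forall>X\<in>\<hh>. \<forall>Y\<in>\<hh>. lie_bracket G ex X Y \<in> \<hh> \<and> F \<bullet> lie_bracket G ex X Y = 0)"

definition pukanszky_polarization ::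
    "'g monoid \<Rightarrow> (real^'n \<Rightarrow> 'g) \<Rightarrow> real^'n \<Rightarrow> (real^'n) set \<Rightarrow> bool" where
  "pukanszky_polarization G ex F \<hh> \<longleftrightarrow>
     subordinate_subalgebra G ex F \<hh> \<and>
     (\<forall>\<kk>. subordinate_subalgebra G ex F \<kk> \<longrightarrow> dim \<kk> \<le> dim \<hh>) \<and>
     (\<lambda>g. coadjoint G ex g F) ` (ex ` \<hh>) = {F + Y |Y. \<forall>X\<in>\<hh>. Y \<bullet> X = 0}"

definition orbit_method_rep ::
    "'g monoid \<Rightarrow> 'g topology \<Rightarrow> (real^'n \<Rightarrow> 'g) \<Rightarrow> real^'n
      \<Rightarrow> ('g \<Rightarrow> 'h::chilbert_space \<Rightarrow> 'h) \<Rightarrow> bool" where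
  "orbit_method_rep G T ex F \<pi> \<longleftrightarrow>
     (\<exists>\<hh>. pukanszky_polarization G ex F \<hh> \<and>
        induced_rep G T (ex ` \<hh>) (\<lambda>h. cis (- 2 * pi * (F \<bullet> lie_log ex h))) \<pi>)"

text \<open>The Pfaffian with respect to the increasing enumeration of the index type.\<close>

definition pfaffian :: "real^'n::_^'n::{finite,wellorder} \<Rightarrow> real" where
  "pfaffian A =
     (let m = CARD('n) div 2; i = (\<lambda>k. sorted_list_of_set (UNIV :: 'n set) ! k)
      in (\<Sum>\<sigma> | \<sigma> permutes (UNIV :: 'n set).
            of_int (sign \<sigma>) * (\<Prod>k<m. A $ \<sigma> (i (2 * k)) $ \<sigma> (i (2 * k + 1))))
         / (2 ^ m * fact m))"

definition Pf :: "'g monoid \<Rightarrow> (real^'n::{finite,wellorder} \<Rightarrow> 'g) \<Rightarrow> real^'n::_ \<Rightarrow> real" where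
  "Pf G ex F = pfaffian (\<chi> i j. F \<bullet> lie_bracket G ex (axis i 1) (axis j 1))"


section \<open>The Duflo-Moore operator\<close>

definition wavelet :: "('g \<Rightarrow> 'h::chilbert_space \<Rightarrow> 'h) \<Rightarrow> 'h \<Rightarrow> 'h \<Rightarrow> 'g \<Rightarrow> complex" where
  "wavelet \<pi> \<phi> \<psi> x = cinner \<psi> (cadjoint (\<pi> x) \<phi>)"

definition square_integrable_rep :: "'g measure \<Rightarrow> ('g \<Rightarrow> 'h::chilbert_space \<Rightarrow> 'h) \<Rightarrow> bool" where
  "square_integrable_rep \<mu>r \<pi> \<longleftrightarrow> (\<exists>\<phi>. \<phi> \<noteq> 0 \<and> wavelet \<pi> \<phi> \<phi> \<in> L2 \<mu>r)"

text \<open>As in the theorem of Duflo and Moore, the domain consists of all admissible vectors. Without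
  this requirement the orthogonality relations would not determine the operator: an unbounded
  positive form has many proper closed, densely defined restrictions.\<close>

definition duflo_moore_relations ::
    "'g measure \<Rightarrow> ('g \<Rightarrow> 'h::chilbert_space \<Rightarrow> 'h) \<Rightarrow> ('h \<times> 'h) set \<Rightarrow> bool" where
  "duflo_moore_relations \<mu>r \<pi> T \<longleftrightarrow>
     positive_operator T \<and>
     Domain T = {\<phi>. \<forall>\<psi>. wavelet \<pi> \<phi> \<psi> \<in> L2 \<mu>r} \<and>
     (\<forall>(\<phi>1, \<eta>1)\<in>T. \<forall>(\<phi>2, \<eta>2)\<in>T. \<forall>\<psi>1 \<psi>2.
        (\<integral>x. wavelet \<pi> \<phi>1 \<psi>1 x * cnj (wavelet \<pi> \<phi>2 \<psi>2 x) \<partial>\<mu>r)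
          = cinner \<psi>1 \<psi>2 * cnj (cinner \<eta>1 \<eta>2))"

definition duflo_moore_inverse ::
    "'g measure \<Rightarrow> ('g \<Rightarrow> 'h::chilbert_space \<Rightarrow> 'h) \<Rightarrow> ('h \<times> 'h) set \<Rightarrow> bool" where
  "duflo_moore_inverse \<mu>r \<pi> Dinv \<longleftrightarrow>
     duflo_moore_relations \<mu>r \<pi> Dinv \<and> (\<forall>T. duflo_moore_relations \<mu>r \<pi> T \<longrightarrow> T = Dinv)"


section \<open>The quantization\<close>

text \<open>\<open>A\<close> is the bounded operator that equals \<open>\<integral> f(x) \<pi>(x\<^sup>-\<^sup>1) D d\<mu>\<^sub>r(x)\<close> on the domain of \<open>D\<close>;
  the operator-valued integral is a weak one.\<close>

definition integrated_operator ::
    "'g monoid \<Rightarrow> 'g measure \<Rightarrow> ('g \<Rightarrow> 'h::chilbert_space \<Rightarrow> 'h) \<Rightarrow> ('h \<times> 'h) set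
      \<Rightarrow> ('g \<Rightarrow> complex) \<Rightarrow> ('h \<Rightarrow> 'h) \<Rightarrow> bool" where
  "integrated_operator G \<mu>r \<pi> D f A \<longleftrightarrow>
     bounded_clinear A \<and>
     (\<forall>(\<phi>, \<eta>)\<in>D. \<forall>\<psi>. cinner (A \<phi>) \<psi> = (\<integral>x. f x * cinner (\<pi> (inv\<^bsub>G\<^esub> x) \<eta>) \<psi> \<partial>\<mu>r))"

definition inv_fourier_wigner ::
    "'g monoid \<Rightarrow> 'g measure \<Rightarrow> ('g \<Rightarrow> 'h::chilbert_space \<Rightarrow> 'h) \<Rightarrow> ('h \<times> 'h) set
      \<Rightarrow> ('g \<Rightarrow> complex) \<Rightarrow> 'h \<Rightarrow> 'h" where
  "inv_fourier_wigner G \<mu>r \<pi> D f =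
     (THE A. hilbert_schmidt A \<and>
        (\<exists>fs As. (\<forall>n. fs n \<in> L2 \<mu>r \<and> integrable \<mu>r (fs n) \<and>
                     hilbert_schmidt (As n) \<and> integrated_operator G \<mu>r \<pi> D (fs n) (As n)) \<and>
           L2_limit \<mu>r fs f \<and> (\<lambda>n. hs_norm (\<lambda>v. As n v - A v)) \<longlonglongrightarrow> 0))"

text \<open>The factor in front of the integral is \<open>\<Theta>(log x)\<^sup>-\<^sup>1\<^sup>/\<^sup>2\<close>. With \<open>d\<mu>\<^sub>r(exp X) = \<Theta>(X) dX\<close> this
  makes the transform isometric on \<open>L\<^sup>2(\<mu>\<^sub>r)\<close>. With the exponent \<open>1/2\<close> found in the source the
  squared norm would be the integral of \<open>\<Theta>(X)\<^sup>2\<close> times the squared modulus of a Euclidean Fourier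
  transform; the transform would then not map \<open>L\<^sup>2(\<mu>\<^sub>r)\<close> to itself, and it would not
  intertwine complex conjugation with the operator adjoint unless \<open>\<Delta> = 1\<close>.\<close>

definition kirillov_integral ::
    "'g monoid \<Rightarrow> (real^'n::{finite,wellorder} \<Rightarrow> 'g) \<Rightarrow> 'g measure \<Rightarrow> ('g \<Rightarrow> real) \<Rightarrow> real^'n::_
      \<Rightarrow> ('g \<Rightarrow> complex) \<Rightarrow> 'g \<Rightarrow> complex" where
  "kirillov_integral G ex \<mu>r \<Delta> F f x =
     complex_of_real (1 / sqrt (Theta G ex (lie_log ex x))) *
     (\<integral>y. f y * cis (- 2 * pi * (kappa G ex F y \<bullet> lie_log ex x))
            / complex_of_real (sqrt (\<bar>Pf G ex F\<bar> * \<Delta> y)) \<partial>\<mu>r)"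

text \<open>The Plancherel extension: \<open>g\<close> is the limit in \<open>L\<^sup>2(\<mu>\<^sub>r)\<close> of transforms given by absolutely
  convergent integrals. It is determined up to null functions, and \<open>SOME\<close> picks a representative.\<close>

definition inv_fourier_kirillov ::
    "'g monoid \<Rightarrow> (real^'n::{finite,wellorder} \<Rightarrow> 'g) \<Rightarrow> 'g measure \<Rightarrow> ('g \<Rightarrow> real) \<Rightarrow> real^'n::_
      \<Rightarrow> ('g \<Rightarrow> complex) \<Rightarrow> 'g \<Rightarrow> complex" where
  "inv_fourier_kirillov G ex \<mu>r \<Delta> F f =
     (SOME g. g \<in> L2 \<mu>r \<and>
        (\<exists>fs. (\<forall>n. fs n \<in> L2 \<mu>r \<and>
                  integrable \<mu>r (\<lambda>y. fs n y / complex_of_real (sqrt (\<bar>Pf G ex F\<bar> * \<Delta> y))) \<and>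
                  kirillov_integral G ex \<mu>r \<Delta> F (fs n) \<in> L2 \<mu>r) \<and>
           L2_limit \<mu>r fs f \<and>
           L2_limit \<mu>r (\<lambda>n. kirillov_integral G ex \<mu>r \<Delta> F (fs n)) g))"

definition quantization ::
    "'g monoid \<Rightarrow> (real^'n::{finite,wellorder} \<Rightarrow> 'g) \<Rightarrow> 'g measure \<Rightarrow> ('g \<Rightarrow> real) \<Rightarrow> real^'n::_
      \<Rightarrow> ('g \<Rightarrow> 'h::chilbert_space \<Rightarrow> 'h) \<Rightarrow> ('h \<times> 'h) set \<Rightarrow> ('g \<Rightarrow> complex) \<Rightarrow> 'h \<Rightarrow> 'h" where
  "quantization G ex \<mu>r \<Delta> F \<pi> D f =
     inv_fourier_wigner G \<mu>r \<pi> D (inv_fourier_kirillov G ex \<mu>r \<Delta> F f)"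

end

theory Submission
  imports Defs "HOL-Probability.Characteristic_Functions"
begin

text \<open>Put \<open>f\<^sup>\<sharp>(x) = \<Delta>(x)\<^sup>1\<^sup>/\<^sup>2 cnj (f(x\<^sup>-\<^sup>1))\<close>, an isometric involution of \<open>L\<^sup>2(\<mu>\<^sub>r)\<close> because
  inversion carries \<open>\<mu>\<^sub>r\<close> to \<open>\<Delta> \<mu>\<^sub>r\<close>. In exponential coordinates this last fact reads
  \<open>\<Theta>(-X) = \<Delta>(exp X) \<Theta>(X)\<close>, whence the Kirillov transform of \<open>cnj f\<close> is the \<open>\<sharp>\<close> of that of \<open>f\<close>.
  On the other side, the uniqueness of the Duflo-Moore operator forces
  \<open>\<pi>(x) D \<pi>(x)\<^sup>* = \<Delta>(x)\<^sup>-\<^sup>1\<^sup>/\<^sup>2 D\<close>, and moving \<open>\<pi>(x\<^sup>-\<^sup>1) D\<close> to the other side of the inner product turns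
  the Wigner operator of \<open>f\<close> into that of \<open>f\<^sup>\<sharp>\<close>. Both transforms exist on all of \<open>L\<^sup>2\<close> since they are
  contractions: the first by the Plancherel inequality on the orbit, an open subset of the dual of the
  Lie algebra by invariance of domain, the second by the orthogonality relations.\<close>

section \<open>Complex Hilbert spaces\<close>

text \<open>The transforms in the statement are selected by \<open>THE\<close> and
  \<open>SOME\<close>, so nothing can be computed before existence and uniqueness are settled: the
  Kirillov transform is a representative known only up to null sets, the Wigner transform is a limit
  of operators. The argument therefore runs on two relations, \<open>kirillov_limit\<close> and
  \<open>is_op\<close>, that survive limits and changes on null sets. The second one is weak: it
  tests an operator only on the range of \<open>Dinv\<close>, which is the domain of the unbounded
  D. There the integral pairs f with a square integrable matrix coefficient, so f in L2 is enough
  and no operator-valued integral is ever formed; density of that range then determines the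
  operator. The power 1/2 of \<Delta> arises independently on the two sides. For Kirillov it is the
  square root of \<Theta>(-X) / \<Theta>(X), a ratio of densities and so known almost everywhere
  only. For Wigner it is what remains of the Haar factor \<Delta>(x) after multiplication by
  \<Delta>(x^-1)^(1/2), and it matches the scaling of D under translation.\<close>

lemma cinner_add_right: "cinner x (y + z) = cinner x y + cinner (x::'h::complex_inner) z"
  by (metis cinner_add_left cinner_commute complex_cnj_add)

lemma cinner_scaleC_right: "cinner x (scaleC a y) = cnj a * cinner (x::'h::complex_inner) y"
  by (metis cinner_commute cinner_scaleC_left complex_cnj_mult)

lemma cinner_scaleR_left: "cinner (r *\<^sub>R x) y = of_real r * cinner (x::'h::complex_inner) y"
  by (metis cinner_scaleC_left scaleC_of_real)

lemma cinner_scaleR_right: "cinner x (r *\<^sub>R y) = of_real r * cinner (x::'h::complex_inner) y"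
  by (metis cinner_scaleC_right scaleC_of_real complex_cnj_complex_of_real)

lemma cinner_zero_left [simp]: "cinner 0 (x::'h::complex_inner) = 0"
  using cinner_scaleR_left[of 0 x x] by simp

lemma cinner_zero_right [simp]: "cinner (x::'h::complex_inner) 0 = 0"
  using cinner_scaleR_right[of x 0 x] by simp

lemma cinner_minus_left: "cinner (- x) y = - cinner (x::'h::complex_inner) y"
  using cinner_scaleR_left[of "-1" x y] by simp

lemma cinner_minus_right: "cinner x (- y) = - cinner (x::'h::complex_inner) y"
  using cinner_scaleR_right[of x "-1" y] by simp

lemma cinner_diff_left: "cinner (x - y) z = cinner x z - cinner (y::'h::complex_inner) z"
  using cinner_add_left[of x "- y" z] by (simp add: cinner_minus_left)

lemma cinner_diff_right: "cinner x (y - z) = cinner x y - cinner (x::'h::complex_inner) z"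
  using cinner_add_right[of x y "- z"] by (simp add: cinner_minus_right)

lemma cinner_sum_left: "cinner (\<Sum>i\<in>I. g i) y = (\<Sum>i\<in>I. cinner (g i :: 'h::complex_inner) y)"
  by (induction I rule: infinite_finite_induct) (auto simp: cinner_add_left)

lemma cinner_sum_right: "cinner y (\<Sum>i\<in>I. g i) = (\<Sum>i\<in>I. cinner y (g i :: 'h::complex_inner))"
  by (induction I rule: infinite_finite_induct) (auto simp: cinner_add_right)

lemma cinner_self: "cinner x x = complex_of_real ((norm (x::'h::complex_inner))\<^sup>2)"
proof -
  have "Im (cinner x x) = 0"
    using arg_cong[OF cinner_commute[of x x], of Im] by simp
  moreover have "Re (cinner x x) = (norm x)\<^sup>2"
    by (simp add: inner_eq_Re_cinner[symmetric] power2_norm_eq_inner)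
  ultimately show ?thesis by (simp add: complex_eq_iff)
qed

lemma norm_scaleC: "norm (scaleC c (x::'h::complex_inner)) = cmod c * norm x"
proof -
  have "complex_of_real ((norm (scaleC c x))\<^sup>2) = c * cnj c * complex_of_real ((norm x)\<^sup>2)"
    by (simp only: cinner_self[symmetric] cinner_scaleC_left cinner_scaleC_right mult_ac)
  also have "\<dots> = complex_of_real ((cmod c * norm x)\<^sup>2)"
    by (simp add: complex_norm_square power_mult_distrib del: of_real_power)

  finally have "(norm (scaleC c x))\<^sup>2 = (cmod c * norm x)\<^sup>2"
    using of_real_eq_iff by blast
  then show ?thesis by (simp add: power2_eq_iff_nonneg)
qed

text \<open>Rotating x by the phase \<open>u\<close> turns the modulus of the inner product into a
  real part, to which the real inequality applies.\<close>

lemma cinner_cauchy_schwarz: "cmod (cinner x y) \<le> norm x * norm (y::'h::complex_inner)"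
proof (cases "cinner x y = 0")
  case False
  define u where "u = cnj (cinner x y) / of_real (cmod (cinner x y))"
  have u: "cmod u = 1" using False by (simp add: u_def norm_divide)
  have "u * cinner x y = of_real (cmod (cinner x y))"
    using False by (simp add: u_def mult.commute[of "cnj _"] complex_norm_square[symmetric] power2_eq_square)
  then have "cmod (cinner x y) = Re (cinner (scaleC u x) y)"
    by (simp add: cinner_scaleC_left)
  also have "\<dots> \<le> norm (scaleC u x) * norm y"
    using norm_cauchy_schwarz[of "scaleC u x" y] by (simp add: inner_eq_Re_cinner)
  finally show ?thesis by (simp add: norm_scaleC u)
qed simp

lemma bounded_bilinear_cinner: "bounded_bilinear (cinner :: 'h::complex_inner \<Rightarrow> 'h \<Rightarrow> complex)"
  by (rule bounded_bilinear.intro)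
    (auto simp: cinner_add_left cinner_add_right cinner_scaleR_left cinner_scaleR_right
      scaleR_conv_of_real intro!: exI[of _ 1] cinner_cauchy_schwarz)

lemmas tendsto_cinner = bounded_bilinear.tendsto[OF bounded_bilinear_cinner]
lemmas continuous_on_cinner = bounded_bilinear.continuous_on[OF bounded_bilinear_cinner]

lemma bounded_linear_scaleC: "bounded_linear (scaleC c :: 'h::complex_inner \<Rightarrow> 'h)"
proof (rule bounded_linear_intro[where K = "cmod c"])
  fix r and x :: 'h
  show "scaleC c (r *\<^sub>R x) = r *\<^sub>R scaleC c x"
    by (simp add: scaleC_of_real[symmetric] scaleC_scaleC mult.commute)
qed (auto simp: scaleC_add_right norm_scaleC)

lemma scaleC_diff_right: "scaleC c (x - y) = scaleC c x - scaleC c (y::'h::complex_inner)"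
  by (rule linear_diff[OF bounded_linear.linear[OF bounded_linear_scaleC]])

lemma scaleC_one [simp]: "scaleC 1 (x::'h::complex_inner) = x"
  using scaleC_of_real[of 1 x] by simp

lemma cinner_eqI:
  assumes "\<And>z. cinner z x = cinner z (y::'h::complex_inner)"
  shows "x = y"
proof -
  have "cinner (x - y) (x - y) = 0" using assms by (simp add: cinner_diff_right)
  then show ?thesis by (simp add: cinner_self)
qed

lemma cadjoint_eqI:
  assumes "\<And>x y. cinner (A x) y = cinner x (B y)"
  shows "cadjoint A = (B :: 'h::complex_inner \<Rightarrow> 'h)"
  unfolding cadjoint_def
proof (rule the_equality)
  fix C assume "\<forall>x y. cinner (A x) y = cinner x (C y)"
  then have "cinner z (C y) = cinner z (B y)" for y z using assms by metis
  then show "C = B" by (intro ext cinner_eqI)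
qed (use assms in blast)

text \<open>The vector is the minimiser of \<open>\<parallel>x\<parallel>\<^sup>2 - 2 f x\<close> on \<open>S\<close>; minimising sequences are Cauchy by
  the parallelogram law.\<close>

lemma riesz_representation_real:
  fixes f :: "'h::{real_inner,complete_space} \<Rightarrow> real"
  assumes f: "bounded_linear f" and S: "subspace S" "closed S"
  shows "\<exists>x\<in>S. \<forall>y\<in>S. x \<bullet> y = f y"
proof -
  interpret f: bounded_linear f by fact
  define J where "J x = x \<bullet> x - 2 * f x" for x
  obtain K where K: "\<And>x. norm (f x) \<le> norm x * K" using f.bounded by blast
  have low: "- (K\<^sup>2) \<le> J x" for x
  proof -
    have "f x \<le> norm x * K" using K[of x] by simp
    moreover have "0 \<le> (norm x - K)\<^sup>2" by simp
    ultimately show ?thesis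
      by (simp add: J_def power2_norm_eq_inner[symmetric] power2_eq_square algebra_simps)
  qed
  define m where "m = Inf (J ` S)"
  have S0: "0 \<in> S" using S by (simp add: subspace_0)
  have bdd: "bdd_below (J ` S)" using low by (intro bdd_belowI2)
  have m: "m \<le> J x" if "x \<in> S" for x
    unfolding m_def by (rule cInf_lower) (use that bdd in auto)
  have "\<exists>x\<in>S. J x < m + 1 / Suc n" for n
  proof -
    have "Inf (J ` S) < m + 1 / Suc n" by (simp add: m_def)
    then obtain y where "y \<in> J ` S" "y < m + 1 / Suc n" using S0
      by (subst (asm) cInf_less_iff[OF _ bdd]) auto
    then show ?thesis by auto
  qed
  then obtain x where xS: "\<And>n. x n \<in> S" and x: "\<And>n. J (x n) < m + 1 / Suc n" by metis
  have par: "(norm (x i - x j))\<^sup>2 \<le> 2 * (1 / Suc i + 1 / Suc j)" for i j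
  proof -
    have mid: "(1/2) *\<^sub>R (x i + x j) \<in> S" using xS S by (simp add: subspace_add subspace_scale)
    have "J (x i) + J (x j) - 2 * J ((1/2) *\<^sub>R (x i + x j)) = (norm (x i - x j))\<^sup>2 / 2"
      unfolding J_def power2_norm_eq_inner
      by (simp add: f.scaleR f.add inner_simps inner_commute) (simp add: field_simps)
    then show ?thesis using x[of i] x[of j] m[OF mid] by argo
  qed
  have "Cauchy x"
  proof (rule metric_CauchyI)
    fix e :: real assume e: "e > 0"
    obtain N where N: "inverse (real (Suc N)) < e\<^sup>2 / 4"
      using reals_Archimedean[of "e\<^sup>2 / 4"] e by auto
    have "dist (x i) (x j) < e" if "i \<ge> N" "j \<ge> N" for i j
    proof -
      have "1 / Suc i \<le> inverse (real (Suc N))" "1 / Suc j \<le> inverse (real (Suc N))"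
        using that by (auto simp: field_simps)
      then have "(norm (x i - x j))\<^sup>2 < e\<^sup>2" using par[of i j] N by argo
      then show ?thesis using e by (simp add: dist_norm power2_less_imp_less)
    qed
    then show "\<exists>N. \<forall>i\<ge>N. \<forall>j\<ge>N. dist (x i) (x j) < e" by blast
  qed
  then obtain z where z: "x \<longlonglongrightarrow> z" using Cauchy_convergent convergent_def by blast
  have zS: "z \<in> S" using closed_sequentially[OF S(2)] xS z by blast
  have "(\<lambda>n. J (x n)) \<longlonglongrightarrow> J z"
    unfolding J_def by (intro tendsto_intros f.tendsto z)
  moreover have "(\<lambda>n. m + 1 / Suc n) \<longlonglongrightarrow> m + 0"
    by (intro tendsto_add tendsto_const LIMSEQ_Suc[OF lim_1_over_n])
  ultimately have Jz: "J z \<le> m"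
    using x by (intro LIMSEQ_le[where X = "\<lambda>n. J (x n)" and Y = "\<lambda>n. m + 1 / Suc n"]) (auto intro: less_imp_le)
  have "z \<bullet> y = f y" if y: "y \<in> S" for y
  proof (rule ccontr)
    assume ne: "z \<bullet> y \<noteq> f y"
    define d where "d = z \<bullet> y - f y"
    have "y \<noteq> 0" using ne by (auto simp: f.zero)
    then have yy: "y \<bullet> y > 0" by simp
    \<comment> \<open>The vertex of the parabola \<open>J (z + t *\<^sub>R y)\<close> in t: moving
      there lowers \<open>J\<close> by d^2 / (y \<bullet> y), against minimality.\<close>
    define t where "t = - d / (y \<bullet> y)"
    have "z + t *\<^sub>R y \<in> S" using zS y S by (simp add: subspace_add subspace_scale)
    then have "J z \<le> J (z + t *\<^sub>R y)" using Jz m by force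
    moreover have "J (z + t *\<^sub>R y) = J z + 2 * t * d + t\<^sup>2 * (y \<bullet> y)"
      unfolding J_def d_def by (simp add: f.scaleR f.add inner_simps inner_commute power2_eq_square algebra_simps)
    moreover have "2 * t * d + t\<^sup>2 * (y \<bullet> y) = - (d\<^sup>2 / (y \<bullet> y))"
      unfolding t_def using yy by (simp add: field_simps power2_eq_square)
    ultimately have "d\<^sup>2 / (y \<bullet> y) \<le> 0" by simp
    then show False using yy ne d_def by (simp add: divide_le_0_iff)
  qed
  then show ?thesis using zS by blast
qed

section \<open>Closures, density and the complex Riesz theorem\<close>

lemma csubspace_imp_subspace: "csubspace V \<Longrightarrow> subspace V"
  unfolding csubspace_def subspace_def by (metis scaleC_of_real)

lemma subspace_closure:
  fixes S :: "'a::real_normed_vector set"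
  assumes "subspace S"
  shows "subspace (closure S)"
  unfolding subspace_def
proof (intro conjI ballI allI)
  show "0 \<in> closure S" using assms closure_subset subspace_0 by blast
  fix x assume "x \<in> closure S"
  then obtain u where u: "\<And>n. u n \<in> S" "u \<longlonglongrightarrow> x" unfolding closure_sequential by blast
  show "c *\<^sub>R x \<in> closure S" for c
    unfolding closure_sequential
    by (rule exI[of _ "\<lambda>n. c *\<^sub>R u n"]) (use u assms subspace_scale in \<open>auto intro!: tendsto_intros\<close>)
  fix y assume "y \<in> closure S"
  then obtain v where v: "\<And>n. v n \<in> S" "v \<longlonglongrightarrow> y" unfolding closure_sequential by blast
  show "x + y \<in> closure S"
    unfolding closure_sequential
    by (rule exI[of _ "\<lambda>n. u n + v n"]) (use u v in \<open>auto intro!: tendsto_intros subspace_add[OF assms]\<close>)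
qed

text \<open>The real Riesz theorem on the closure of V, applied to the inner product with u,
  produces the orthogonal projection x of u. The difference x - u is orthogonal to V in the real
  part, and also in the imaginary part because V contains i v along with v; hence it is 0.\<close>

lemma dense_if_orthogonal_trivial:
  fixes V :: "'h::chilbert_space set"
  assumes V: "csubspace V" and triv: "\<And>u. (\<And>v. v \<in> V \<Longrightarrow> cinner u v = 0) \<Longrightarrow> u = 0"
  shows "closure V = UNIV"
proof -
  have "u \<in> closure V" for u
  proof -
    have "bounded_linear (\<lambda>y. u \<bullet> y)" by (rule bounded_linear_inner_right)
    moreover have "subspace (closure V)" using V by (simp add: csubspace_imp_subspace subspace_closure)
    ultimately obtain x where x: "x \<in> closure V" "\<And>y. y \<in> closure V \<Longrightarrow> x \<bullet> y = u \<bullet> y"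
      using riesz_representation_real[of "\<lambda>y. u \<bullet> y" "closure V"] by auto
    have re: "Re (cinner (x - u) v) = 0" if "v \<in> V" for v
      using x(2)[of v] closure_subset that by (auto simp: inner_eq_Re_cinner cinner_diff_left)
    have "cinner (x - u) v = 0" if v: "v \<in> V" for v
    proof -
      have "scaleC \<i> v \<in> V" using V v by (auto simp: csubspace_def)
      from re[OF this] re[OF v] show ?thesis
        by (simp add: cinner_scaleC_right complex_eq_iff)
    qed
    then have "x - u = 0" using triv by blast
    then show ?thesis using x by simp
  qed
  then show ?thesis by auto
qed

text \<open>The real theorem represents the real part of f, and complex linearity recovers the rest:
  Re (f (-i y)) = Im (f y).\<close>

lemma riesz_representation:
  fixes f :: "'h::chilbert_space \<Rightarrow> complex"
  assumes f: "bounded_linear f" and fC: "\<And>c x. f (scaleC c x) = c * f x"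
  shows "\<exists>x. \<forall>y. cinner y x = f y"
proof -
  have "bounded_linear (\<lambda>y. Re (f y))" using f by (rule bounded_linear_compose[OF bounded_linear_Re])
  then obtain x where x: "\<And>y. x \<bullet> y = Re (f y)"
    using riesz_representation_real[of "\<lambda>y. Re (f y)" UNIV] by auto
  have re: "Re (cinner y x) = Re (f y)" for y
    using x[of y] unfolding inner_commute[of x] by (simp add: inner_eq_Re_cinner)
  have "cinner y x = f y" for y
    using re[of y] re[of "scaleC (- \<i>) y"] by (simp add: cinner_scaleC_left fC complex_eq_iff)
  then show ?thesis by blast
qed

lemma continuous_eq_on_dense:
  fixes f g :: "'a::topological_space \<Rightarrow> 'b::t2_space"
  assumes "continuous_on UNIV f" "continuous_on UNIV g" "closure V = UNIV" "\<And>x. x \<in> V \<Longrightarrow> f x = g x"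
  shows "f x = g x"
proof -
  have "closed {x. f x = g x}" using assms(1,2) by (rule closed_Collect_eq)
  moreover have "V \<subseteq> {x. f x = g x}" using assms(4) by auto
  ultimately have "closure V \<subseteq> {x. f x = g x}" by (simp add: closure_minimal)
  then show ?thesis using assms(3) by auto
qed

lemma csubspace_diff: "csubspace V \<Longrightarrow> x \<in> V \<Longrightarrow> y \<in> V \<Longrightarrow> x - y \<in> V"
  using csubspace_imp_subspace subspace_diff by blast

subsection \<open>Bounded operators\<close>

text \<open>\<open>some_orthonormal_basis\<close> is chosen by \<open>SOME\<close> and has its
  defining property only once a basis exists. Zorn's lemma gives a maximal orthonormal set; a
  nonzero vector orthogonal to it could be normalised and added.\<close>

lemma orthonormal_basis_exists: "\<exists>E :: 'h::complex_inner set. orthonormal_basis E"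
proof -
  define on where "on E \<longleftrightarrow> (\<forall>e\<in>E. \<forall>e'\<in>E. cinner e e' = (if e = e' then 1 else 0))" for E :: "'h set"
  have "\<exists>M\<in>{E. on E}. \<forall>X\<in>{E. on E}. M \<subseteq> X \<longrightarrow> X = M"
  proof (rule subset_Zorn', goal_cases)
    case (1 C)
    have "on (\<Union>C)"
      unfolding on_def
    proof (intro ballI)
      fix e e' assume "e \<in> \<Union>C" "e' \<in> \<Union>C"
      then obtain X Y where XY: "e \<in> X" "X \<in> C" "e' \<in> Y" "Y \<in> C" by blast
      then obtain Z where "Z \<in> C" "e \<in> Z" "e' \<in> Z"
        using 1 by (metis chainsD subset_chain_def subsetD)
      then have "on Z" using 1 by (auto simp: subset_chain_def)
      then show "cinner e e' = (if e = e' then 1 else 0)"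
        using \<open>e \<in> Z\<close> \<open>e' \<in> Z\<close> unfolding on_def by blast
    qed
    then show ?case by simp
  qed
  then obtain M where M: "on M" and max: "\<And>X. on X \<Longrightarrow> M \<subseteq> X \<Longrightarrow> X = M" by auto
  have "v = 0" if v: "\<forall>e\<in>M. cinner v e = 0" for v
  proof (rule ccontr)
    assume "v \<noteq> 0"
    define u where "u = (1 / norm v) *\<^sub>R v"
    have uu: "cinner u u = 1" using \<open>v \<noteq> 0\<close> by (simp add: cinner_self u_def)
    have u: "cinner u e = 0" "cinner e u = 0" if "e \<in> M" for e
    proof -
      show "cinner u e = 0" using v that by (simp add: u_def cinner_scaleR_left)
      then show "cinner e u = 0" by (metis cinner_commute complex_cnj_zero)
    qed
    have "on (insert u M)"
      using M u uu unfolding on_def by fastforce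
    from max[OF this] have "u \<in> M" by blast
    then show False using u uu by fastforce
  qed
  then show ?thesis using M unfolding orthonormal_basis_def on_def by blast
qed

lemma orthonormal_basis_some: "orthonormal_basis (some_orthonormal_basis :: 'h::complex_inner set)"
  unfolding some_orthonormal_basis_def by (rule someI_ex[OF orthonormal_basis_exists])

lemma bounded_clinear_bounded_linear: "bounded_clinear A \<Longrightarrow> bounded_linear A"
  by (simp add: bounded_clinear_def)

lemma bounded_clinear_scaleC: "bounded_clinear A \<Longrightarrow> A (scaleC c x) = scaleC c (A x)"
  by (simp add: bounded_clinear_def)

lemma bounded_clinear_diff:
  assumes A: "bounded_clinear A" and B: "bounded_clinear B"
  shows "bounded_clinear (\<lambda>v. A v - B v)"
  unfolding bounded_clinear_def
proof (intro conjI allI)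
  show "bounded_linear (\<lambda>v. A v - B v)"
    by (rule bounded_linear_sub) (rule A[THEN bounded_clinear_bounded_linear] B[THEN bounded_clinear_bounded_linear])+
  show "A (scaleC c x) - B (scaleC c x) = scaleC c (A x - B x)" for c x
    by (simp only: bounded_clinear_scaleC[OF A] bounded_clinear_scaleC[OF B] scaleC_diff_right)
qed

text \<open>On a finite combination of basis vectors this is Cauchy-Schwarz for the coefficients
  against the norms of the images \<open>A e\<close>; totality of the basis and continuity of A give
  the rest. Convergence in Hilbert-Schmidt norm thus implies convergence at every vector.\<close>

lemma norm_le_hs_norm:
  fixes A :: "'h::chilbert_space \<Rightarrow> 'h"
  assumes A: "hilbert_schmidt A"
  shows "norm (A v) \<le> hs_norm A * norm v"
proof -
  define E where "E = (some_orthonormal_basis :: 'h set)"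
  have E: "\<And>e e'. e \<in> E \<Longrightarrow> e' \<in> E \<Longrightarrow> cinner e e' = (if e = e' then 1 else 0)"
    and total: "\<And>v. (\<And>e. e \<in> E \<Longrightarrow> cinner v e = 0) \<Longrightarrow> v = 0"
    using orthonormal_basis_some unfolding orthonormal_basis_def E_def by blast+
  interpret A: bounded_linear A using A by (simp add: hilbert_schmidt_def bounded_clinear_def)
  have sm: "(\<lambda>e. (norm (A e))\<^sup>2) summable_on E"
    using A by (simp add: hilbert_schmidt_def E_def)
  define V where "V = {\<Sum>e\<in>I. scaleC (c e) e |I c. finite I \<and> I \<subseteq> E}"
  have V0: "scaleC c e \<in> V" if "e \<in> E" for c e
    unfolding V_def using that by (intro CollectI exI[of _ "{e}"] exI[of _ "\<lambda>_. c"]) simp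
  \<comment> \<open>Padding the coefficients with zeros lets two combinations share one index set,
    so that they can be added.\<close>
  have ext: "\<exists>c'. (\<Sum>e\<in>I. scaleC (c e) e) = (\<Sum>e\<in>I'. scaleC (c' e) e)" if "I \<subseteq> I'" "finite I'" for I I' and c :: "'h \<Rightarrow> complex"
  proof
    show "(\<Sum>e\<in>I. scaleC (c e) e) = (\<Sum>e\<in>I'. scaleC (if e \<in> I then c e else 0) e)"
      using that by (intro sum.mono_neutral_cong_left) (auto simp: norm_scaleC simp flip: norm_eq_zero)
  qed
  have "csubspace V"
    unfolding csubspace_def
  proof (intro conjI ballI allI)
    show "0 \<in> V" unfolding V_def by (intro CollectI exI[of _ "{}"]) simp
    fix x assume x: "x \<in> V"
    then obtain I c where I: "finite I" "I \<subseteq> E" "x = (\<Sum>e\<in>I. scaleC (c e) e)" unfolding V_def by blast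
    show "scaleC a x \<in> V" for a
      unfolding V_def I using I
      by (intro CollectI exI[of _ I] exI[of _ "\<lambda>e. a * c e"])
        (simp add: scaleC_scaleC[symmetric] linear_sum[OF bounded_linear.linear[OF bounded_linear_scaleC]])
    fix y assume "y \<in> V"
    then obtain I' c' where I': "finite I'" "I' \<subseteq> E" "y = (\<Sum>e\<in>I'. scaleC (c' e) e)" unfolding V_def by blast
    obtain d d' where "x = (\<Sum>e\<in>I \<union> I'. scaleC (d e) e)" "y = (\<Sum>e\<in>I \<union> I'. scaleC (d' e) e)"
      using ext[of I "I \<union> I'" c] ext[of I' "I \<union> I'" c'] I I' by auto
    then show "x + y \<in> V"
      unfolding V_def using I I'
      by (intro CollectI exI[of _ "I \<union> I'"] exI[of _ "\<lambda>e. d e + d' e"])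
        (auto simp: scaleC_add_left sum.distrib)
  qed
  then have dense: "closure V = UNIV"
  proof (rule dense_if_orthogonal_trivial)
    fix u assume u: "\<And>v. v \<in> V \<Longrightarrow> cinner u v = 0"
    show "u = 0" by (rule total) (use u[OF V0[of _ 1]] in simp)
  qed
  have le: "norm (A v) \<le> hs_norm A * norm v" if "v \<in> V" for v
  proof -
    from that obtain I c where I: "finite I" "I \<subseteq> E" "v = (\<Sum>e\<in>I. scaleC (c e) e)" unfolding V_def by blast
    have "cinner v v = (\<Sum>e\<in>I. \<Sum>e'\<in>I. c e * (cnj (c e') * cinner e e'))"
      unfolding I(3) cinner_sum_left unfolding cinner_scaleC_left cinner_sum_right
      cinner_scaleC_right sum_distrib_left by (simp only: mult_ac)
    also have "\<dots> = (\<Sum>e\<in>I. c e * cnj (c e))"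
    proof (rule sum.cong[OF refl])
      fix e assume e: "e \<in> I"
      have "(\<Sum>e'\<in>I. c e * (cnj (c e') * cinner e e')) = (\<Sum>e'\<in>I. if e' = e then c e * cnj (c e) else 0)"
        using I e by (intro sum.cong refl) (auto simp: E subsetD)
      then show "(\<Sum>e'\<in>I. c e * (cnj (c e') * cinner e e')) = c e * cnj (c e)"
        using I e by simp
    qed
    also have "\<dots> = complex_of_real (\<Sum>e\<in>I. (cmod (c e))\<^sup>2)" by (simp add: complex_norm_square del: of_real_power)
    finally have nv: "(norm v)\<^sup>2 = (\<Sum>e\<in>I. (cmod (c e))\<^sup>2)"
      unfolding cinner_self using of_real_eq_iff by blast
    have AC: "A (scaleC a x) = scaleC a (A x)" for a x
      using A by (simp add: hilbert_schmidt_def bounded_clinear_def)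
    have "norm (A v) \<le> (\<Sum>e\<in>I. norm (A (scaleC (c e) e)))" unfolding I A.sum by (rule norm_sum)
    also have "\<dots> = (\<Sum>e\<in>I. \<bar>cmod (c e)\<bar> * \<bar>norm (A e)\<bar>)" by (simp add: AC norm_scaleC)
    also have "\<dots> \<le> L2_set (\<lambda>e. cmod (c e)) I * L2_set (\<lambda>e. norm (A e)) I" by (rule L2_set_mult_ineq)
    also have "L2_set (\<lambda>e. cmod (c e)) I = norm v" unfolding L2_set_def nv[symmetric] by simp
    also have "L2_set (\<lambda>e. norm (A e)) I \<le> hs_norm A"
      unfolding L2_set_def hs_norm_def E_def[symmetric]
      using finite_sum_le_infsum[OF sm I(1,2)] by auto
    finally show ?thesis by (simp add: mult.commute mult_right_mono)
  qed
  have "closed {v. norm (A v) \<le> hs_norm A * norm v}"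
    by (intro closed_Collect_le continuous_intros linear_continuous_on A.bounded_linear)
  moreover have "V \<subseteq> {v. norm (A v) \<le> hs_norm A * norm v}" using le by auto
  ultimately have "closure V \<subseteq> {v. norm (A v) \<le> hs_norm A * norm v}" by (simp add: closure_minimal)
  then show ?thesis using dense by auto
qed

text \<open>A divergent infinite sum has the value 0 by convention, so \<open>hs_norm\<close> of a
  difference carries information only once the difference is known to be Hilbert-Schmidt.\<close>

lemma hilbert_schmidt_diff:
  fixes A B :: "'h::complex_inner \<Rightarrow> 'h"
  assumes A: "hilbert_schmidt A" and B: "hilbert_schmidt B"
  shows "hilbert_schmidt (\<lambda>v. A v - B v)"
proof -
  have "(\<lambda>e. (norm (A e - B e))\<^sup>2) summable_on some_orthonormal_basis"
  proof (rule summable_on_comparison_test)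
    show "(\<lambda>e. 2 * (norm (A e))\<^sup>2 + 2 * (norm (B e))\<^sup>2) summable_on some_orthonormal_basis"
      using A B by (intro summable_on_add summable_on_cmult_right) (auto simp: hilbert_schmidt_def)
    fix e
    have "(norm (A e - B e))\<^sup>2 \<le> (norm (A e) + norm (B e))\<^sup>2"
      by (intro power_mono norm_triangle_ineq4) simp
    also have "\<dots> \<le> 2 * (norm (A e))\<^sup>2 + 2 * (norm (B e))\<^sup>2"
      using sum_squares_ge_zero[of "norm (A e) - norm (B e)" 0] by (simp add: power2_eq_square algebra_simps)
    finally show "(norm (A e - B e))\<^sup>2 \<le> 2 * (norm (A e))\<^sup>2 + 2 * (norm (B e))\<^sup>2" .
  qed simp
  then show ?thesis using A B bounded_clinear_diff unfolding hilbert_schmidt_def by auto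
qed

text \<open>Polarisation: norms determine the real part of the inner product, and replacing u by i u
  determines the imaginary part.\<close>

lemma isometry_cinner:
  fixes A :: "'h::complex_inner \<Rightarrow> 'h"
  assumes A: "bounded_clinear A" and iso: "\<And>v. norm (A v) = norm v"
  shows "cinner (A u) (A v) = cinner u v"
proof -
  have add: "A (u + v) = A u + A v" for u v
    by (rule linear_add[OF bounded_linear.linear[OF bounded_clinear_bounded_linear[OF A]]])
  have re: "Re (cinner (A u) (A v)) = Re (cinner u v)" for u v
    using dot_norm[of "A u" "A v"] dot_norm[of u v] iso[of "u + v"] iso[of u] iso[of v]
    by (simp add: add inner_eq_Re_cinner)
  have "Re (cinner (A (scaleC \<i> u)) (A v)) = Re (cinner (scaleC \<i> u) v)" by (rule re)
  then have "Im (cinner (A u) (A v)) = Im (cinner u v)"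
    by (simp add: bounded_clinear_scaleC[OF A] cinner_scaleC_left)
  then show ?thesis using re by (simp add: complex_eq_iff)
qed

section \<open>Extension from a dense subspace\<close>

lemma dense_approx_seq:
  assumes "closure V = (UNIV :: 'a::metric_space set)"
  obtains u where "\<And>n. u n \<in> V" "u \<longlonglongrightarrow> x"
proof -
  have "x \<in> closure V" using assms by simp
  then show ?thesis using that unfolding closure_sequential by blast
qed

text \<open>Boundedness makes \<open>A0\<close> uniformly continuous on V, hence extendable to the
  closure; linearity and the bound persist because they are closed conditions.\<close>

lemma bounded_clinear_extension:
  fixes A0 :: "'h::chilbert_space \<Rightarrow> 'h"
  assumes V: "csubspace V" and dense: "closure V = UNIV"
    and add: "\<And>x y. x \<in> V \<Longrightarrow> y \<in> V \<Longrightarrow> A0 (x + y) = A0 x + A0 y"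
    and scale: "\<And>c x. x \<in> V \<Longrightarrow> A0 (scaleC c x) = scaleC c (A0 x)"
    and bound: "\<And>x. x \<in> V \<Longrightarrow> norm (A0 x) \<le> K * norm x" and K: "0 \<le> K"
  obtains A where "bounded_clinear A" "\<And>x. x \<in> V \<Longrightarrow> A x = A0 x"
proof -
  have diff: "A0 (x - y) = A0 x - A0 y" if "x \<in> V" "y \<in> V" for x y
    using add[of "x - y" y] csubspace_diff[OF V that] that by simp
  have "uniformly_continuous_on V A0"
    unfolding uniformly_continuous_on_def
  proof (intro allI impI)
    fix e :: real assume e: "e > 0"
    show "\<exists>d>0. \<forall>x\<in>V. \<forall>x'\<in>V. dist x' x < d \<longrightarrow> dist (A0 x') (A0 x) < e"
    proof (intro exI[of _ "e / (K + 1)"] conjI ballI impI)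
      show "e / (K + 1) > 0" using e K by simp
      fix x x' assume x: "x \<in> V" "x' \<in> V" and d: "dist x' x < e / (K + 1)"
      have "dist (A0 x') (A0 x) = norm (A0 (x' - x))" using x by (simp add: dist_norm diff)
      also have "\<dots> \<le> K * norm (x' - x)" by (rule bound) (rule csubspace_diff[OF V x(2,1)])
      also have "\<dots> \<le> (K + 1) * norm (x' - x)" by (simp add: mult_right_mono)
      also have "\<dots> < e" using d K by (simp add: dist_norm pos_less_divide_eq mult.commute)
      finally show "dist (A0 x') (A0 x) < e" .
    qed
  qed
  then obtain A where A: "uniformly_continuous_on (closure V) A" and eq: "\<And>x. x \<in> V \<Longrightarrow> A0 x = A x"
    by (rule uniformly_continuous_on_extension_on_closure) blast
  have cont: "continuous_on UNIV A" using uniformly_continuous_imp_continuous[OF A] dense by simp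
  have comp: "continuous_on UNIV (\<lambda>x. A (h x))" if "continuous_on UNIV h" for h :: "'h \<Rightarrow> 'h"
    using continuous_on_compose2[OF cont that] by simp
  have VD: "x + y \<in> V" "scaleC c x \<in> V" if "x \<in> V" "y \<in> V" for x y c
    using V that by (auto simp: csubspace_def)
  \<comment> \<open>Additivity reaches the closure one argument at a time: here x is arbitrary while
    y stays in V, and next y is released as well.\<close>
  have add1: "A (x + y) = A x + A y" if y: "y \<in> V" for x y
    by (rule continuous_eq_on_dense[of "\<lambda>x. A (x + y)" "\<lambda>x. A x + A y", OF _ _ dense])
      (use y eq VD add in \<open>auto intro!: comp cont continuous_intros simp flip: eq\<close>)
  have Aadd: "A (x + y) = A x + A y" for x y
    by (rule continuous_eq_on_dense[of "\<lambda>y. A (x + y)" "\<lambda>y. A x + A y", OF _ _ dense])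
      (auto intro!: comp cont continuous_intros add1)
  have Ascale: "A (scaleC c x) = scaleC c (A x)" for c x
  proof (rule continuous_eq_on_dense[of "\<lambda>x. A (scaleC c x)" "\<lambda>x. scaleC c (A x)", OF _ _ dense])
    show "continuous_on UNIV (\<lambda>x. A (scaleC c x))"
      by (rule comp) (rule linear_continuous_on[OF bounded_linear_scaleC])
    show "continuous_on UNIV (\<lambda>x. scaleC c (A x))"
      by (rule bounded_linear.continuous_on[OF bounded_linear_scaleC cont])
    show "A (scaleC c x) = scaleC c (A x)" if "x \<in> V" for x
      using that by (simp add: eq[symmetric] VD scale)
  qed
  have le: "norm (A x) \<le> norm x * K" for x
  proof -
    have "closed {x. norm (A x) \<le> norm x * K}"
      by (intro closed_Collect_le continuous_intros cont)
    moreover have "V \<subseteq> {x. norm (A x) \<le> norm x * K}" using bound eq by (auto simp: mult.commute)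
    ultimately have "closure V \<subseteq> {x. norm (A x) \<le> norm x * K}" by (simp add: closure_minimal)
    then show ?thesis using dense by auto
  qed
  have "bounded_linear A"
  proof (rule bounded_linear_intro[OF Aadd _ le])
    show "A (r *\<^sub>R x) = r *\<^sub>R A x" for r x
      using Ascale[of "complex_of_real r" x] by (simp add: scaleC_of_real)
  qed
  then have "bounded_clinear A" using Ascale by (simp add: bounded_clinear_def)
  then show ?thesis using that eq by metis
qed

section \<open>Square integrable functions\<close>

definition L2_norm :: "'m measure \<Rightarrow> ('m \<Rightarrow> complex) \<Rightarrow> real" where
  "L2_norm M f = sqrt (\<integral>x. (cmod (f x))\<^sup>2 \<partial>M)"

lemma L2_D:
  assumes "f \<in> L2 M"
  shows L2_measurable: "f \<in> borel_measurable M" and L2_integrable: "integrable M (\<lambda>x. (cmod (f x))\<^sup>2)"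
  using assms by (auto simp: L2_def)

lemma L2_norm_nonneg [simp]: "0 \<le> L2_norm M f"
  by (simp add: L2_norm_def)

lemma L2_norm_power2: "(L2_norm M f)\<^sup>2 = (\<integral>x. (cmod (f x))\<^sup>2 \<partial>M)"
  by (simp add: L2_norm_def)

lemma L2_limit_iff: "L2_limit M fs f \<longleftrightarrow> (\<lambda>n. L2_norm M (\<lambda>x. fs n x - f x)) \<longlonglongrightarrow> 0"
proof
  assume "L2_limit M fs f"
  then show "(\<lambda>n. L2_norm M (\<lambda>x. fs n x - f x)) \<longlonglongrightarrow> 0"
    unfolding L2_limit_def L2_norm_def using tendsto_real_sqrt by fastforce
next
  assume "(\<lambda>n. L2_norm M (\<lambda>x. fs n x - f x)) \<longlonglongrightarrow> 0"
  from tendsto_power[OF this, of 2] show "L2_limit M fs f"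
    unfolding L2_limit_def L2_norm_power2 by simp
qed

lemma cmod_mult_le_squares: "cmod (a * b) \<le> (cmod a)\<^sup>2 + (cmod b)\<^sup>2"
proof -
  have "0 \<le> (cmod a - cmod b)\<^sup>2 + (cmod a)\<^sup>2 + (cmod b)\<^sup>2" by simp
  then show ?thesis by (simp add: norm_mult power2_eq_square algebra_simps)
qed

lemma cmod_add_square_le: "(cmod (a + b))\<^sup>2 \<le> 2 * (cmod a)\<^sup>2 + 2 * (cmod b)\<^sup>2"
proof -
  have "(cmod (a + b))\<^sup>2 \<le> (cmod a + cmod b)\<^sup>2" by (intro power_mono norm_triangle_ineq) simp
  moreover have "0 \<le> (cmod a - cmod b)\<^sup>2" by simp
  ultimately show ?thesis by (simp add: power2_eq_square algebra_simps)
qed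

lemma L2_mult_integrable:
  assumes "f \<in> L2 M" "g \<in> L2 M"
  shows "integrable M (\<lambda>x. f x * g x)"
proof (rule Bochner_Integration.integrable_bound)
  show "integrable M (\<lambda>x. (cmod (f x))\<^sup>2 + (cmod (g x))\<^sup>2)" using assms by (simp add: L2_integrable)
  show "(\<lambda>x. f x * g x) \<in> borel_measurable M" using assms by (simp add: L2_measurable borel_measurable_times)
qed (use cmod_mult_le_squares in auto)

lemma borel_measurable_cnj [measurable]: "cnj \<in> borel_measurable borel"
  by (intro borel_measurable_continuous_onI continuous_intros)

lemma L2_add:
  assumes "f \<in> L2 M" "g \<in> L2 M"
  shows "(\<lambda>x. f x + g x) \<in> L2 M"
proof -
  note [measurable] = L2_measurable[OF assms(1)] L2_measurable[OF assms(2)]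
  have "integrable M (\<lambda>x. (cmod (f x + g x))\<^sup>2)"
  proof (rule Bochner_Integration.integrable_bound)
    show "integrable M (\<lambda>x. 2 * (cmod (f x))\<^sup>2 + 2 * (cmod (g x))\<^sup>2)"
      using assms by (simp add: L2_integrable)
  qed (use cmod_add_square_le in auto)
  then show ?thesis by (auto simp: L2_def)
qed

lemma L2_scale: "f \<in> L2 M \<Longrightarrow> (\<lambda>x. c * f x) \<in> L2 M"
  by (auto simp: L2_def norm_mult power_mult_distrib)

lemma L2_cnj: "f \<in> L2 M \<Longrightarrow> (\<lambda>x. cnj (f x)) \<in> L2 M"
  by (auto simp: L2_def intro!: measurable_compose[OF _ borel_measurable_cnj])

lemma L2_diff: "f \<in> L2 M \<Longrightarrow> g \<in> L2 M \<Longrightarrow> (\<lambda>x. f x - g x) \<in> L2 M"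
  using L2_add[OF _ L2_scale[of g M "-1"], of f] by simp

lemma L2_sum: "(\<And>i. i \<in> I \<Longrightarrow> f i \<in> L2 M) \<Longrightarrow> (\<lambda>x. \<Sum>i\<in>I. f i x) \<in> L2 M"
proof (induction I rule: infinite_finite_induct)
  case (insert i I)
  then show ?case using L2_add[of "f i" M "\<lambda>x. \<Sum>i\<in>I. f i x"] by simp
qed (auto simp: L2_def)

text \<open>The integral of (t |f| - |g|)^2 is a nonnegative polynomial in t, so its discriminant is
  not positive. The degenerate case of leading coefficient 0 is treated apart.\<close>

lemma L2_cauchy_schwarz_norm:
  assumes "f \<in> L2 M" "g \<in> L2 M"
  shows "(\<integral>x. cmod (f x * g x) \<partial>M) \<le> L2_norm M f * L2_norm M g"
proof -
  define a where "a = (\<integral>x. (cmod (f x))\<^sup>2 \<partial>M)"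
  define b where "b = (\<integral>x. (cmod (g x))\<^sup>2 \<partial>M)"
  define c where "c = (\<integral>x. cmod (f x * g x) \<partial>M)"
  note int = L2_integrable[OF assms(1)] L2_integrable[OF assms(2)]
    integrable_norm[OF L2_mult_integrable[OF assms]]
  have a0: "a \<ge> 0" and b0: "b \<ge> 0" and c0: "c \<ge> 0" by (simp_all add: a_def b_def c_def)
  have quad: "0 \<le> a * t\<^sup>2 - 2 * t * c + b" for t
  proof -
    have "0 \<le> (\<integral>x. (t * cmod (f x) - cmod (g x))\<^sup>2 \<partial>M)" by simp
    also have "\<dots> = (\<integral>x. t\<^sup>2 * (cmod (f x))\<^sup>2 - 2 * t * cmod (f x * g x) + (cmod (g x))\<^sup>2 \<partial>M)"
      by (intro Bochner_Integration.integral_cong refl)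
        (simp add: norm_mult power2_eq_square algebra_simps)
    also have "\<dots> = t\<^sup>2 * a - 2 * t * c + b"
      unfolding a_def b_def c_def using int by simp
    finally show ?thesis by (simp add: mult.commute)
  qed
  have "c\<^sup>2 \<le> a * b"
  proof (cases "a = 0")
    case True
    have "c = 0"
    proof (rule ccontr)
      assume "c \<noteq> 0"
      \<comment> \<open>At this t the polynomial, linear since a = 0, takes the value -1.\<close>
      then show False using quad[of "(b + 1) / (2 * c)"] True by simp
    qed
    then show ?thesis using a0 b0 by simp
  next
    case False
    have "0 \<le> a * (a * (c / a)\<^sup>2 - 2 * (c / a) * c + b)" using quad[of "c / a"] a0 by (intro mult_nonneg_nonneg)
    also have "\<dots> = a * b - c\<^sup>2" using False by (simp add: field_simps power2_eq_square)
    finally show ?thesis by simp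
  qed
  then have "sqrt (c\<^sup>2) \<le> sqrt (a * b)" by (rule real_sqrt_le_mono)
  then show ?thesis using c0 unfolding a_def b_def c_def L2_norm_def by (simp add: real_sqrt_mult)
qed

lemma L2_cauchy_schwarz:
  assumes "f \<in> L2 M" "g \<in> L2 M"
  shows "cmod (\<integral>x. f x * g x \<partial>M) \<le> L2_norm M f * L2_norm M g"
  using integral_norm_bound[of M "\<lambda>x. f x * g x"] L2_cauchy_schwarz_norm[OF assms] by (rule order_trans)

lemma L2_norm_triangle:
  assumes "f \<in> L2 M" "g \<in> L2 M"
  shows "L2_norm M (\<lambda>x. f x + g x) \<le> L2_norm M f + L2_norm M g"
proof -
  note int = L2_integrable[OF assms(1)] L2_integrable[OF assms(2)]
    integrable_norm[OF L2_mult_integrable[OF assms]] L2_integrable[OF L2_add[OF assms]]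
  have "(L2_norm M (\<lambda>x. f x + g x))\<^sup>2
      \<le> (\<integral>x. (cmod (f x))\<^sup>2 + 2 * cmod (f x * g x) + (cmod (g x))\<^sup>2 \<partial>M)"
    unfolding L2_norm_power2
  proof (rule integral_mono)
    fix x
    have "(cmod (f x + g x))\<^sup>2 \<le> (cmod (f x) + cmod (g x))\<^sup>2" by (intro power_mono norm_triangle_ineq) simp
    then show "(cmod (f x + g x))\<^sup>2 \<le> (cmod (f x))\<^sup>2 + 2 * cmod (f x * g x) + (cmod (g x))\<^sup>2"
      by (simp add: norm_mult power2_eq_square algebra_simps)
  qed (use int in auto)
  also have "\<dots> = (L2_norm M f)\<^sup>2 + 2 * (\<integral>x. cmod (f x * g x) \<partial>M) + (L2_norm M g)\<^sup>2"
    unfolding L2_norm_power2 using int by simp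
  also have "\<dots> \<le> (L2_norm M f)\<^sup>2 + 2 * (L2_norm M f * L2_norm M g) + (L2_norm M g)\<^sup>2"
    using L2_cauchy_schwarz_norm[OF assms] by simp
  also have "\<dots> = (L2_norm M f + L2_norm M g)\<^sup>2" by (simp add: power2_eq_square algebra_simps)
  finally show ?thesis by (rule power2_le_imp_le) simp
qed

section \<open>Limits in L2\<close>

lemma L2_norm_minus_commute: "L2_norm M (\<lambda>x. f x - g x) = L2_norm M (\<lambda>x. g x - f x)"
  unfolding L2_norm_def by (simp add: norm_minus_commute)

lemma L2_norm_triangle_diff:
  assumes "f \<in> L2 M" "g \<in> L2 M" "h \<in> L2 M"
  shows "L2_norm M (\<lambda>x. f x - h x) \<le> L2_norm M (\<lambda>x. f x - g x) + L2_norm M (\<lambda>x. g x - h x)"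
  using L2_norm_triangle[OF L2_diff[OF assms(1,2)] L2_diff[OF assms(2,3)]] by simp

lemma L2_norm_eq_0_AE:
  assumes "f \<in> L2 M" "L2_norm M f = 0"
  shows "AE x in M. f x = 0"
proof -
  have "(\<integral>x. (cmod (f x))\<^sup>2 \<partial>M) = 0" using assms(2) by (simp add: L2_norm_def)
  then have "AE x in M. (cmod (f x))\<^sup>2 = 0"
    by (subst (asm) integral_nonneg_eq_0_iff_AE[OF L2_integrable[OF assms(1)]]) auto
  then show ?thesis by eventually_elim simp
qed

lemma L2_norm_cong_AE:
  assumes "f \<in> borel_measurable M" "g \<in> borel_measurable M" "AE x in M. f x = g x"
  shows "L2_norm M f = L2_norm M g"
  unfolding L2_norm_def using assms by (intro arg_cong[of _ _ sqrt] integral_cong_AE) auto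

text \<open>Functions are not identified modulo null sets, so limits agree only almost everywhere.
  Allowing two different approximating sequences is what makes an extension by continuity
  independent of the approximation.\<close>

lemma L2_limit_unique_AE:
  assumes "\<And>n. fs n \<in> L2 M" "\<And>n. hs n \<in> L2 M" "f \<in> L2 M" "g \<in> L2 M"
    and "L2_limit M fs f" "L2_limit M hs g" "(\<lambda>n. L2_norm M (\<lambda>x. fs n x - hs n x)) \<longlonglongrightarrow> 0"
  shows "AE x in M. f x = g x"
proof -
  have le: "L2_norm M (\<lambda>x. f x - g x) \<le> L2_norm M (\<lambda>x. fs n x - f x)
      + L2_norm M (\<lambda>x. fs n x - hs n x) + L2_norm M (\<lambda>x. hs n x - g x)" for n
    using L2_norm_triangle_diff[OF assms(3) assms(1)[of n] assms(4)]
      L2_norm_triangle_diff[OF assms(1)[of n] assms(2)[of n] assms(4)]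
      L2_norm_minus_commute[of M f "fs n"] by linarith
  have "(\<lambda>n. L2_norm M (\<lambda>x. fs n x - f x)
      + L2_norm M (\<lambda>x. fs n x - hs n x) + L2_norm M (\<lambda>x. hs n x - g x)) \<longlonglongrightarrow> 0 + 0 + 0"
    using assms(5-7) unfolding L2_limit_iff by (intro tendsto_add)
  from LIMSEQ_le_const[OF this] have "L2_norm M (\<lambda>x. f x - g x) \<le> 0" using le by auto
  then have "L2_norm M (\<lambda>x. f x - g x) = 0" by (simp add: antisym)
  from L2_norm_eq_0_AE[OF L2_diff[OF assms(3,4)] this] show ?thesis by simp
qed

lemma L2_limit_integral_mult:
  assumes "\<And>n. fs n \<in> L2 M" "f \<in> L2 M" "g \<in> L2 M" "L2_limit M fs f"
  shows "(\<lambda>n. \<integral>x. fs n x * g x \<partial>M) \<longlonglongrightarrow> (\<integral>x. f x * g x \<partial>M)"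
proof (rule LIM_zero_cancel, rule tendsto_norm_zero_cancel,
    rule tendsto_sandwich[of "\<lambda>_. 0" _ _ "\<lambda>n. L2_norm M (\<lambda>x. fs n x - f x) * L2_norm M g"])
  show "\<forall>\<^sub>F n in sequentially. norm ((\<integral>x. fs n x * g x \<partial>M) - (\<integral>x. f x * g x \<partial>M))
      \<le> L2_norm M (\<lambda>x. fs n x - f x) * L2_norm M g"
  proof (rule always_eventually, rule allI)
    fix n
    have "(\<integral>x. fs n x * g x \<partial>M) - (\<integral>x. f x * g x \<partial>M) = (\<integral>x. (fs n x - f x) * g x \<partial>M)"
      using L2_mult_integrable[OF assms(1)[of n] assms(3)] L2_mult_integrable[OF assms(2,3)]
      by (simp add: left_diff_distrib)
    then show "norm ((\<integral>x. fs n x * g x \<partial>M) - (\<integral>x. f x * g x \<partial>M))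
      \<le> L2_norm M (\<lambda>x. fs n x - f x) * L2_norm M g"
      using L2_cauchy_schwarz[OF L2_diff[OF assms(1)[of n] assms(2)] assms(3)] by simp
  qed
  show "(\<lambda>n. L2_norm M (\<lambda>x. fs n x - f x) * L2_norm M g) \<longlonglongrightarrow> 0"
    using tendsto_mult_left_zero[OF assms(4)[unfolded L2_limit_iff]] .
qed auto

text \<open>Dominated convergence with majorant |f|^2. The sets need not increase; each point only
  has to lie in all but finitely many of them.\<close>

lemma L2_truncate:
  assumes f: "f \<in> L2 M" and S: "\<And>n. S n \<in> sets M"
    and ev: "\<And>x. x \<in> space M \<Longrightarrow> eventually (\<lambda>n. x \<in> S n) sequentially"
  shows "(\<lambda>x. indicator (S n) x * f x) \<in> L2 M"
    and "L2_limit M (\<lambda>n x. indicator (S n) x * f x) f"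
proof -
  note [measurable] = L2_measurable[OF f] S
  have sq: "(cmod (indicator (S n) x * f x - f x))\<^sup>2 \<le> (cmod (f x))\<^sup>2"
    "(cmod (indicator (S n) x * f x))\<^sup>2 \<le> (cmod (f x))\<^sup>2" for n x
    by (auto simp: indicator_def)
  show "(\<lambda>x. indicator (S n) x * f x) \<in> L2 M"
    unfolding L2_def
  proof (intro CollectI conjI)
    show "integrable M (\<lambda>x. (cmod (indicator (S n) x * f x))\<^sup>2)"
      by (rule Bochner_Integration.integrable_bound[OF L2_integrable[OF f]]) (use sq in auto)
  qed measurable
  have "(\<lambda>n. \<integral>x. (cmod (indicator (S n) x * f x - f x))\<^sup>2 \<partial>M) \<longlonglongrightarrow> (\<integral>x. 0 \<partial>M)"
  proof (rule integral_dominated_convergence[where w = "\<lambda>x. (cmod (f x))\<^sup>2"])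
    show "AE x in M. (\<lambda>n. (cmod (indicator (S n) x * f x - f x))\<^sup>2) \<longlonglongrightarrow> 0"
    proof (rule AE_I2)
      fix x assume "x \<in> space M"
      from ev[OF this] have "\<forall>\<^sub>F n in sequentially. (cmod (indicator (S n) x * f x - f x))\<^sup>2 = 0"
        by eventually_elim simp
      then show "(\<lambda>n. (cmod (indicator (S n) x * f x - f x))\<^sup>2) \<longlonglongrightarrow> 0" by (rule tendsto_eventually)
    qed
  qed (use L2_integrable[OF f] sq in auto)
  then show "L2_limit M (\<lambda>n x. indicator (S n) x * f x) f" unfolding L2_limit_def by simp
qed

lemma L2_norm_nn_integral:
  assumes "f \<in> borel_measurable M" "(\<integral>\<^sup>+x. ennreal ((cmod (f x))\<^sup>2) \<partial>M) \<le> ennreal C" "C \<ge> 0"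
  shows "f \<in> L2 M" and "(L2_norm M f)\<^sup>2 \<le> C"
proof -
  have int: "integrable M (\<lambda>x. (cmod (f x))\<^sup>2)"
    using assms(1,2) by (intro integrableI_bounded) (auto intro: order.strict_trans1 ennreal_less_top)
  then show "f \<in> L2 M" using assms(1) by (simp add: L2_def)
  have "ennreal ((L2_norm M f)\<^sup>2) \<le> ennreal C"
    unfolding L2_norm_power2 using nn_integral_eq_integral[OF int] assms(2) by simp
  then show "(L2_norm M f)\<^sup>2 \<le> C" using assms(3) by simp
qed

lemma nn_integral_L2_norm:
  assumes "f \<in> L2 M"
  shows "(\<integral>\<^sup>+x. ennreal ((cmod (f x))\<^sup>2) \<partial>M) = ennreal ((L2_norm M f)\<^sup>2)"
  unfolding L2_norm_power2 by (rule nn_integral_eq_integral[OF L2_integrable[OF assms]]) simp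

text \<open>Along a subsequence the consecutive differences \<open>d\<^sub>k\<close> satisfy \<open>\<parallel>d\<^sub>k\<parallel>\<^sup>2 \<le> 4\<^sup>-\<^sup>k\<close>, so that
  \<open>\<Sum>\<^sub>k 2\<^sup>k |d\<^sub>k|\<^sup>2\<close> is integrable and \<open>|d\<^sub>k|\<close> decays geometrically almost everywhere.\<close>

lemma L2_complete:
  assumes fs: "\<And>n. fs n \<in> L2 M"
    and cauchy: "\<And>e. e > 0 \<Longrightarrow> \<exists>N. \<forall>m\<ge>N. \<forall>n\<ge>N. L2_norm M (\<lambda>x. fs m x - fs n x) < e"
  obtains g where "g \<in> L2 M" "L2_limit M fs g"
proof -
  note [measurable] = L2_measurable[OF fs]
  have "\<forall>k. \<exists>N. \<forall>m\<ge>N. \<forall>n\<ge>N. L2_norm M (\<lambda>x. fs m x - fs n x) < (1/2)^k"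
    using cauchy by simp
  then obtain N where N: "\<And>k m n. m \<ge> N k \<Longrightarrow> n \<ge> N k \<Longrightarrow> L2_norm M (\<lambda>x. fs m x - fs n x) < (1/2)^k"
    by metis
  \<comment> \<open>Partial sums dominate every earlier term of \<open>N\<close>, so
    \<open>r j\<close> is at least \<open>N k\<close> for all j \<ge> k; in particular both indices
    in \<open>d k\<close> are beyond \<open>N k\<close>.\<close>
  define r where "r k = (\<Sum>i\<le>k. N i)" for k
  have rN: "r k \<ge> N k" for k unfolding r_def by (rule member_le_sum) auto
  have r_Suc: "r (Suc k) \<ge> N k" for k using rN[of k] by (simp add: r_def)
  define d where "d k x = fs (r (Suc k)) x - fs (r k) x" for k x
  have d: "L2_norm M (d k) < (1/2)^k" for k
    unfolding d_def using N rN r_Suc by blast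
  have d_L2: "d k \<in> L2 M" for k unfolding d_def[abs_def] by (intro L2_diff fs)
  note [measurable] = L2_measurable[OF d_L2]
  have "(\<integral>\<^sup>+x. (\<Sum>k. ennreal (2^k * (cmod (d k x))\<^sup>2)) \<partial>M) = (\<Sum>k. \<integral>\<^sup>+x. ennreal (2^k * (cmod (d k x))\<^sup>2) \<partial>M)"
    by (rule nn_integral_suminf) measurable
  also have "\<dots> \<le> (\<Sum>k. ennreal ((1/2)^k))"
  proof (intro suminf_le summableI)
    fix k
    have "(\<integral>\<^sup>+x. ennreal (2^k * (cmod (d k x))\<^sup>2) \<partial>M) = ennreal (2^k) * (\<integral>\<^sup>+x. ennreal ((cmod (d k x))\<^sup>2) \<partial>M)"
      by (subst nn_integral_cmult[symmetric]) (auto simp: ennreal_mult)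
    also have "\<dots> = ennreal (2^k * (L2_norm M (d k))\<^sup>2)"
      by (simp add: nn_integral_L2_norm[OF d_L2] ennreal_mult)
    also have "\<dots> \<le> ennreal (2^k * ((1/2)^k)\<^sup>2)"
      by (intro ennreal_leI mult_left_mono power_mono less_imp_le[OF d]) auto
    also have "2^k * ((1/2)^k)\<^sup>2 = ((1/2)^k :: real)"
      by (simp add: power2_eq_square power_one_over)
    finally show "(\<integral>\<^sup>+x. ennreal (2^k * (cmod (d k x))\<^sup>2) \<partial>M) \<le> ennreal ((1/2)^k)" .
  qed
  also have "\<dots> < \<infinity>"
    by (subst suminf_ennreal_eq[where x = 2]) (use geometric_sums[of "1/2::real"] in auto)
  finally have "(\<integral>\<^sup>+x. (\<Sum>k. ennreal (2^k * (cmod (d k x))\<^sup>2)) \<partial>M) \<noteq> \<infinity>" by simp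
  then have AEfin: "AE x in M. (\<Sum>k. ennreal (2^k * (cmod (d k x))\<^sup>2)) \<noteq> \<infinity>"
    by (intro nn_integral_noteq_infinite) measurable
  define g where "g x = lim (\<lambda>k. fs (r k) x)" for x
  have [measurable]: "g \<in> borel_measurable M" unfolding g_def[abs_def] by measurable
  have AElim: "AE x in M. (\<lambda>k. fs (r k) x) \<longlonglongrightarrow> g x"
    using AEfin
  proof eventually_elim
    fix x assume fin: "(\<Sum>k. ennreal (2^k * (cmod (d k x))\<^sup>2)) \<noteq> \<infinity>"
    have sm: "summable (\<lambda>k. 2^k * (cmod (d k x))\<^sup>2)"
      by (rule summable_suminf_not_top) (use fin in auto)
    then obtain C where C: "\<And>k. 2^k * (cmod (d k x))\<^sup>2 \<le> C"
      using convergent_imp_Bseq[OF convergentI[OF summable_LIMSEQ_zero[OF sm]]]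
      unfolding Bseq_def by auto
    have "cmod (d k x) \<le> sqrt C * (sqrt (1/2)) ^ k" for k
    proof -
      have "(cmod (d k x))\<^sup>2 \<le> C * (1/2)^k" using C[of k] by (simp add: field_simps)
      then have "sqrt ((cmod (d k x))\<^sup>2) \<le> sqrt (C * (1/2)^k)" by (rule real_sqrt_le_mono)
      then show ?thesis by (simp add: real_sqrt_mult real_sqrt_power)
    qed
    moreover have "summable (\<lambda>k. sqrt C * (sqrt (1/2)) ^ k)"
      by (intro summable_mult summable_geometric) simp
    ultimately have "summable (\<lambda>k. d k x)" by (rule summable_comparison_test'[where N = 0, rotated])
    then have "convergent (\<lambda>n. \<Sum>k<n. d k x)" by (simp add: summable_iff_convergent)
    moreover have "(\<Sum>k<n. d k x) = fs (r n) x - fs (r 0) x" for n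
      unfolding d_def by (rule sum_lessThan_telescope)
    ultimately have "convergent (\<lambda>n. fs (r n) x - fs (r 0) x)" by simp
    then have "convergent (\<lambda>n. fs (r n) x)"
      using convergent_add[OF _ convergent_const[of "fs (r 0) x"]] by fastforce
    then show "(\<lambda>k. fs (r k) x) \<longlonglongrightarrow> g x" unfolding g_def by (simp add: convergent_LIMSEQ_iff)
  qed
  \<comment> \<open>Fatou's lemma along the subsequence bounds the distance from \<open>fs m\<close>
    to the limit for arbitrary m, which upgrades convergence of a subsequence to convergence of the
    whole sequence.\<close>
  have bound: "(\<integral>\<^sup>+x. ennreal ((cmod (fs m x - g x))\<^sup>2) \<partial>M) \<le> ennreal (e\<^sup>2)"
    if e: "e > 0" and NN: "\<And>j. j \<ge> J \<Longrightarrow> L2_norm M (\<lambda>x. fs m x - fs (r j) x) < e" for m J e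
  proof -
    have "(\<integral>\<^sup>+x. ennreal ((cmod (fs m x - g x))\<^sup>2) \<partial>M)
        = (\<integral>\<^sup>+x. liminf (\<lambda>j. ennreal ((cmod (fs m x - fs (r j) x))\<^sup>2)) \<partial>M)"
    proof (rule nn_integral_cong_AE)
      show "AE x in M. ennreal ((cmod (fs m x - g x))\<^sup>2) = liminf (\<lambda>j. ennreal ((cmod (fs m x - fs (r j) x))\<^sup>2))"
        using AElim
      proof eventually_elim
        fix x assume "(\<lambda>k. fs (r k) x) \<longlonglongrightarrow> g x"
        then have "(\<lambda>j. ennreal ((cmod (fs m x - fs (r j) x))\<^sup>2)) \<longlonglongrightarrow> ennreal ((cmod (fs m x - g x))\<^sup>2)"
          by (intro tendsto_intros)
        then show "ennreal ((cmod (fs m x - g x))\<^sup>2) = liminf (\<lambda>j. ennreal ((cmod (fs m x - fs (r j) x))\<^sup>2))"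
          by (rule lim_imp_Liminf[OF sequentially_bot, symmetric])
      qed
    qed
    also have "\<dots> \<le> liminf (\<lambda>j. \<integral>\<^sup>+x. ennreal ((cmod (fs m x - fs (r j) x))\<^sup>2) \<partial>M)"
      by (rule nn_integral_liminf) measurable
    also have "\<dots> \<le> ennreal (e\<^sup>2)"
    proof (rule Liminf_le)
      have "(\<integral>\<^sup>+x. ennreal ((cmod (fs m x - fs (r j) x))\<^sup>2) \<partial>M) \<le> ennreal (e\<^sup>2)" if "j \<ge> J" for j
        unfolding nn_integral_L2_norm[OF L2_diff[OF fs fs]]
        using NN[OF that] by (intro ennreal_leI power_mono) auto
      then show "\<forall>\<^sub>F j in sequentially. (\<integral>\<^sup>+x. ennreal ((cmod (fs m x - fs (r j) x))\<^sup>2) \<partial>M) \<le> ennreal (e\<^sup>2)"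
        unfolding eventually_sequentially by blast
    qed simp
    finally show ?thesis .
  qed
  have r_ge: "\<exists>J. \<forall>j\<ge>J. r j \<ge> N k" for k
  proof (intro exI allI impI)
    fix j assume "j \<ge> k"
    then show "r j \<ge> N k" unfolding r_def by (intro member_le_sum) auto
  qed
  have bnd: "(\<integral>\<^sup>+x. ennreal ((cmod (fs m x - g x))\<^sup>2) \<partial>M) \<le> ennreal (((1/2)^k)\<^sup>2)" if m: "m \<ge> N k" for m k
  proof -
    obtain J where J: "\<And>j. j \<ge> J \<Longrightarrow> r j \<ge> N k" using r_ge[of k] by blast
    show ?thesis by (rule bound[of _ J]) (use N m J in auto)
  qed
  have gL2: "g \<in> L2 M"
  proof -
    have "(\<lambda>x. fs (N 0) x - g x) \<in> L2 M"
      by (rule L2_norm_nn_integral(1)[OF _ bnd[of 0 "N 0"]]) auto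
    from L2_diff[OF fs[of "N 0"] this] show ?thesis by simp
  qed
  have "L2_limit M fs g"
    unfolding L2_limit_iff
  proof (rule LIMSEQ_I)
    fix e :: real assume "e > 0"
    then obtain k where k: "(1/2)^k < e" using real_arch_pow_inv[of e "1/2"] by auto
    have "norm (L2_norm M (\<lambda>x. fs m x - g x) - 0) < e" if "m \<ge> N k" for m
    proof -
      have "(L2_norm M (\<lambda>x. fs m x - g x))\<^sup>2 \<le> ((1/2)^k)\<^sup>2"
        by (rule L2_norm_nn_integral(2)[OF _ bnd[OF that]]) auto
      then have "L2_norm M (\<lambda>x. fs m x - g x) \<le> (1/2)^k" by (rule power2_le_imp_le) simp
      then show ?thesis using k by simp
    qed
    then show "\<exists>N. \<forall>m\<ge>N. norm (L2_norm M (\<lambda>x. fs m x - g x) - 0) < e" by blast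
  qed
  then show ?thesis using gL2 that by blast
qed

section \<open>The Plancherel inequality\<close>

lemma lborel_uminus: "distr lborel borel uminus = (lborel :: 'a::euclidean_space measure)"
  using lborel_affine[of "-1" "0::'a"] by (simp add: density_1)

lemma lborel_prod_euclidean:
  fixes f :: "'a::euclidean_space \<Rightarrow> real \<Rightarrow> complex"
  assumes "\<And>b. b \<in> Basis \<Longrightarrow> integrable lborel (f b)"
  shows lborel_integrable_prod: "integrable lborel (\<lambda>X::'a. \<Prod>b\<in>Basis. f b (X \<bullet> b))"
    and lborel_integral_prod: "(\<integral>X. (\<Prod>b\<in>Basis. f b ((X::'a) \<bullet> b)) \<partial>lborel) = (\<Prod>b\<in>Basis. \<integral>t. f b t \<partial>lborel)"
proof -
  interpret product_sigma_finite "\<lambda>_::'a. lborel :: real measure" by standard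
  define S where "S = (\<lambda>u. \<Sum>b\<in>Basis. u b *\<^sub>R (b::'a))"
  have [measurable]: "S \<in> (\<Pi>\<^sub>M b\<in>Basis. lborel) \<rightarrow>\<^sub>M borel" unfolding S_def by measurable
  have [measurable]: "f b \<in> borel_measurable borel" if "b \<in> Basis" for b
    using assms[OF that] by (auto dest: borel_measurable_integrable)
  have eq: "(\<Prod>b\<in>Basis. f b (S u \<bullet> b)) = (\<Prod>b\<in>Basis. f b (u b))" for u
    by (intro prod.cong refl) (simp add: S_def inner_sum_left inner_Basis if_distrib cong: if_cong)
  have m: "(\<lambda>X::'a. \<Prod>b\<in>Basis. f b (X \<bullet> b)) \<in> borel_measurable borel" by measurable
  have lb: "lborel = distr (\<Pi>\<^sub>M b\<in>Basis. lborel) borel S" unfolding S_def by (rule lborel_eq)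
  have int: "integrable (\<Pi>\<^sub>M b\<in>Basis. lborel) (\<lambda>u. \<Prod>b\<in>Basis. f b (u b))"
    by (rule product_integrable_prod) (use assms in auto)
  show "integrable lborel (\<lambda>X::'a. \<Prod>b\<in>Basis. f b (X \<bullet> b))"
    unfolding lb using int by (subst integrable_distr_eq) (auto simp: eq)
  have "(\<integral>X. (\<Prod>b\<in>Basis. f b ((X::'a) \<bullet> b)) \<partial>lborel) = (\<integral>u. (\<Prod>b\<in>Basis. f b (u b)) \<partial>(\<Pi>\<^sub>M b\<in>Basis. lborel))"
    unfolding lb by (subst integral_distr) (auto simp: eq)
  also have "\<dots> = (\<Prod>b\<in>Basis. \<integral>t. f b t \<partial>lborel)"
    by (rule product_integral_prod) (use assms in auto)
  finally show "(\<integral>X. (\<Prod>b\<in>Basis. f b ((X::'a) \<bullet> b)) \<partial>lborel) = (\<Prod>b\<in>Basis. \<integral>t. f b t \<partial>lborel)" .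
qed

text \<open>The characteristic function of the standard normal law at t / s, after the substitution
  x to s x. The result is written through \<open>std_normal_density\<close> so that it is visibly a
  multiple of a probability density.\<close>

lemma gaussian_fourier_1d:
  assumes s: "s > 0"
  shows "integrable lborel (\<lambda>x. complex_of_real (exp (- (s * x)\<^sup>2 / 2)) * cis (t * x))"
    and "(\<integral>x. complex_of_real (exp (- (s * x)\<^sup>2 / 2)) * cis (t * x) \<partial>lborel)
      = complex_of_real (2 * pi / s * std_normal_density (t / s))"
proof -
  have "char std_normal_distribution (t / s) = complex_of_real (exp (- ((t / s)\<^sup>2) / 2))"
    by (simp add: char_std_normal_distribution)
  moreover have "char std_normal_distribution (t / s)
     = (\<integral>x. complex_of_real (std_normal_density x) * cis (t / s * x) \<partial>lborel)"
    unfolding char_def by (subst integral_density) (auto simp: cis_conv_exp scaleR_conv_of_real)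
  ultimately have base: "(\<integral>x. complex_of_real (std_normal_density x) * cis (t / s * x) \<partial>lborel)
     = complex_of_real (exp (- ((t / s)\<^sup>2) / 2))" by simp
  have intb: "integrable lborel (\<lambda>x. complex_of_real (std_normal_density x) * cis (t / s * x))"
  proof (rule Bochner_Integration.integrable_bound[OF integrable_normal_density[of 1 0]])
    show "(\<lambda>x. complex_of_real (std_normal_density x) * cis (t / s * x)) \<in> borel_measurable lborel"
      unfolding cis_conv_exp by measurable
  qed (auto simp: norm_mult)
  have e: "complex_of_real (exp (- (s * x)\<^sup>2 / 2)) * cis (t * x)
     = complex_of_real (sqrt (2 * pi)) * (complex_of_real (std_normal_density (0 + s * x)) * cis (t / s * (0 + s * x)))" for x
    using s by (simp add: std_normal_density_def)
  show "integrable lborel (\<lambda>x. complex_of_real (exp (- (s * x)\<^sup>2 / 2)) * cis (t * x))"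
    unfolding e using s
    by (intro integrable_mult_right impI lborel_integrable_real_affine[OF intb]) auto
  have "complex_of_real (exp (- ((t / s)\<^sup>2) / 2)) = \<bar>s\<bar> *\<^sub>R (\<integral>x. complex_of_real (std_normal_density (0 + s * x)) * cis (t / s * (0 + s * x)) \<partial>lborel)"
    unfolding base[symmetric] using s by (intro lborel_integral_real_affine) simp
  then have "(\<integral>x. complex_of_real (std_normal_density (0 + s * x)) * cis (t / s * (0 + s * x)) \<partial>lborel)
      = complex_of_real (exp (- ((t / s)\<^sup>2) / 2) / s)"
    using s by (simp add: scaleR_conv_of_real field_simps)
  moreover have "sqrt (2 * pi) * (exp (- ((t / s)\<^sup>2) / 2) / s) = 2 * pi / s * std_normal_density (t / s)"
  proof -
    have alg: "p * (E / s) = p * p / s * (1 / p * E)" if "p > 0" for p E :: real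
      using that s by (simp add: field_simps)
    have "sqrt (2 * pi) * sqrt (2 * pi) = 2 * pi" by simp
    then show ?thesis unfolding std_normal_density_def using alg[of "sqrt (2 * pi)"] by simp
  qed
  ultimately show "(\<integral>x. complex_of_real (exp (- (s * x)\<^sup>2 / 2)) * cis (t * x) \<partial>lborel)
      = complex_of_real (2 * pi / s * std_normal_density (t / s))"
    unfolding e integral_mult_right_zero by (metis of_real_mult)
qed

text \<open>This is exp (- s^2 |X|^2 / 2), written as a product over the basis so that its integrals
  factor.\<close>

definition gauss :: "real \<Rightarrow> 'a::euclidean_space \<Rightarrow> real" where
  "gauss s X = (\<Prod>b\<in>Basis. exp (- (s * (X \<bullet> b))\<^sup>2 / 2))"

text \<open>For s > 0 this is the Fourier transform of \<open>gauss s\<close> for the kernel e^(-2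
  pi i Y \<bullet> X), and also the density of independent centred normal coordinates of standard
  deviation s / (2 pi).\<close>

definition gauss_hat :: "real \<Rightarrow> 'a::euclidean_space \<Rightarrow> real" where
  "gauss_hat s Y = (\<Prod>b\<in>Basis. 2 * pi / s * std_normal_density (2 * pi * (Y \<bullet> b) / s))"

lemma gauss_bounds: "0 \<le> gauss s X" "gauss s X \<le> 1"
  by (auto simp: gauss_def intro!: prod_nonneg prod_le_1)

lemma gauss_measurable [measurable]: "gauss s \<in> borel_measurable borel"
  unfolding gauss_def[abs_def] by measurable

lemma gauss_hat_nonneg: "s > 0 \<Longrightarrow> 0 \<le> gauss_hat s Y"
  by (auto simp: gauss_hat_def intro!: prod_nonneg)

lemma gauss_hat_measurable [measurable]: "gauss_hat s \<in> borel_measurable borel"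
  unfolding gauss_hat_def[abs_def] by measurable

lemma gauss_hat_uminus: "gauss_hat s (- Y) = gauss_hat s Y"
  by (simp add: gauss_hat_def std_normal_density_def)

lemma cis_inner: "cis (c * (X \<bullet> Y)) = (\<Prod>b\<in>Basis. cis (c * (Y \<bullet> b) * (X \<bullet> b)))" for X Y :: "'a::euclidean_space"
proof -
  have "(\<Prod>b\<in>I. cis (h b)) = cis (\<Sum>b\<in>I. h b)" for I :: "'a set" and h
    by (induction I rule: infinite_finite_induct) (auto simp: cis_mult)
  moreover have "c * (X \<bullet> Y) = (\<Sum>b\<in>Basis. c * (Y \<bullet> b) * (X \<bullet> b))"
    by (subst euclidean_inner) (simp add: sum_distrib_left mult_ac)
  ultimately show ?thesis by simp
qed

lemma gauss_fourier:
  fixes Y :: "'a::euclidean_space"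
  assumes s: "s > 0"
  shows "(\<integral>X. complex_of_real (gauss s X) * cis (- 2 * pi * (Y \<bullet> X)) \<partial>lborel) = complex_of_real (gauss_hat s Y)"
proof -
  have "(\<lambda>X. complex_of_real (gauss s X) * cis (- 2 * pi * (Y \<bullet> X)))
     = (\<lambda>X. \<Prod>b\<in>Basis. complex_of_real (exp (- (s * (X \<bullet> b))\<^sup>2 / 2)) * cis ((- 2 * pi * (Y \<bullet> b)) * (X \<bullet> b)))"
    unfolding gauss_def of_real_prod prod.distrib inner_commute[of Y] cis_inner[of "- 2 * pi" _ Y] ..
  then have "(\<integral>X. complex_of_real (gauss s X) * cis (- 2 * pi * (Y \<bullet> X)) \<partial>lborel)
     = (\<Prod>b\<in>(Basis::'a set). \<integral>x. complex_of_real (exp (- (s * x)\<^sup>2 / 2)) * cis ((- 2 * pi * (Y \<bullet> b)) * x) \<partial>lborel)"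
    by (simp only:) (rule lborel_integral_prod, rule gaussian_fourier_1d(1)[OF s])
  also have "\<dots> = complex_of_real (gauss_hat s Y)"
    unfolding gaussian_fourier_1d(2)[OF s] gauss_hat_def by (simp add: std_normal_density_def)
  finally show ?thesis .
qed

lemma gauss_integrable:
  assumes "s > 0"
  shows "integrable lborel (gauss s :: 'a::euclidean_space \<Rightarrow> real)"
proof -
  have "integrable lborel (\<lambda>X::'a. \<Prod>b\<in>Basis. complex_of_real (exp (- (s * (X \<bullet> b))\<^sup>2 / 2)) * cis (0 * (X \<bullet> b)))"
    by (rule lborel_integrable_prod, rule gaussian_fourier_1d(1)[OF assms])
  then have "integrable lborel (\<lambda>X::'a. complex_of_real (gauss s X))" by (simp add: gauss_def)
  from integrable_Re[OF this] show ?thesis by simp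
qed

text \<open>An affine substitution in each coordinate, then translation invariance; the second form
  follows because the density is even. Both are needed, since the Plancherel estimate integrates out
  either variable.\<close>

lemma nn_integral_gauss_hat:
  fixes Y Z :: "'a::euclidean_space"
  assumes s: "s > 0"
  shows "(\<integral>\<^sup>+Y. ennreal (gauss_hat s (Y - Z)) \<partial>lborel) = 1"
    and "(\<integral>\<^sup>+Z. ennreal (gauss_hat s (Y - Z)) \<partial>lborel) = 1"
proof -
  have one: "(\<integral>\<^sup>+y. ennreal (2 * pi / s * std_normal_density (2 * pi * y / s)) \<partial>lborel) = 1"
  proof -
    have "(\<integral>\<^sup>+y. ennreal (std_normal_density y) \<partial>lborel) = 1"
      by (subst nn_integral_eq_integral) auto
    also have "(\<integral>\<^sup>+y. ennreal (std_normal_density y) \<partial>lborel)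
       = ennreal \<bar>2 * pi / s\<bar> * (\<integral>\<^sup>+y. ennreal (std_normal_density (0 + (2 * pi / s) * y)) \<partial>lborel)"
      using s by (intro nn_integral_real_affine) auto
    also have "\<dots> = (\<integral>\<^sup>+y. ennreal (2 * pi / s * std_normal_density (2 * pi * y / s)) \<partial>lborel)"
      using s by (subst nn_integral_cmult[symmetric]) (auto simp: ennreal_mult'[symmetric])
    finally show ?thesis by simp
  qed
  have int: "(\<integral>\<^sup>+Y. ennreal (gauss_hat s (Y::'a)) \<partial>lborel) = 1"
  proof -
    have "(\<integral>\<^sup>+Y. ennreal (gauss_hat s (Y::'a)) \<partial>lborel)
      = (\<integral>\<^sup>+Y. (\<Prod>b\<in>Basis. ennreal (2 * pi / s * std_normal_density (2 * pi * ((Y::'a) \<bullet> b) / s))) \<partial>lborel)"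
      using s by (simp add: gauss_hat_def prod_ennreal)
    also have "\<dots> = (\<Prod>b\<in>(Basis::'a set). \<integral>\<^sup>+y. ennreal (2 * pi / s * std_normal_density (2 * pi * y / s)) \<partial>lborel)"
      by (rule nn_integral_lborel_prod) auto
    also have "\<dots> = 1" unfolding one by simp
    finally show ?thesis .
  qed
  have tr: "(\<integral>\<^sup>+Y. ennreal (gauss_hat s (Y - Z)) \<partial>lborel) = 1" for Z :: 'a
  proof -
    have "(\<integral>\<^sup>+Y. ennreal (gauss_hat s (Y::'a)) \<partial>lborel) = (\<integral>\<^sup>+Y. ennreal (gauss_hat s (Y::'a)) \<partial>distr lborel borel ((+) (- Z)))"
      by (simp only: lborel_distr_plus)
    also have "\<dots> = (\<integral>\<^sup>+Y. ennreal (gauss_hat s (Y - Z)) \<partial>lborel)"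
      by (subst nn_integral_distr) auto
    finally show ?thesis using int by simp
  qed
  show "(\<integral>\<^sup>+Y. ennreal (gauss_hat s (Y - Z)) \<partial>lborel) = 1" by (rule tr)
  show "(\<integral>\<^sup>+Z. ennreal (gauss_hat s (Y - Z)) \<partial>lborel) = 1"
    using tr[of Y] gauss_hat_uminus[of s "Y - _"] by simp
qed

text \<open>Supplies the hypothesis of Fubini's theorem for product integrands twisted by a kernel
  of modulus at most 1, such as a character.\<close>

lemma integrable_product_bounded:
  fixes f :: "'a \<Rightarrow> complex" and g :: "'b \<Rightarrow> complex"
  assumes "sigma_finite_measure M" "sigma_finite_measure N"
    and f: "integrable M f" and g: "integrable N g"
    and u: "u \<in> borel_measurable (M \<Otimes>\<^sub>M N)" and le: "\<And>x y. cmod (u (x, y)) \<le> 1"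
  shows "integrable (M \<Otimes>\<^sub>M N) (\<lambda>(x, y). f x * g y * u (x, y))"
proof -
  interpret M: sigma_finite_measure M by fact
  interpret N: sigma_finite_measure N by fact
  interpret pair_sigma_finite M N ..
  note [measurable] = borel_measurable_integrable[OF f] borel_measurable_integrable[OF g] u
  have "integrable (M \<Otimes>\<^sub>M N) (\<lambda>p. f (fst p) * g (snd p))"
  proof (rule Fubini_integrable)
    show "integrable M (\<lambda>x. \<integral>y. norm (f (fst (x, y)) * g (snd (x, y))) \<partial>N)"
      using f by (simp add: norm_mult)
    show "AE x in M. integrable N (\<lambda>y. f (fst (x, y)) * g (snd (x, y)))"
      using g by simp
  qed measurable
  then show ?thesis
  proof (rule Bochner_Integration.integrable_bound)
    show "AE p in M \<Otimes>\<^sub>M N. norm (case p of (x, y) \<Rightarrow> f x * g y * u (x, y)) \<le> norm (f (fst p) * g (snd p))"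
      using le by (intro AE_I2) (auto simp: norm_mult intro!: mult_left_le)
  qed measurable
qed

lemma norm_integral_le_nn:
  fixes f :: "'a \<Rightarrow> complex"
  shows "ennreal (norm (\<integral>x. f x \<partial>M)) \<le> (\<integral>\<^sup>+x. ennreal (norm (f x)) \<partial>M)"
  using integral_norm_bound_ennreal[of M f] by (cases "integrable M f") (auto simp: not_integrable_integral_eq)

lemma cis_inner_measurable [measurable]:
  fixes f g :: "'b \<Rightarrow> 'a::euclidean_space"
  assumes [measurable]: "f \<in> borel_measurable M" "g \<in> borel_measurable M"
  shows "(\<lambda>x. cis (c * (f x \<bullet> g x))) \<in> borel_measurable M"
  unfolding cis_conv_exp by measurable

text \<open>Against a Gaussian weight in \<open>X\<close> the squared modulus of the Fourier transform becomes the
  integral of \<open>h(Y) cnj (h(Z))\<close> against a Gaussian probability density in \<open>Y - Z\<close>, which is bounded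
  by \<open>(|h(Y)|\<^sup>2 + |h(Z)|\<^sup>2)/2\<close>; then the weight is removed by Fatou's lemma.\<close>

lemma plancherel_inequality:
  fixes h :: "'a::euclidean_space \<Rightarrow> complex"
  assumes h: "integrable lborel h"
  shows "(\<integral>\<^sup>+X. ennreal ((cmod (\<integral>Y. h Y * cis (- 2 * pi * (Y \<bullet> X)) \<partial>lborel))\<^sup>2) \<partial>lborel)
    \<le> (\<integral>\<^sup>+Y. ennreal ((cmod (h Y))\<^sup>2) \<partial>lborel)"
proof -
  define hat where "hat X = (\<integral>Y. h Y * cis (- 2 * pi * (Y \<bullet> X)) \<partial>lborel)" for X
  have [measurable]: "h \<in> borel_measurable borel" using h by (auto dest: borel_measurable_integrable)
  have [measurable]: "hat \<in> borel_measurable borel"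
  proof -
    have "hat \<in> borel_measurable lborel"
      unfolding hat_def[abs_def]
      by (rule sigma_finite_measure.borel_measurable_lebesgue_integral[OF sigma_finite_lborel]) measurable
    then show ?thesis by simp
  qed
  define C where "C = (\<integral>Y. cmod (h Y) \<partial>lborel)"
  have hatC: "cmod (hat X) \<le> C" for X
    unfolding hat_def C_def
    by (rule order_trans[OF integral_norm_bound]) (simp add: norm_mult)
  have main: "(\<integral>\<^sup>+X. ennreal ((cmod (hat X))\<^sup>2 * gauss s X) \<partial>lborel) \<le> (\<integral>\<^sup>+Y. ennreal ((cmod (h Y))\<^sup>2) \<partial>lborel)"
    if s: "s > 0" for s
  proof -
    \<comment> \<open>Splitting the weighted square as \<open>hat X * k X\<close> with integrable
      \<open>k\<close> leaves the transform inside \<open>hat\<close> free to be expanded, so that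
      Fubini's theorem applies with a character as bounded kernel. The conjugate inside
      \<open>k\<close> is expanded in the same way afterwards.\<close>
    define k where "k X = cnj (hat X) * complex_of_real (gauss s X)" for X
    have [measurable]: "k \<in> borel_measurable borel" unfolding k_def[abs_def] complex_eq_iff
      by (intro borel_measurable_times measurable_compose[OF _ borel_measurable_continuous_onI[of cnj]] continuous_intros) measurable
    have k: "integrable lborel k"
    proof (rule Bochner_Integration.integrable_bound)
      show "integrable lborel (\<lambda>X. C * gauss s X)" by (intro integrable_mult_right gauss_integrable[OF s])
      show "AE X in lborel. norm (k X) \<le> norm (C * gauss s X)"
        using hatC order_trans[OF norm_ge_zero hatC]
        by (intro AE_I2) (auto simp: k_def norm_mult gauss_bounds abs_mult intro!: mult_right_mono)
    qed measurable
    have sq: "complex_of_real ((cmod (hat X))\<^sup>2 * gauss s X) = hat X * k X" for X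
      by (simp add: k_def complex_norm_square del: of_real_power)
    have intsq: "integrable lborel (\<lambda>X. (cmod (hat X))\<^sup>2 * gauss s X)"
    proof (rule Bochner_Integration.integrable_bound)
      show "integrable lborel (\<lambda>X. C\<^sup>2 * gauss s X)" by (intro integrable_mult_right gauss_integrable[OF s])
      show "AE X in lborel. norm ((cmod (hat X))\<^sup>2 * gauss s X) \<le> norm (C\<^sup>2 * gauss s X)"
        by (intro AE_I2) (auto simp: norm_mult gauss_bounds abs_mult intro!: mult_right_mono power_mono hatC)
    qed measurable
    have "complex_of_real (\<integral>X. (cmod (hat X))\<^sup>2 * gauss s X \<partial>lborel) = (\<integral>X. hat X * k X \<partial>lborel)"
      unfolding sq[symmetric] by (rule integral_complex_of_real[symmetric])
    also have "\<dots> = (\<integral>X. \<integral>Y. h Y * k X * cis (- 2 * pi * (Y \<bullet> X)) \<partial>lborel \<partial>lborel)"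
      unfolding hat_def by (subst integral_mult_left_zero[symmetric]) (simp add: mult_ac)
    also have "\<dots> = (\<integral>Y. \<integral>X. h Y * k X * cis (- 2 * pi * (Y \<bullet> X)) \<partial>lborel \<partial>lborel)"
    proof (rule lborel_pair.Fubini_integral)
      show "integrable (lborel \<Otimes>\<^sub>M lborel) (\<lambda>(Y, X). h Y * k X * cis (- 2 * pi * (Y \<bullet> X)))"
        using integrable_product_bounded[OF sigma_finite_lborel sigma_finite_lborel h k
            cis_inner_measurable[of fst "lborel \<Otimes>\<^sub>M lborel" snd "- 2 * pi"]] by simp
    qed
    also have "\<dots> = (\<integral>Y. h Y * (\<integral>X. k X * cis (- 2 * pi * (Y \<bullet> X)) \<partial>lborel) \<partial>lborel)"
      by (simp add: mult.assoc)
    also have "\<dots> = (\<integral>Y. h Y * (\<integral>Z. cnj (h Z) * complex_of_real (gauss_hat s (Y - Z)) \<partial>lborel) \<partial>lborel)"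
    proof (rule Bochner_Integration.integral_cong[OF refl], rule arg_cong2[of _ _ _ _ "(*)", OF refl])
      fix Y :: 'a
      have g: "integrable lborel (\<lambda>X::'a. complex_of_real (gauss s X))"
        by (intro integrable_of_real gauss_integrable[OF s])
      have hc: "integrable lborel (\<lambda>Z. cnj (h Z))" using h by (simp add: integrable_cnj)
      have ch: "cnj (hat X) = (\<integral>Z. cnj (h Z) * cis (2 * pi * (Z \<bullet> X)) \<partial>lborel)" for X
      proof -
        have "(\<integral>Z. cnj (h Z) * cis (2 * pi * (Z \<bullet> X)) \<partial>lborel) = (\<integral>Z. cnj (h Z * cis (- 2 * pi * (Z \<bullet> X))) \<partial>lborel)"
          by (intro Bochner_Integration.integral_cong refl) (simp add: cis_cnj)
        then show ?thesis unfolding hat_def by (simp only: Bochner_Integration.integral_cnj)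
      qed
      have cc: "cis (2 * pi * (Z \<bullet> X)) * cis (- 2 * pi * (Y \<bullet> X)) = cis (- 2 * pi * ((Y - Z) \<bullet> X))" for X Z :: 'a
        by (simp add: cis_mult inner_diff_left algebra_simps)
      have "(\<integral>X. k X * cis (- 2 * pi * (Y \<bullet> X)) \<partial>lborel)
         = (\<integral>X. \<integral>Z. cnj (h Z) * cis (2 * pi * (Z \<bullet> X)) * (complex_of_real (gauss s X) * cis (- 2 * pi * (Y \<bullet> X))) \<partial>lborel \<partial>lborel)"
        unfolding k_def ch by (subst integral_mult_left_zero) (simp add: mult_ac)
      also have "\<dots> = (\<integral>X. \<integral>Z. cnj (h Z) * complex_of_real (gauss s X) * cis (- 2 * pi * ((Y - Z) \<bullet> X)) \<partial>lborel \<partial>lborel)"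
        unfolding cc[symmetric] by (simp only: mult_ac)
      also have "\<dots> = (\<integral>Z. \<integral>X. cnj (h Z) * complex_of_real (gauss s X) * cis (- 2 * pi * ((Y - Z) \<bullet> X)) \<partial>lborel \<partial>lborel)"
      proof (rule lborel_pair.Fubini_integral)
        show "integrable (lborel \<Otimes>\<^sub>M lborel) (\<lambda>(Z, X). cnj (h Z) * complex_of_real (gauss s X) * cis (- 2 * pi * ((Y - Z) \<bullet> X)))"
          using integrable_product_bounded[OF sigma_finite_lborel sigma_finite_lborel hc g
            cis_inner_measurable[of "\<lambda>p. Y - fst p" "lborel \<Otimes>\<^sub>M lborel" snd "- 2 * pi"]] by simp
      qed
      also have "\<dots> = (\<integral>Z. cnj (h Z) * complex_of_real (gauss_hat s (Y - Z)) \<partial>lborel)"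
        unfolding gauss_fourier[OF s, symmetric] integral_mult_right_zero[symmetric] by (simp only: mult.assoc)
      finally show "(\<integral>X. k X * cis (- 2 * pi * (Y \<bullet> X)) \<partial>lborel)
         = (\<integral>Z. cnj (h Z) * complex_of_real (gauss_hat s (Y - Z)) \<partial>lborel)" .
    qed
    finally have eq: "complex_of_real (\<integral>X. (cmod (hat X))\<^sup>2 * gauss s X \<partial>lborel)
       = (\<integral>Y. h Y * (\<integral>Z. cnj (h Z) * complex_of_real (gauss_hat s (Y - Z)) \<partial>lborel) \<partial>lborel)" .
    have "(\<integral>\<^sup>+X. ennreal ((cmod (hat X))\<^sup>2 * gauss s X) \<partial>lborel) = ennreal (\<integral>X. (cmod (hat X))\<^sup>2 * gauss s X \<partial>lborel)"
      by (rule nn_integral_eq_integral[OF intsq]) (simp add: gauss_bounds)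
    also have "\<dots> \<le> ennreal (cmod (complex_of_real (\<integral>X. (cmod (hat X))\<^sup>2 * gauss s X \<partial>lborel)))"
      by (intro ennreal_leI) simp
    also have "\<dots> \<le> (\<integral>\<^sup>+Y. ennreal (norm (h Y * (\<integral>Z. cnj (h Z) * complex_of_real (gauss_hat s (Y - Z)) \<partial>lborel))) \<partial>lborel)"
      unfolding eq by (rule norm_integral_le_nn)
    also have "\<dots> \<le> (\<integral>\<^sup>+Y. \<integral>\<^sup>+Z. ennreal (((cmod (h Y))\<^sup>2 + (cmod (h Z))\<^sup>2) / 2 * gauss_hat s (Y - Z)) \<partial>lborel \<partial>lborel)"
    proof (rule nn_integral_mono)
      fix Y
      have "ennreal (norm (h Y * (\<integral>Z. cnj (h Z) * complex_of_real (gauss_hat s (Y - Z)) \<partial>lborel)))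
         = ennreal (norm (\<integral>Z. h Y * (cnj (h Z) * complex_of_real (gauss_hat s (Y - Z))) \<partial>lborel))" by simp
      also have "\<dots> \<le> (\<integral>\<^sup>+Z. ennreal (norm (h Y * (cnj (h Z) * complex_of_real (gauss_hat s (Y - Z))))) \<partial>lborel)"
        by (rule norm_integral_le_nn)
      also have "\<dots> \<le> (\<integral>\<^sup>+Z. ennreal (((cmod (h Y))\<^sup>2 + (cmod (h Z))\<^sup>2) / 2 * gauss_hat s (Y - Z)) \<partial>lborel)"
      proof (intro nn_integral_mono ennreal_leI)
        fix Z
        have "0 \<le> (cmod (h Y) - cmod (h Z))\<^sup>2" by simp
        then have "cmod (h Y) * cmod (h Z) \<le> ((cmod (h Y))\<^sup>2 + (cmod (h Z))\<^sup>2) / 2"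
          by (simp add: power2_eq_square algebra_simps)
        from mult_right_mono[OF this gauss_hat_nonneg[OF s, of "Y - Z"]]
        show "norm (h Y * (cnj (h Z) * complex_of_real (gauss_hat s (Y - Z)))) \<le> ((cmod (h Y))\<^sup>2 + (cmod (h Z))\<^sup>2) / 2 * gauss_hat s (Y - Z)"
          using gauss_hat_nonneg[OF s, of "Y - Z"] by (simp add: norm_mult mult.assoc)
      qed
      finally show "ennreal (norm (h Y * (\<integral>Z. cnj (h Z) * complex_of_real (gauss_hat s (Y - Z)) \<partial>lborel)))
        \<le> (\<integral>\<^sup>+Z. ennreal (((cmod (h Y))\<^sup>2 + (cmod (h Z))\<^sup>2) / 2 * gauss_hat s (Y - Z)) \<partial>lborel)" .
    qed
    also have "\<dots> = (\<integral>\<^sup>+Y. \<integral>\<^sup>+Z. (ennreal ((cmod (h Y))\<^sup>2 / 2) * ennreal (gauss_hat s (Y - Z))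
         + ennreal ((cmod (h Z))\<^sup>2 / 2) * ennreal (gauss_hat s (Y - Z))) \<partial>lborel \<partial>lborel)"
      by (intro nn_integral_cong)
        (simp add: add_divide_distrib distrib_right ennreal_mult[symmetric] gauss_hat_nonneg[OF s])
    also have "\<dots> = (\<integral>\<^sup>+Y. \<integral>\<^sup>+Z. ennreal ((cmod (h Y))\<^sup>2 / 2) * ennreal (gauss_hat s (Y - Z)) \<partial>lborel \<partial>lborel)
       + (\<integral>\<^sup>+Y. \<integral>\<^sup>+Z. ennreal ((cmod (h Z))\<^sup>2 / 2) * ennreal (gauss_hat s (Y - Z)) \<partial>lborel \<partial>lborel)"
      by (simp add: nn_integral_add)
    also have "(\<integral>\<^sup>+Y. \<integral>\<^sup>+Z. ennreal ((cmod (h Z))\<^sup>2 / 2) * ennreal (gauss_hat s (Y - Z)) \<partial>lborel \<partial>lborel)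
       = (\<integral>\<^sup>+Z. \<integral>\<^sup>+Y. ennreal ((cmod (h Z))\<^sup>2 / 2) * ennreal (gauss_hat s (Y - Z)) \<partial>lborel \<partial>lborel)"
      by (rule lborel_pair.Fubini') measurable
    also have "(\<integral>\<^sup>+Y. \<integral>\<^sup>+Z. ennreal ((cmod (h Y))\<^sup>2 / 2) * ennreal (gauss_hat s (Y - Z)) \<partial>lborel \<partial>lborel)
       = (\<integral>\<^sup>+Y. ennreal ((cmod (h Y))\<^sup>2 / 2) \<partial>lborel)"
      by (simp add: nn_integral_cmult nn_integral_gauss_hat[OF s])
    also have "(\<integral>\<^sup>+Z. \<integral>\<^sup>+Y. ennreal ((cmod (h Z))\<^sup>2 / 2) * ennreal (gauss_hat s (Y - Z)) \<partial>lborel \<partial>lborel)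
       = (\<integral>\<^sup>+Y. ennreal ((cmod (h Y))\<^sup>2 / 2) \<partial>lborel)"
      by (simp add: nn_integral_cmult nn_integral_gauss_hat[OF s])
    also have "(\<integral>\<^sup>+Y. ennreal ((cmod (h Y))\<^sup>2 / 2) \<partial>lborel) + (\<integral>\<^sup>+Y. ennreal ((cmod (h Y))\<^sup>2 / 2) \<partial>lborel)
       = (\<integral>\<^sup>+Y. ennreal ((cmod (h Y))\<^sup>2) \<partial>lborel)"
      by (subst nn_integral_add[symmetric]) (auto simp: ennreal_plus[symmetric] simp del: ennreal_plus)
    finally show ?thesis .
  qed
  have lim: "(\<lambda>n. ennreal ((cmod (hat X))\<^sup>2 * gauss (1 / Suc n) X)) \<longlonglongrightarrow> ennreal ((cmod (hat X))\<^sup>2)" for X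
  proof -
    have "(\<lambda>n. gauss (1 / Suc n) X) \<longlonglongrightarrow> (\<Prod>b\<in>(Basis::'a set). exp (- (0 * (X \<bullet> b))\<^sup>2 / 2))"
      unfolding gauss_def
      by (intro tendsto_intros LIMSEQ_Suc[OF lim_1_over_n]) auto
    then have "(\<lambda>n. (cmod (hat X))\<^sup>2 * gauss (1 / Suc n) X) \<longlonglongrightarrow> (cmod (hat X))\<^sup>2 * 1"
      by (intro tendsto_mult tendsto_const) simp
    then show ?thesis by (intro tendsto_ennrealI) simp
  qed
  have "(\<integral>\<^sup>+X. ennreal ((cmod (hat X))\<^sup>2) \<partial>lborel)
     = (\<integral>\<^sup>+X. liminf (\<lambda>n. ennreal ((cmod (hat X))\<^sup>2 * gauss (1 / Suc n) X)) \<partial>lborel)"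
    by (intro nn_integral_cong lim_imp_Liminf[OF sequentially_bot, symmetric] lim)
  also have "\<dots> \<le> liminf (\<lambda>n. \<integral>\<^sup>+X. ennreal ((cmod (hat X))\<^sup>2 * gauss (1 / Suc n) X) \<partial>lborel)"
    by (rule nn_integral_liminf) measurable
  also have "\<dots> \<le> (\<integral>\<^sup>+Y. ennreal ((cmod (h Y))\<^sup>2) \<partial>lborel)"
    by (rule Liminf_le) (auto intro!: always_eventually main)
  finally show ?thesis unfolding hat_def .
qed

section \<open>Exponential Lie groups\<close>

subsection \<open>Twice differentiable maps\<close>

text \<open>Two derivatives are all that is used: the first of conjugation yields \<open>Ad\<close>,
  the second yields the bracket. As in \<open>Ck_on\<close>, the second derivative is taken
  direction by direction, which avoids differentiating operator-valued maps.\<close>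

definition twice_diff_on :: "('a::euclidean_space \<Rightarrow> 'b::euclidean_space) \<Rightarrow> 'a set \<Rightarrow> bool" where
  "twice_diff_on f S \<longleftrightarrow> (\<forall>x\<in>S. f differentiable at x \<and>
     (\<forall>v. (\<lambda>x. frechet_derivative f (at x) v) differentiable at x))"

lemma smooth_on_imp_twice_diff_on:
  assumes "smooth_on f S"
  shows "twice_diff_on f S"
proof -
  have "Ck_on (Suc (Suc 0)) f S" using assms unfolding smooth_on_def by blast
  then show ?thesis unfolding twice_diff_on_def by simp
qed

lemma twice_diff_on_subset: "twice_diff_on f S \<Longrightarrow> T \<subseteq> S \<Longrightarrow> twice_diff_on f T"
  unfolding twice_diff_on_def by blast

text \<open>The set T need not be open, because all derivatives are taken in the full space and not
  within the set.\<close>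

lemma twice_diff_on_local:
  assumes "\<And>x. x \<in> S \<Longrightarrow> \<exists>T. x \<in> T \<and> twice_diff_on f T"
  shows "twice_diff_on f S"
  unfolding twice_diff_on_def
proof
  fix x assume "x \<in> S"
  then obtain T where "x \<in> T" "twice_diff_on f T" using assms by meson
  then show "f differentiable at x \<and> (\<forall>v. (\<lambda>x. frechet_derivative f (at x) v) differentiable at x)"
    by (simp add: twice_diff_on_def)
qed

lemma twice_diff_on_differentiable: "twice_diff_on f S \<Longrightarrow> x \<in> S \<Longrightarrow> f differentiable at x"
  by (simp add: twice_diff_on_def)

lemma twice_diff_on_differentiable2:
  "twice_diff_on f S \<Longrightarrow> x \<in> S \<Longrightarrow> (\<lambda>x. frechet_derivative f (at x) v) differentiable at x"
  by (simp add: twice_diff_on_def)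

lemma twice_diff_on_has_derivative:
  "twice_diff_on f S \<Longrightarrow> x \<in> S \<Longrightarrow> (f has_derivative frechet_derivative f (at x)) (at x)"
  by (rule frechet_derivative_works[THEN iffD1, OF twice_diff_on_differentiable])

lemma twice_diff_on_continuous: "twice_diff_on f S \<Longrightarrow> continuous_on S f"
  by (intro continuous_at_imp_continuous_on ballI differentiable_imp_continuous_within)
    (rule twice_diff_on_differentiable)

lemma differentiable_eq_on_open:
  assumes "f differentiable at x" "open S" "x \<in> S" "\<And>y. y \<in> S \<Longrightarrow> f y = g y"
  shows "g differentiable at x"
proof -
  obtain D where "(f has_derivative D) (at x)" using assms(1) unfolding differentiable_def ..
  from has_derivative_transform_within_open[OF this assms(2,3,4)] show ?thesis by (rule differentiableI)
qed

lemma twice_diff_onI: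
  fixes f :: "'a::euclidean_space \<Rightarrow> 'b::euclidean_space"
  assumes S: "open S" and f: "\<And>x. x \<in> S \<Longrightarrow> (f has_derivative f' x) (at x)"
    and f': "\<And>v x. x \<in> S \<Longrightarrow> (\<lambda>x. f' x v) differentiable at x"
  shows "twice_diff_on f S"
  unfolding twice_diff_on_def
proof (intro ballI conjI allI)
  fix x v assume x: "x \<in> S"
  show "f differentiable at x" using f[OF x] differentiableI by blast
  show "(\<lambda>x. frechet_derivative f (at x) v) differentiable at x"
    by (rule differentiable_eq_on_open[OF f'[OF x] S x]) (simp only: frechet_derivative_at[OF f])
qed

lemma twice_diff_on_cong:
  assumes f: "twice_diff_on f S" and S: "open S" and eq: "\<And>x. x \<in> S \<Longrightarrow> f x = g x"
  shows "twice_diff_on g S"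
proof (rule twice_diff_onI[OF S])
  show "(\<lambda>x. frechet_derivative f (at x) v) differentiable at x" if "x \<in> S" for v x
    using f that by (rule twice_diff_on_differentiable2)
  show "(g has_derivative frechet_derivative f (at x)) (at x)" if "x \<in> S" for x
    using has_derivative_transform_within_open[OF twice_diff_on_has_derivative[OF f that] S that eq] .
qed

text \<open>The chain rule is expanded in a basis of the middle space. Each term is then a scalar
  times the derivative of g in a fixed direction, and only such directional derivatives are known to
  be differentiable.\<close>

lemma twice_diff_on_compose:
  fixes f :: "'a::euclidean_space \<Rightarrow> 'b::euclidean_space" and g :: "'b \<Rightarrow> 'c::euclidean_space"
  assumes f: "twice_diff_on f S" and g: "twice_diff_on g T" and S: "open S"
    and sub: "\<And>x. x \<in> S \<Longrightarrow> f x \<in> T"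
  shows "twice_diff_on (\<lambda>x. g (f x)) S"
proof (rule twice_diff_onI[OF S])
  define f' where "f' x = frechet_derivative f (at x)" for x
  define g' where "g' y = frechet_derivative g (at y)" for y
  have df: "(f has_derivative f' x) (at x)" if "x \<in> S" for x
    unfolding f'_def using f that by (rule twice_diff_on_has_derivative)
  have dg: "(g has_derivative g' y) (at y)" if "y \<in> T" for y
    unfolding g'_def using g that by (rule twice_diff_on_has_derivative)
  show D: "((\<lambda>x. g (f x)) has_derivative (\<lambda>v. \<Sum>b\<in>Basis. (f' x v \<bullet> b) *\<^sub>R g' (f x) b)) (at x)"
    if x: "x \<in> S" for x
  proof -
    have lin: "linear (g' (f x))" using dg[OF sub[OF x]] has_derivative_linear by blast
    have eq: "g' (f x) w = (\<Sum>b\<in>Basis. (w \<bullet> b) *\<^sub>R g' (f x) b)" for w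
    proof -
      have "g' (f x) w = g' (f x) (\<Sum>b\<in>Basis. (w \<bullet> b) *\<^sub>R b)" by (simp add: euclidean_representation)
      then show ?thesis by (simp only: linear_sum[OF lin] linear_scale[OF lin])
    qed
    have "(\<lambda>v. g' (f x) (f' x v)) = (\<lambda>v. \<Sum>b\<in>Basis. (f' x v \<bullet> b) *\<^sub>R g' (f x) b)"
      by (rule ext) (rule eq)
    with diff_chain_at[OF df[OF x] dg[OF sub[OF x]]] show ?thesis unfolding o_def by simp
  qed
  show "(\<lambda>x. \<Sum>b\<in>Basis. (f' x v \<bullet> b) *\<^sub>R g' (f x) b) differentiable at x" if x: "x \<in> S" for v x
  proof -
    have 1: "(\<lambda>x. f' x v) differentiable at x"
      unfolding f'_def using f x by (rule twice_diff_on_differentiable2)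
    have "(\<lambda>y. g' y b) differentiable at (f x)" for b
      unfolding g'_def using g sub[OF x] by (rule twice_diff_on_differentiable2)
    then have 2: "(\<lambda>x. g' (f x) b) differentiable at x" for b
      using differentiable_chain_at[OF differentiableI[OF df[OF x]], of "\<lambda>y. g' y b"] by (simp add: o_def)
    show ?thesis
    proof (intro differentiable_sum finite_Basis ballI)
      fix b :: 'b
      have "(\<lambda>x. f' x v \<bullet> b) differentiable at x"
        by (rule differentiable_compose[OF linear_imp_differentiable 1]) (simp add: bounded_linear.linear bounded_linear_inner_left)
      then show "(\<lambda>x. (f' x v \<bullet> b) *\<^sub>R g' (f x) b) differentiable at x" by (intro differentiable_scaleR 2)
    qed
  qed
qed

lemma twice_diff_on_linear:
  fixes f :: "'a::euclidean_space \<Rightarrow> 'b::euclidean_space"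
  assumes f: "bounded_linear f" and S: "open S"
  shows "twice_diff_on f S"
  by (rule twice_diff_onI[OF S bounded_linear_imp_has_derivative[OF f]]) simp

lemma twice_diff_on_Pair:
  fixes f :: "'a::euclidean_space \<Rightarrow> 'b::euclidean_space" and g :: "'a \<Rightarrow> 'c::euclidean_space"
  assumes f: "twice_diff_on f S" and g: "twice_diff_on g S" and S: "open S"
  shows "twice_diff_on (\<lambda>x. (f x, g x)) S"
proof (rule twice_diff_onI[OF S])
  show "((\<lambda>x. (f x, g x)) has_derivative (\<lambda>v. (frechet_derivative f (at x) v, frechet_derivative g (at x) v))) (at x)"
    if "x \<in> S" for x
    using that by (intro has_derivative_Pair twice_diff_on_has_derivative[OF f] twice_diff_on_has_derivative[OF g])
  show "(\<lambda>x. (frechet_derivative f (at x) v, frechet_derivative g (at x) v)) differentiable at x"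
    if x: "x \<in> S" for v x
  proof -
    have "(\<lambda>x. frechet_derivative f (at x) v) differentiable at x"
      "(\<lambda>x. frechet_derivative g (at x) v) differentiable at x"
      using twice_diff_on_differentiable2[OF f x] twice_diff_on_differentiable2[OF g x] by this
    then obtain D D' where "((\<lambda>x. frechet_derivative f (at x) v) has_derivative D) (at x)"
      "((\<lambda>x. frechet_derivative g (at x) v) has_derivative D') (at x)"
      unfolding differentiable_def by metis
    from has_derivative_Pair[OF this] show ?thesis by (rule differentiableI)
  qed
qed

lemma differentiable_Pair_const: "(\<lambda>x. (x, c)) differentiable at x"
  unfolding differentiable_def by (auto intro!: exI derivative_intros)

lemma borel_measurable_det:
  fixes A :: "'x \<Rightarrow> real^'n^'n"
  assumes "\<And>i j. (\<lambda>x. A x $ i $ j) \<in> borel_measurable M"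
  shows "(\<lambda>x. det (A x)) \<in> borel_measurable M"
  unfolding det_def using assms by (intro borel_measurable_sum borel_measurable_times borel_measurable_prod) auto

subsection \<open>Exponential coordinates\<close>

locale exp_group =
  fixes G :: "'g monoid" (structure) and \<A> :: "('g, real^'n) atlas" and ex :: "real^'n \<Rightarrow> 'g"
  assumes exponential: "exponential_lie_group G \<A> ex"
begin

abbreviation "\<T> \<equiv> atlas_topology \<A>"
abbreviation "lg \<equiv> lie_log ex"

lemma group_G: "group G"
  using exponential by (simp add: exponential_lie_group_def lie_group_def)

sublocale group G by (rule group_G)

lemma bij_ex: "bij_betw ex UNIV (carrier G)"
  using exponential by (simp add: exponential_lie_group_def)

lemma ex_carrier [simp, intro]: "ex X \<in> carrier G"
  using bij_ex bij_betw_apply by fastforce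

lemma lg_ex [simp]: "lg (ex X) = X"
  using bij_ex by (simp add: bij_betw_def)

lemma ex_lg [simp]: "x \<in> carrier G \<Longrightarrow> ex (lg x) = x"
  using bij_ex by (simp add: bij_betw_def f_inv_into_f)

lemma ex_add: "ex ((s + t) *\<^sub>R X) = ex (s *\<^sub>R X) \<otimes> ex (t *\<^sub>R X)"
  using exponential unfolding exponential_lie_group_def by blast

lemma ex_0 [simp]: "ex 0 = \<one>"
  using ex_add[of 0 0 0] by (metis ex_carrier l_cancel_one' scaleR_zero_right)

lemma inv_ex: "inv (ex X) = ex (- X)"
  using ex_add[of "-1" 1 X] by (intro inv_equality) auto

lemma lg_inv: "x \<in> carrier G \<Longrightarrow> lg (inv x) = - lg x"
  by (metis ex_lg inv_ex lg_ex)

section \<open>Charts, topology and Borel sets\<close>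

lemma atlas: "smooth_atlas (carrier G) \<A>"
  using exponential by (simp add: exponential_lie_group_def lie_group_def)

lemma chart_cover: "x \<in> carrier G \<Longrightarrow> \<exists>U c. (U, c) \<in> \<A> \<and> x \<in> U"
  using atlas unfolding smooth_atlas_def by blast

lemma chart:
  assumes "(U, c) \<in> \<A>"
  shows "U \<subseteq> carrier G" "inj_on c U" "open (c ` U)"
  using atlas assms unfolding smooth_atlas_def by blast+

lemma chart_ex:
  assumes "(U, c) \<in> \<A>"
  shows "open (ex -` U)" "twice_diff_on (\<lambda>X. c (ex X)) (ex -` U)"
proof -
  have "smooth_map UNIV euclidean_atlas (carrier G) \<A> ex"
    using exponential by (simp add: exponential_lie_group_def)
  then have "open (ex -` U) \<and> smooth_on (c \<circ> ex \<circ> inv_into UNIV id) (ex -` U)"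
    using assms unfolding smooth_map_def euclidean_atlas_def by fastforce
  moreover have "c \<circ> ex \<circ> inv_into UNIV id = (\<lambda>X. c (ex X))"
    by (auto simp: fun_eq_iff inv_id)
  ultimately show "open (ex -` U)" "twice_diff_on (\<lambda>X. c (ex X)) (ex -` U)"
    using smooth_on_imp_twice_diff_on by auto
qed

lemma chart_lg:
  assumes "(U, c) \<in> \<A>"
  shows "twice_diff_on (\<lambda>z. lg (inv_into U c z)) (c ` U)"
proof -
  have "smooth_map (carrier G) \<A> UNIV euclidean_atlas lg"
    using exponential by (simp add: exponential_lie_group_def)
  then have "smooth_on (id \<circ> lg \<circ> inv_into U c) (c ` U)"
    using assms unfolding smooth_map_def euclidean_atlas_def by fastforce
  from smooth_on_imp_twice_diff_on[OF this] show ?thesis by (simp add: o_def)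
qed

lemma chart_mult:
  assumes "(U, c) \<in> \<A>" "(V, d) \<in> \<A>" "(W, e) \<in> \<A>"
  defines "S \<equiv> map_prod c d ` (U \<times> V \<inter> (\<lambda>(x, y). x \<otimes> y) -` W)"
  shows "open S"
    "twice_diff_on (\<lambda>z. e ((\<lambda>(x, y). x \<otimes> y) (inv_into (U \<times> V) (map_prod c d) z))) S"
proof -
  have "(U \<times> V, map_prod c d) \<in> prod_atlas \<A> \<A>"
    using assms unfolding prod_atlas_def by blast
  moreover have "smooth_map (carrier G \<times> carrier G) (prod_atlas \<A> \<A>) (carrier G) \<A> (\<lambda>(x, y). x \<otimes> y)"
    using exponential by (simp add: exponential_lie_group_def lie_group_def)
  ultimately have "open S \<and> smooth_on (e \<circ> (\<lambda>(x, y). x \<otimes> y) \<circ> inv_into (U \<times> V) (map_prod c d)) S"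
    using assms(3) unfolding smooth_map_def S_def by fast
  then show "open S"
    "twice_diff_on (\<lambda>z. e ((\<lambda>(x, y). x \<otimes> y) (inv_into (U \<times> V) (map_prod c d) z))) S"
    using smooth_on_imp_twice_diff_on by (auto simp: o_def)
qed

lemma topspace_T: "topspace \<T> = carrier G"
proof -
  have "topspace \<T> = \<Union>{U \<inter> c -` W |U c W. (U, c) \<in> \<A> \<and> open W}"
    unfolding atlas_topology_def by (rule topology_generated_by_topspace)
  also have "\<dots> = \<Union>{U. \<exists>c. (U, c) \<in> \<A>}" by (auto, metis Int_iff UNIV_I open_UNIV vimage_UNIV)
  also have "\<dots> = carrier G" using atlas unfolding smooth_atlas_def by blast
  finally show ?thesis .
qed

lemma continuous_ex: "continuous_map euclidean \<T> ex"
  unfolding atlas_topology_def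
proof (rule continuous_on_generated_topo)
  show "openin euclidean (ex -` B \<inter> topspace euclidean)"
    if "B \<in> {U \<inter> c -` W |U c W. (U, c) \<in> \<A> \<and> open W}" for B
  proof -
    from that obtain U c W where B: "B = U \<inter> c -` W" "(U, c) \<in> \<A>" "open W" by blast
    have "open ((\<lambda>X. c (ex X)) -` W \<inter> ex -` U)"
      using continuous_on_open_vimage[OF chart_ex(1)[OF B(2)]]
        twice_diff_on_continuous[OF chart_ex(2)[OF B(2)]] B(3) by blast
    also have "(\<lambda>X. c (ex X)) -` W \<inter> ex -` U = ex -` B" using B by auto
    finally show ?thesis by simp
  qed
  show "ex ` topspace euclidean \<subseteq> \<Union>{U \<inter> c -` W |U c W. (U, c) \<in> \<A> \<and> open W}"
    using topspace_T unfolding atlas_topology_def topology_generated_by_topspace by auto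
qed

text \<open>Read in a chart, \<open>lg\<close> is continuous on an open set, so around each point
  the preimage of an open set contains one of the generating open sets. Together with
  \<open>continuous_ex\<close> this makes \<open>ex\<close> a homeomorphism, so Borel questions on G
  move to coordinates.\<close>

lemma continuous_lg: "continuous_map \<T> euclidean lg"
  unfolding continuous_map_def
proof (intro conjI allI impI)
  fix O' :: "(real^'n) set" assume "openin euclidean O'"
  then have O': "open O'" by simp
  show "openin \<T> {x \<in> topspace \<T>. lg x \<in> O'}"
  proof (subst openin_subopen, intro ballI)
    fix x assume "x \<in> {x \<in> topspace \<T>. lg x \<in> O'}"
    then have x: "x \<in> carrier G" "lg x \<in> O'" by (auto simp: topspace_T)
    obtain U c where U: "(U, c) \<in> \<A>" "x \<in> U" using chart_cover[OF x(1)] by blast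
    define W where "W = (\<lambda>z. lg (inv_into U c z)) -` O' \<inter> c ` U"
    have W: "open W" unfolding W_def
      using continuous_on_open_vimage[OF chart(3)[OF U(1)]] twice_diff_on_continuous[OF chart_lg[OF U(1)]] O' by blast
    have mem: "y \<in> U \<inter> c -` W \<longleftrightarrow> y \<in> U \<and> lg y \<in> O'" for y
      unfolding W_def using inv_into_f_f[OF chart(2)[OF U(1)], of y] by auto
    have "openin \<T> (U \<inter> c -` W)"
      unfolding atlas_topology_def using U W by (intro topology_generated_by_Basis) blast
    moreover have "x \<in> U \<inter> c -` W" using mem U x by blast
    moreover have "U \<inter> c -` W \<subseteq> {x \<in> topspace \<T>. lg x \<in> O'}"
      using mem chart(1)[OF U(1)] by (auto simp: topspace_T)
    ultimately show "\<exists>T. openin \<T> T \<and> x \<in> T \<and> T \<subseteq> {x \<in> topspace \<T>. lg x \<in> O'}" by blast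
  qed
qed auto

lemma sets_borel_of: "sets (borel_of \<T>) = sigma_sets (carrier G) {U. openin \<T> U}"
  and space_borel_of: "space (borel_of \<T>) = carrier G"
proof -
  have "{U. openin \<T> U} \<subseteq> Pow (carrier G)" using openin_subset by (fastforce simp: topspace_T)
  then show "sets (borel_of \<T>) = sigma_sets (carrier G) {U. openin \<T> U}"
    "space (borel_of \<T>) = carrier G"
    unfolding borel_of_def topspace_T by auto
qed

lemma openin_sets: "openin \<T> U \<Longrightarrow> U \<in> sets (borel_of \<T>)"
  unfolding sets_borel_of by blast

lemma ex_measurable [measurable]: "ex \<in> borel \<rightarrow>\<^sub>M borel_of \<T>"
proof (rule measurable_sigma_sets[OF sets_borel_of])
  show "{U. openin \<T> U} \<subseteq> Pow (carrier G)" using openin_subset by (fastforce simp: topspace_T)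
  show "ex -` U \<inter> space borel \<in> sets borel" if "U \<in> {U. openin \<T> U}" for U
  proof -
    have "openin euclidean {x \<in> topspace euclidean. ex x \<in> U}"
      using continuous_ex that unfolding continuous_map_def by blast
    then have "open (ex -` U)" by (simp add: vimage_def)
    then show ?thesis by simp
  qed
qed auto

lemma lg_measurable [measurable]: "lg \<in> borel_of \<T> \<rightarrow>\<^sub>M borel"
proof (rule borel_measurableI)
  fix S :: "(real^'n) set" assume "open S"
  then have "openin \<T> {x \<in> topspace \<T>. lg x \<in> S}"
    using continuous_lg unfolding continuous_map_def by simp
  then have "{x \<in> topspace \<T>. lg x \<in> S} \<in> sets (borel_of \<T>)" by (rule openin_sets)
  moreover have "{x \<in> topspace \<T>. lg x \<in> S} = lg -` S \<inter> space (borel_of \<T>)"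
    by (auto simp: topspace_T space_borel_of)
  ultimately show "lg -` S \<inter> space (borel_of \<T>) \<in> sets (borel_of \<T>)" by simp
qed

section \<open>The group law in exponential coordinates\<close>

definition mul :: "(real^'n) \<times> (real^'n) \<Rightarrow> real^'n" where
  "mul p = lg (ex (fst p) \<otimes> ex (snd p))"

lemma ex_mul: "ex (mul (X, Y)) = ex X \<otimes> ex Y"
  by (simp add: mul_def)

text \<open>Multiplication is known to be smooth only between charts. Near a given pair of points
  \<open>mul\<close> factors through \<open>ex\<close> into charts around the two factors,
  multiplication read in charts, and \<open>lg\<close> read in a chart around the product.\<close>

lemma mul_twice_diff: "twice_diff_on mul UNIV"
proof (rule twice_diff_on_local)
  fix p :: "(real^'n) \<times> (real^'n)"
  obtain X0 Y0 where p: "p = (X0, Y0)" by fastforce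
  obtain U c where U: "(U, c) \<in> \<A>" "ex X0 \<in> U" using chart_cover[of "ex X0"] by auto
  obtain V d where V: "(V, d) \<in> \<A>" "ex Y0 \<in> V" using chart_cover[of "ex Y0"] by auto
  obtain W e where W: "(W, e) \<in> \<A>" "ex X0 \<otimes> ex Y0 \<in> W" using chart_cover[of "ex X0 \<otimes> ex Y0"] by auto
  define S where "S = map_prod c d ` (U \<times> V \<inter> (\<lambda>(x, y). x \<otimes> y) -` W)"
  define m where "m z = e ((\<lambda>(x, y). x \<otimes> y) (inv_into (U \<times> V) (map_prod c d) z))" for z
  have oS: "open S" and mS: "twice_diff_on m S"
    using chart_mult[OF U(1) V(1) W(1)] unfolding S_def m_def[abs_def] by auto
  define R where "R = ex -` U \<times> ex -` V"
  have oR: "open R" unfolding R_def using chart_ex(1)[OF U(1)] chart_ex(1)[OF V(1)] by (rule open_Times)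
  define P where "P q = (c (ex (fst q)), d (ex (snd q)))" for q
  have P: "twice_diff_on P R"
    unfolding P_def[abs_def]
  proof (rule twice_diff_on_Pair[OF _ _ oR])
    show "twice_diff_on (\<lambda>q. c (ex (fst q))) R"
      by (rule twice_diff_on_compose[OF twice_diff_on_linear[OF bounded_linear_fst oR] chart_ex(2)[OF U(1)] oR])
        (auto simp: R_def)
    show "twice_diff_on (\<lambda>q. d (ex (snd q))) R"
      by (rule twice_diff_on_compose[OF twice_diff_on_linear[OF bounded_linear_snd oR] chart_ex(2)[OF V(1)] oR])
        (auto simp: R_def)
  qed
  \<comment> \<open>On \<open>N\<close> all three charts apply at once. Membership in
    \<open>S\<close> speaks of some pair with the given coordinates; injectivity of the charts
    identifies it with the pair at hand, so the product lies in \<open>W\<close>.\<close>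
  define N where "N = P -` S \<inter> R"
  have oN: "open N"
    unfolding N_def using continuous_on_open_vimage[OF oR] twice_diff_on_continuous[OF P] oS by blast
  have inj: "inj_on (map_prod c d) (U \<times> V)"
    using chart(2)[OF U(1)] chart(2)[OF V(1)] by (rule map_prod_inj_on)
  have NW: "ex (fst q) \<otimes> ex (snd q) \<in> W" if "q \<in> N" for q
  proof -
    from that have "P q \<in> S" and q: "ex (fst q) \<in> U" "ex (snd q) \<in> V" by (auto simp: N_def R_def)
    then obtain u v where uv: "u \<in> U" "v \<in> V" "u \<otimes> v \<in> W" "c u = c (ex (fst q))" "d v = d (ex (snd q))"
      unfolding S_def P_def by auto
    then have "u = ex (fst q)" "v = ex (snd q)"
      using q chart(2)[OF U(1)] chart(2)[OF V(1)] by (auto dest: inj_onD)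
    then show ?thesis using uv by simp
  qed
  have mP: "m (P q) = e (ex (fst q) \<otimes> ex (snd q))" if "q \<in> N" for q
  proof -
    have "inv_into (U \<times> V) (map_prod c d) (P q) = (ex (fst q), ex (snd q))"
      using that by (intro inv_into_f_eq[OF inj]) (auto simp: N_def R_def P_def)
    then show ?thesis by (simp add: m_def)
  qed
  have "twice_diff_on (\<lambda>q. m (P q)) N"
    by (rule twice_diff_on_compose[OF twice_diff_on_subset[OF P] mS oN]) (auto simp: N_def)
  then have "twice_diff_on (\<lambda>q. lg (inv_into W e (m (P q)))) N"
    by (rule twice_diff_on_compose[OF _ chart_lg[OF W(1)] oN]) (use mP NW in auto)
  then have "twice_diff_on mul N"
  proof (rule twice_diff_on_cong[OF _ oN])
    fix q assume q: "q \<in> N"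
    show "lg (inv_into W e (m (P q))) = mul q"
      using mP[OF q] NW[OF q] chart(2)[OF W(1)] by (simp add: mul_def inv_into_f_f)
  qed
  moreover have "p \<in> N"
    unfolding N_def S_def R_def P_def p using U V W by auto
  ultimately show "\<exists>T. p \<in> T \<and> twice_diff_on mul T" by blast
qed

lemma continuous_mul: "continuous_on UNIV mul"
  by (rule twice_diff_on_continuous[OF mul_twice_diff])

lemma mult_measurable:
  "(\<lambda>p. fst p \<otimes> snd p) \<in> borel_of \<T> \<Otimes>\<^sub>M borel_of \<T> \<rightarrow>\<^sub>M borel_of \<T>"
proof -
  have [measurable]: "mul \<in> borel_measurable borel"
    by (rule borel_measurable_continuous_onI[OF continuous_mul])
  have "(\<lambda>p. ex (mul (lg (fst p), lg (snd p)))) \<in> borel_of \<T> \<Otimes>\<^sub>M borel_of \<T> \<rightarrow>\<^sub>M borel_of \<T>"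
    by measurable
  then show ?thesis
    by (rule measurable_cong[THEN iffD1, rotated])
      (auto simp: space_pair_measure space_borel_of ex_mul)
qed

lemma inv_measurable: "(\<lambda>x. inv x) \<in> borel_of \<T> \<rightarrow>\<^sub>M borel_of \<T>"
proof -
  have "(\<lambda>x. ex (- lg x)) \<in> borel_of \<T> \<rightarrow>\<^sub>M borel_of \<T>" by measurable
  then show ?thesis
    by (rule measurable_cong[THEN iffD1, rotated]) (auto simp: space_borel_of inv_ex[symmetric])
qed

section \<open>Conjugation and the adjoint representation\<close>

definition conj_map :: "(real^'n) \<times> (real^'n) \<Rightarrow> real^'n" where
  "conj_map p = mul (mul p, - fst p)"

lemma conj_map_twice_diff: "twice_diff_on conj_map UNIV"
proof -
  have "twice_diff_on (\<lambda>p::(real^'n) \<times> (real^'n). - fst p) UNIV"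
    by (rule twice_diff_on_linear) (auto intro: bounded_linear_minus bounded_linear_fst)
  then have "twice_diff_on (\<lambda>p::(real^'n) \<times> (real^'n). (mul p, - fst p)) UNIV"
    by (intro twice_diff_on_Pair mul_twice_diff) auto
  from twice_diff_on_compose[OF this mul_twice_diff] show ?thesis
    unfolding conj_map_def[abs_def] by simp
qed

lemma conj_map_eq: "conj_map (Z, X) = lg (ex Z \<otimes> ex X \<otimes> inv (ex Z))"
  by (simp add: conj_map_def mul_def inv_ex)

text \<open>The differential of conjugation by \<open>ex Z\<close> at the identity. Taking it as a
  partial derivative of the joint map \<open>conj_map\<close>, and not for each Z separately, makes
  its dependence on Z differentiable.\<close>

definition AD :: "real^'n \<Rightarrow> real^'n \<Rightarrow> real^'n" where
  "AD Z X = frechet_derivative conj_map (at (Z, 0)) (0, X)"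

lemma conj_has_derivative: "((\<lambda>X. conj_map (Z, X)) has_derivative AD Z) (at 0)"
proof -
  have "(conj_map has_derivative frechet_derivative conj_map (at (Z, 0))) (at (Z, 0))"
    by (rule twice_diff_on_has_derivative[OF conj_map_twice_diff]) simp
  moreover have "((\<lambda>X::real^'n. (Z, X)) has_derivative (\<lambda>X. (0, X))) (at 0)"
    by (auto intro!: derivative_eq_intros)
  ultimately show ?thesis
    using diff_chain_at[of "\<lambda>X. (Z, X)" "\<lambda>X. (0, X)" 0 conj_map] by (simp add: o_def AD_def[abs_def])
qed

lemma linear_AD: "linear (AD Z)"
  using conj_has_derivative has_derivative_linear by blast

text \<open>\<open>Ad\<close> is defined by differentiating along lines, which by itself does not
  give linearity in X; differentiability of \<open>conj_map\<close> identifies it with a total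
  derivative.\<close>

lemma Ad_ex: "Ad G ex (ex Z) = AD Z"
proof
  fix X
  have "((\<lambda>t. conj_map (Z, t *\<^sub>R X)) has_vector_derivative AD Z X) (at 0)"
  proof -
    have d: "((\<lambda>t::real. t *\<^sub>R X) has_derivative (\<lambda>t. t *\<^sub>R X)) (at 0)"
      by (auto intro!: derivative_eq_intros)
    have "((\<lambda>X. conj_map (Z, X)) has_derivative AD Z) (at (0 *\<^sub>R X))"
      using conj_has_derivative by simp
    from diff_chain_at[OF d this] show ?thesis
      unfolding has_vector_derivative_def by (simp add: o_def linear_scale[OF linear_AD])
  qed
  then show "Ad G ex (ex Z) X = AD Z X"
    unfolding Ad_def conj_map_eq[symmetric] by (rule vector_derivative_at)
qed

lemma AD_differentiable: "(\<lambda>Z. AD Z X) differentiable at Z"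
proof -
  have "(\<lambda>p. frechet_derivative conj_map (at p) (0, X)) differentiable at (Z, 0)"
    by (rule twice_diff_on_differentiable2[OF conj_map_twice_diff]) simp
  then show ?thesis
    using differentiable_chain_at[OF differentiable_Pair_const[of 0 Z], of "\<lambda>p. frechet_derivative conj_map (at p) (0, X)"]
    by (simp add: o_def AD_def)
qed

lemma Ad_has_derivative:
  assumes "g \<in> carrier G"
  shows "((\<lambda>X. lg (g \<otimes> ex X \<otimes> inv g)) has_derivative Ad G ex g) (at 0)"
  using conj_has_derivative[of "lg g"] Ad_ex[of "lg g"] assms by (simp add: conj_map_eq)

lemma linear_Ad: "g \<in> carrier G \<Longrightarrow> linear (Ad G ex g)"
  using linear_AD[of "lg g"] Ad_ex[of "lg g"] by simp

text \<open>In logarithmic coordinates conjugations fix 0 and compose like the group elements, so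
  this is the chain rule at 0 together with uniqueness of the derivative.\<close>

lemma Ad_mult:
  assumes g: "g \<in> carrier G" and h: "h \<in> carrier G"
  shows "Ad G ex (g \<otimes> h) = Ad G ex g \<circ> Ad G ex h"
proof -
  define \<phi> where "\<phi> k X = lg (k \<otimes> ex X \<otimes> inv k)" for k X
  have \<phi>0: "\<phi> h 0 = 0" using h lg_ex[of 0] by (simp add: \<phi>_def del: lg_ex)
  have comp: "\<phi> g \<circ> \<phi> h = \<phi> (g \<otimes> h)"
    using g h by (auto simp: \<phi>_def fun_eq_iff inv_mult_group m_assoc intro!: arg_cong[of _ _ lg])
  have "((\<phi> g \<circ> \<phi> h) has_derivative (Ad G ex g \<circ> Ad G ex h)) (at 0)"
    by (rule diff_chain_at) (use Ad_has_derivative g h \<phi>0 in \<open>auto simp: \<phi>_def[abs_def]\<close>)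
  moreover have "(\<phi> (g \<otimes> h) has_derivative Ad G ex (g \<otimes> h)) (at 0)"
    using Ad_has_derivative[of "g \<otimes> h"] g h by (simp add: \<phi>_def[abs_def])
  ultimately show ?thesis unfolding comp using has_derivative_unique by blast
qed

section \<open>The coadjoint action and the orbit map\<close>

lemma coadjoint_mult:
  assumes g: "g \<in> carrier G" and h: "h \<in> carrier G"
  shows "coadjoint G ex (g \<otimes> h) F = coadjoint G ex g (coadjoint G ex h F)"
proof -
  have lin: "linear (Ad G ex (inv g))" "linear (Ad G ex (inv h))"
    "linear (Ad G ex (inv (g \<otimes> h)))" using g h by (auto intro: linear_Ad)
  have "x \<bullet> coadjoint G ex (g \<otimes> h) F = x \<bullet> coadjoint G ex g (coadjoint G ex h F)" for x
    unfolding coadjoint_def adjoint_works[OF lin(1)] adjoint_works[OF lin(2)] adjoint_works[OF lin(3)]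
    using g h by (simp add: inv_mult_group Ad_mult)
  then show ?thesis by (metis vector_eq_ldot)
qed

text \<open>If \<kappa>(x) = \<kappa>(y), acting with y on both sides shows that y x^-1 fixes F,
  hence is the identity.\<close>

lemma kappa_inj:
  assumes stab: "{g \<in> carrier G. coadjoint G ex g F = F} = {\<one>}"
  shows "inj_on (kappa G ex F) (carrier G)"
proof (rule inj_onI)
  fix x y assume x: "x \<in> carrier G" and y: "y \<in> carrier G" and eq: "kappa G ex F x = kappa G ex F y"
  have "coadjoint G ex (y \<otimes> inv x) F = coadjoint G ex (y \<otimes> inv y) F"
    using eq by (simp only: kappa_def coadjoint_mult[OF y inv_closed[OF x]] coadjoint_mult[OF y inv_closed[OF y]])
  also have "\<dots> = F"
  proof -
    have "coadjoint G ex \<one> F = F" using stab by blast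
    then show ?thesis using y by simp
  qed
  finally have "y \<otimes> inv x = \<one>" using stab x y by blast
  then show "x = y" using x y by (metis inv_closed inv_equality inv_inv)
qed

text \<open>Expanding in coordinates reduces regularity of the orbit map to that of
  \<open>AD Z b\<close> for fixed directions b, which is all that is known about
  \<open>AD\<close>.\<close>

lemma kappa_ex: "kappa G ex F (ex Z) = (\<Sum>b\<in>Basis. (AD Z b \<bullet> F) *\<^sub>R b)"
proof -
  have "kappa G ex F (ex Z) = adjoint (AD Z) F"
    by (simp add: kappa_def coadjoint_def Ad_ex)
  also have "\<dots> = (\<Sum>b\<in>Basis. (adjoint (AD Z) F \<bullet> b) *\<^sub>R b)" by (simp add: euclidean_representation)
  also have "\<dots> = (\<Sum>b\<in>Basis. (AD Z b \<bullet> F) *\<^sub>R b)"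
    by (subst inner_commute) (simp add: adjoint_works[OF linear_AD])
  finally show ?thesis .
qed

lemma continuous_kappa_ex: "continuous_on UNIV (\<lambda>Z. kappa G ex F (ex Z))"
proof -
  have "continuous_on UNIV (\<lambda>Z. AD Z X)" for X
    by (intro continuous_at_imp_continuous_on ballI differentiable_imp_continuous_within AD_differentiable)
  then show ?thesis unfolding kappa_ex by (intro continuous_intros) auto
qed

lemma kappa_measurable: "kappa G ex F \<in> borel_of \<T> \<rightarrow>\<^sub>M borel"
proof -
  have [measurable]: "(\<lambda>Z. kappa G ex F (ex Z)) \<in> borel_measurable borel"
    by (rule borel_measurable_continuous_onI[OF continuous_kappa_ex])
  have "(\<lambda>x. kappa G ex F (ex (lg x))) \<in> borel_of \<T> \<rightarrow>\<^sub>M borel" by measurable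
  then show ?thesis by (rule measurable_cong[THEN iffD1, rotated]) (simp add: space_borel_of)
qed

text \<open>In exponential coordinates the orbit map is a continuous injection between spaces of
  equal dimension, so invariance of domain applies without computing the rank of a differential.
  Continuity of the inverse serves to make \<open>kinv\<close> a Borel map.\<close>

lemma kappa_homeomorphism:
  assumes stab: "{g \<in> carrier G. coadjoint G ex g F = F} = {\<one>}"
  shows "open (coadjoint_orbit G ex F)"
    and "continuous_on (coadjoint_orbit G ex F) (\<lambda>Y. lg (inv_into (carrier G) (kappa G ex F) Y))"
proof -
  define k where "k Z = kappa G ex F (ex Z)" for Z
  have inj: "inj k"
    using kappa_inj[OF stab] unfolding k_def inj_on_def by (metis UNIV_I ex_carrier lg_ex)
  have img: "range k = kappa G ex F ` carrier G"
    unfolding k_def using bij_ex by (metis bij_betw_def image_image)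
  have orb: "kappa G ex F ` carrier G = coadjoint_orbit G ex F"
    unfolding kappa_def coadjoint_orbit_def
    by (auto simp: image_iff) (metis inv_closed inv_inv)
  have cont: "continuous_on UNIV k" unfolding k_def[abs_def] by (rule continuous_kappa_ex)
  show "open (coadjoint_orbit G ex F)"
    using invariance_of_domain[OF cont open_UNIV inj] img orb by simp
  obtain j where j: "homeomorphism UNIV (range k) k j"
    using invariance_of_domain_homeomorphism[OF open_UNIV cont _ inj] by auto
  have "lg (inv_into (carrier G) (kappa G ex F) Y) = j Y" if "Y \<in> range k" for Y
  proof -
    from that obtain Z where Z: "Y = k Z" by blast
    have "inv_into (carrier G) (kappa G ex F) Y = ex Z"
      unfolding Z k_def by (rule inv_into_f_f[OF kappa_inj[OF stab]]) simp
    then show ?thesis using j Z by (simp add: homeomorphism_def)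
  qed
  moreover have "continuous_on (range k) j" using j by (simp add: homeomorphism_def)
  ultimately show "continuous_on (coadjoint_orbit G ex F) (\<lambda>Y. lg (inv_into (carrier G) (kappa G ex F) Y))"
    using img orb by (metis (mono_tags, lifting) continuous_on_cong)
qed

section \<open>The bracket and the density \<Theta>\<close>

lemma lie_bracket_eq: "lie_bracket G ex X Y = frechet_derivative (\<lambda>Z. AD Z Y) (at 0) X"
proof -
  have "((\<lambda>s. AD (s *\<^sub>R X) Y) has_vector_derivative frechet_derivative (\<lambda>Z. AD Z Y) (at 0) X) (at 0)"
  proof -
    have d: "((\<lambda>t::real. t *\<^sub>R X) has_derivative (\<lambda>t. t *\<^sub>R X)) (at 0)"
      by (auto intro!: derivative_eq_intros)
    have "((\<lambda>Z. AD Z Y) has_derivative frechet_derivative (\<lambda>Z. AD Z Y) (at 0)) (at (0 *\<^sub>R X))"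
      using frechet_derivative_works[THEN iffD1, OF AD_differentiable] by simp
    from diff_chain_at[OF d this] show ?thesis
      unfolding has_vector_derivative_def
      by (simp add: o_def linear_scale[OF linear_frechet_derivative[OF AD_differentiable]])
  qed
  then show ?thesis unfolding lie_bracket_def Ad_ex by (rule vector_derivative_at)
qed

text \<open>Linear in X because it is a derivative evaluated at X. Linear in Y because
  \<open>AD Z\<close> is linear for every Z and derivatives in Z are unique.\<close>

lemma bilinear_lie_bracket: "bilinear (lie_bracket G ex)"
  unfolding bilinear_def
proof (intro conjI allI)
  fix Y show "linear (\<lambda>X. lie_bracket G ex X Y)"
    unfolding lie_bracket_eq by (rule linear_frechet_derivative[OF AD_differentiable])
next
  fix X
  have D: "((\<lambda>Z. AD Z Y) has_derivative (\<lambda>X. lie_bracket G ex X Y)) (at 0)" for Y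
    unfolding lie_bracket_eq by (rule frechet_derivative_works[THEN iffD1, OF AD_differentiable])
  show "linear (\<lambda>Y. lie_bracket G ex X Y)"
  proof (rule linearI)
    fix Y Y'
    have "((\<lambda>Z. AD Z (Y + Y')) has_derivative (\<lambda>X. lie_bracket G ex X Y + lie_bracket G ex X Y')) (at 0)"
      unfolding linear_add[OF linear_AD] by (intro has_derivative_add D)
    from has_derivative_unique[OF D this]
    show "lie_bracket G ex X (Y + Y') = lie_bracket G ex X Y + lie_bracket G ex X Y'" by metis
    fix r
    have "((\<lambda>Z. AD Z (r *\<^sub>R Y)) has_derivative (\<lambda>X. r *\<^sub>R lie_bracket G ex X Y)) (at 0)"
      unfolding linear_scale[OF linear_AD] by (intro has_derivative_scaleR_right D)
    from has_derivative_unique[OF D this]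
    show "lie_bracket G ex X (r *\<^sub>R Y) = r *\<^sub>R lie_bracket G ex X Y" by metis
  qed
qed

text \<open>Iterated brackets are Borel functions of X by induction, and so is the sum of the
  series: its measurability requires no proof of convergence.\<close>

lemma Theta_measurable [measurable]: "Theta G ex \<in> borel_measurable borel"
proof -
  obtain K where K: "bounded_bilinear (lie_bracket G ex)"
    using bilinear_lie_bracket bilinear_conv_bounded_bilinear by blast
  have pow: "(\<lambda>X. (lie_bracket G ex X ^^ k) Y) \<in> borel_measurable borel" for k Y
  proof (induction k)
    case (Suc k)
    note [measurable] = Suc
    have cont: "continuous_on UNIV (\<lambda>p. lie_bracket G ex (fst p) (snd p))"
      by (intro bounded_bilinear.continuous_on[OF K] continuous_intros)
    have [measurable]: "(\<lambda>p. lie_bracket G ex (fst p) (snd p)) \<in> borel_measurable borel"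
      by (rule borel_measurable_continuous_onI[OF cont])
    have "(\<lambda>X. (\<lambda>p. lie_bracket G ex (fst p) (snd p)) (X, (lie_bracket G ex X ^^ k) Y)) \<in> borel_measurable borel"
      by measurable
    then show ?case by simp
  qed simp
  note [measurable] = pow
  have "(\<lambda>X. det (matrix (\<lambda>Y. \<Sum>k. (1 / fact (Suc k)) *\<^sub>R (lie_bracket G ex X ^^ k) Y))) \<in> borel_measurable borel"
  proof (rule borel_measurable_det)
    fix i j
    have m: "(\<lambda>X. \<Sum>k. (1 / fact (Suc k)) *\<^sub>R (lie_bracket G ex X ^^ k) (axis j 1)) \<in> borel_measurable borel"
      by measurable
    have "(\<lambda>v::real^'n. v $ i) \<in> borel_measurable borel"
      by (intro borel_measurable_continuous_onI continuous_intros)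
    from measurable_compose[OF m this]
    show "(\<lambda>X. matrix (\<lambda>Y. \<Sum>k. (1 / fact (Suc k)) *\<^sub>R (lie_bracket G ex X ^^ k) Y) $ i $ j) \<in> borel_measurable borel"
      by (simp add: matrix_def)
  qed
  then show ?thesis unfolding Theta_def[abs_def] by measurable
qed

lemma Theta_nonneg: "0 \<le> Theta G ex X"
  by (simp add: Theta_def)

end

subsection \<open>Haar measure\<close>

context exp_group
begin

lemma inv_continuous: "continuous_map \<T> \<T> (\<lambda>x. inv x)"
proof -
  have "continuous_map euclidean euclidean (uminus :: real^'n \<Rightarrow> real^'n)"
    by (simp add: continuous_intros)
  then have "continuous_map \<T> \<T> (ex \<circ> uminus \<circ> lg)"
    by (intro continuous_map_compose[OF continuous_lg continuous_map_compose[OF _ continuous_ex, unfolded]])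
      (auto simp: o_assoc intro: continuous_map_compose continuous_lg continuous_ex)
  then show ?thesis
    by (rule continuous_map_eq) (auto simp: topspace_T inv_ex[symmetric])
qed

lemma ex_image: "ex ` S = {x \<in> carrier G. lg x \<in> S}"
proof (intro Set.set_eqI iffI)
  fix x assume "x \<in> {x \<in> carrier G. lg x \<in> S}"
  then have "x = ex (lg x)" "lg x \<in> S" by auto
  then show "x \<in> ex ` S" by (rule image_eqI)
qed auto

lemma ex_image_sets: "S \<in> sets borel \<Longrightarrow> ex ` S \<in> sets (borel_of \<T>)"
proof -
  assume "S \<in> sets borel"
  then have "lg -` S \<inter> space (borel_of \<T>) \<in> sets (borel_of \<T>)" using lg_measurable by (rule measurable_sets[rotated])
  also have "lg -` S \<inter> space (borel_of \<T>) = ex ` S" by (auto simp: ex_image space_borel_of)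
  finally show ?thesis .
qed

lemma compactin_ex_cball: "compactin \<T> (ex ` cball 0 r)"
  by (rule image_compactin[OF _ continuous_ex]) simp

lemma openin_ex_ball: "openin \<T> (ex ` ball 0 r)"
proof -
  have "openin \<T> {x \<in> topspace \<T>. lg x \<in> ball 0 r}"
    by (rule openin_continuous_map_preimage[OF continuous_lg]) simp
  also have "{x \<in> topspace \<T>. lg x \<in> ball 0 r} = ex ` ball 0 r"
    by (simp only: ex_image topspace_T)
  finally show ?thesis .
qed

text \<open>Exponential balls exhaust the group by sets of finite measure, and they supply sets of
  positive finite measure by which common factors can be cancelled.\<close>

lemma haar_regular_ball:
  assumes "haar_regular \<T> \<mu>"
  shows "emeasure \<mu> (ex ` cball 0 r) < \<infinity>" "emeasure \<mu> (ex ` ball 0 r) < \<infinity>"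
    "r > 0 \<Longrightarrow> 0 < emeasure \<mu> (ex ` ball 0 r)"
proof -
  show c: "emeasure \<mu> (ex ` cball 0 r) < \<infinity>"
    using assms by (simp add: haar_regular_def compactin_ex_cball)
  have "emeasure \<mu> (ex ` ball 0 r) \<le> emeasure \<mu> (ex ` cball 0 r)"
    using assms ex_image_sets[of "cball 0 r"] by (intro emeasure_mono image_mono ball_subset_cball) (auto simp: haar_regular_def)
  then show "emeasure \<mu> (ex ` ball 0 r) < \<infinity>" using c by (rule order.strict_trans1)
  show "r > 0 \<Longrightarrow> 0 < emeasure \<mu> (ex ` ball 0 r)"
    using assms openin_ex_ball[of r] unfolding haar_regular_def by auto
qed

lemma haar_regular_sets:
  assumes "haar_regular \<T> \<mu>"
  shows "sets \<mu> = sets (borel_of \<T>)" "space \<mu> = carrier G"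
  using assms sets_eq_imp_space_eq[of \<mu> "borel_of \<T>"] by (auto simp: haar_regular_def space_borel_of)

lemma haar_regular_sigma_finite:
  assumes "haar_regular \<T> \<mu>"
  shows "sigma_finite_measure \<mu>"
proof
  let ?A = "range (\<lambda>n::nat. ex ` cball 0 (real n))"
  have "x \<in> \<Union>?A" if "x \<in> carrier G" for x
  proof -
    obtain n :: nat where "norm (lg x) \<le> real n" using real_arch_simple by blast
    then show ?thesis using that by (auto simp: image_iff intro!: exI[of _ n] bexI[of _ "lg x"])
  qed
  then have "\<Union>?A = space \<mu>" using haar_regular_sets[OF assms] by auto
  moreover have "?A \<subseteq> sets \<mu>" using haar_regular_sets[OF assms] ex_image_sets by auto
  moreover have "\<forall>a\<in>?A. emeasure \<mu> a \<noteq> \<infinity>" using haar_regular_ball(1)[OF assms] by (auto simp: less_top)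
  ultimately show "\<exists>A. countable A \<and> A \<subseteq> sets \<mu> \<and> \<Union>A = space \<mu> \<and> (\<forall>a\<in>A. emeasure \<mu> a \<noteq> \<infinity>)"
    by (intro exI[of _ ?A]) auto
qed

end

section \<open>Translations of Haar measure and the modular function\<close>

locale exp_haar = exp_group G \<A> ex
  for G :: "'g monoid" (structure) and \<A> :: "('g, real^'n) atlas" and ex :: "real^'n \<Rightarrow> 'g" +
  fixes \<mu>r :: "'g measure" and \<Delta> :: "'g \<Rightarrow> real"
  assumes right_haar: "right_haar G (atlas_topology \<A>) \<mu>r"
    and modular: "modular_function G (atlas_topology \<A>) \<Delta>"
begin

abbreviation "\<B> \<equiv> borel_of \<T>"

text \<open>A left Haar measure tied to \<mu>r with no free constant. The defining property of
  \<open>modular_function\<close> speaks of left Haar measures and becomes usable through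
  it.\<close>

definition \<nu> :: "'g measure" where "\<nu> = distr \<mu>r \<B> (\<lambda>x. inv x)"

lemma regular: "haar_regular \<T> \<mu>r" using right_haar by (simp add: right_haar_def)

lemma sets_\<mu>r [simp, measurable_cong]: "sets \<mu>r = sets \<B>" and space_\<mu>r [simp]: "space \<mu>r = carrier G"
  using haar_regular_sets[OF regular] by auto

lemma sets_\<nu> [simp, measurable_cong]: "sets \<nu> = sets \<B>" and space_\<nu> [simp]: "space \<nu> = carrier G"
  by (auto simp: \<nu>_def space_borel_of)

lemmas [measurable] = inv_measurable

lemma mult_measurable' [measurable (raw)]:
  assumes "f \<in> M \<rightarrow>\<^sub>M \<B>" "g \<in> M \<rightarrow>\<^sub>M \<B>"
  shows "(\<lambda>x. f x \<otimes> g x) \<in> M \<rightarrow>\<^sub>M \<B>"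
  using measurable_compose[OF measurable_Pair[OF assms] mult_measurable] by simp

lemma const_measurable: "x \<in> carrier G \<Longrightarrow> (\<lambda>_. x) \<in> M \<rightarrow>\<^sub>M \<B>"
  by (simp add: space_borel_of)

lemma left_mult_measurable: "x \<in> carrier G \<Longrightarrow> (\<lambda>y. x \<otimes> y) \<in> \<B> \<rightarrow>\<^sub>M \<B>"
  and right_mult_measurable: "x \<in> carrier G \<Longrightarrow> (\<lambda>y. y \<otimes> x) \<in> \<B> \<rightarrow>\<^sub>M \<B>"
  by (intro mult_measurable' const_measurable measurable_ident_sets[OF refl]; assumption)+

lemma \<Delta>_pos [simp]: "x \<in> carrier G \<Longrightarrow> 0 < \<Delta> x"
  using modular by (simp add: modular_function_def)

lemma right_translate_vimage:
  assumes x: "x \<in> carrier G" and A: "A \<subseteq> carrier G"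
  shows "(\<lambda>y. y \<otimes> x) -` A \<inter> carrier G = (\<lambda>y. y \<otimes> inv x) ` A"
proof (intro Set.set_eqI iffI)
  fix y assume "y \<in> (\<lambda>y. y \<otimes> x) -` A \<inter> carrier G"
  then have y: "y \<in> carrier G" "y \<otimes> x \<in> A" by auto
  have "y = y \<otimes> x \<otimes> inv x" using x y by (simp add: m_assoc)
  then show "y \<in> (\<lambda>y. y \<otimes> inv x) ` A" using y by blast
next
  fix y assume "y \<in> (\<lambda>y. y \<otimes> inv x) ` A"
  then obtain z where z: "z \<in> A" "y = z \<otimes> inv x" by blast
  then show "y \<in> (\<lambda>y. y \<otimes> x) -` A \<inter> carrier G" using x A by (auto simp: m_assoc)
qed

lemma inv_vimage: "A \<subseteq> carrier G \<Longrightarrow> (\<lambda>x. inv x) -` A \<inter> carrier G = (\<lambda>x. inv x) ` A"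
  by (auto simp: image_iff) (metis inv_inv)

lemma sets_carrier: "A \<in> sets \<B> \<Longrightarrow> A \<subseteq> carrier G"
  using sets.sets_into_space space_borel_of by blast

lemma emeasure_\<nu>: "A \<in> sets \<B> \<Longrightarrow> emeasure \<nu> A = emeasure \<mu>r ((\<lambda>x. inv x) ` A)"
  unfolding \<nu>_def by (subst emeasure_distr) (auto simp: inv_vimage sets_carrier)

lemma inv_image_sets: "A \<in> sets \<B> \<Longrightarrow> (\<lambda>x. inv x) ` A \<in> sets \<B>"
  using measurable_sets[OF inv_measurable, of A] by (simp add: space_borel_of inv_vimage sets_carrier)

lemma left_haar_\<nu>: "left_haar G \<T> \<nu>"
  unfolding left_haar_def haar_regular_def
proof (intro conjI allI impI ballI)
  show "sets \<nu> = sets \<B>" by simp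
  fix C assume C: "compactin \<T> C"
  \<comment> \<open>Compact sets are not shown to be Borel; a set outside the sigma-algebra has
    measure 0 by convention.\<close>
  show "emeasure \<nu> C < \<infinity>"
  proof (cases "C \<in> sets \<B>")
    case True
    then show ?thesis
      using regular image_compactin[OF C inv_continuous] by (simp add: emeasure_\<nu> haar_regular_def)
  qed (simp add: emeasure_notin_sets)
next
  fix U assume U: "openin \<T> U" "U \<noteq> {}"
  have Us: "U \<subseteq> carrier G" using openin_subset[OF U(1)] by (simp add: topspace_T)
  have "openin \<T> {x \<in> topspace \<T>. inv x \<in> U}"
    using inv_continuous U(1) unfolding continuous_map_def by blast
  also have "{x \<in> topspace \<T>. inv x \<in> U} = (\<lambda>x. inv x) ` U"
    using inv_vimage[OF Us] by (auto simp: topspace_T)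
  finally show "0 < emeasure \<nu> U"
    using U regular by (simp add: emeasure_\<nu>[OF openin_sets] haar_regular_def)
next
  fix x A assume x: "x \<in> carrier G" and "A \<in> sets \<nu>"
  then have A: "A \<in> sets \<B>" by simp
  note Ac = sets_carrier[OF A]
  have img: "(\<lambda>x. inv x) ` (\<lambda>y. x \<otimes> y) ` A = (\<lambda>y. y \<otimes> inv x) ` (\<lambda>x. inv x) ` A"
    unfolding image_image using Ac x by (intro image_cong refl) (auto simp: inv_mult_group)
  have "(\<lambda>y. x \<otimes> y) ` A = (\<lambda>y. inv x \<otimes> y) -` A \<inter> carrier G"
  proof (intro Set.set_eqI iffI)
    fix y assume y: "y \<in> (\<lambda>y. inv x \<otimes> y) -` A \<inter> carrier G"
    then have "y = x \<otimes> (inv x \<otimes> y)" using x by (simp add: m_assoc[symmetric])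
    then show "y \<in> (\<lambda>y. x \<otimes> y) ` A" using y by blast
  qed (use Ac x in \<open>auto simp: m_assoc[symmetric]\<close>)
  then have "(\<lambda>y. x \<otimes> y) ` A \<in> sets \<B>"
    using measurable_sets[OF left_mult_measurable A, of "inv x"] x by (simp add: space_borel_of)
  then have "emeasure \<nu> ((\<lambda>y. x \<otimes> y) ` A) = emeasure \<mu>r ((\<lambda>y. y \<otimes> inv x) ` (\<lambda>x. inv x) ` A)"
    by (simp add: emeasure_\<nu> img)
  also have "\<dots> = emeasure \<mu>r ((\<lambda>x. inv x) ` A)"
    using right_haar x inv_image_sets[OF A] by (simp add: right_haar_def)
  finally show "emeasure \<nu> ((\<lambda>y. x \<otimes> y) ` A) = emeasure \<nu> A" using A by (simp add: emeasure_\<nu>)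
qed

lemma regular_\<nu>: "haar_regular \<T> \<nu>" using left_haar_\<nu> by (simp add: left_haar_def)

sublocale r: sigma_finite_measure \<mu>r by (rule haar_regular_sigma_finite[OF regular])
sublocale l: sigma_finite_measure \<nu> by (rule haar_regular_sigma_finite[OF regular_\<nu>])
sublocale pair_sigma_finite \<mu>r \<nu> ..

lemma \<nu>_right_translate:
  "x \<in> carrier G \<Longrightarrow> A \<in> sets \<B> \<Longrightarrow> emeasure \<nu> ((\<lambda>y. y \<otimes> x) ` A) = ennreal (\<Delta> x) * emeasure \<nu> A"
  using modular left_haar_\<nu> unfolding modular_function_def by simp

lemma distr_right_\<mu>r:
  assumes x: "x \<in> carrier G"
  shows "distr \<mu>r \<B> (\<lambda>y. y \<otimes> x) = \<mu>r"
proof (rule measure_eqI)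
  fix A assume "A \<in> sets (distr \<mu>r \<B> (\<lambda>y. y \<otimes> x))"
  then have A: "A \<in> sets \<B>" by simp
  then show "emeasure (distr \<mu>r \<B> (\<lambda>y. y \<otimes> x)) A = emeasure \<mu>r A"
    using right_haar right_mult_measurable[OF x] x
    by (subst emeasure_distr) (auto simp: right_translate_vimage sets_carrier right_haar_def)
qed simp

lemma distr_left_\<nu>:
  assumes x: "x \<in> carrier G"
  shows "distr \<nu> \<B> (\<lambda>y. x \<otimes> y) = \<nu>"
proof (rule measure_eqI)
  fix A assume "A \<in> sets (distr \<nu> \<B> (\<lambda>y. x \<otimes> y))"
  then have A: "A \<in> sets \<B>" by simp
  have "(\<lambda>y. x \<otimes> y) -` A \<inter> carrier G = (\<lambda>y. inv x \<otimes> y) ` A"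
  proof (intro Set.set_eqI iffI)
    fix y assume y: "y \<in> (\<lambda>y. x \<otimes> y) -` A \<inter> carrier G"
    then have "y = inv x \<otimes> (x \<otimes> y)" using x by (simp add: m_assoc[symmetric])
    then show "y \<in> (\<lambda>y. inv x \<otimes> y) ` A" using y by blast
  qed (use sets_carrier[OF A] x in \<open>auto simp: m_assoc[symmetric]\<close>)
  then show "emeasure (distr \<nu> \<B> (\<lambda>y. x \<otimes> y)) A = emeasure \<nu> A"
    using left_haar_\<nu> left_mult_measurable[OF x] x A
    by (subst emeasure_distr) (auto simp: left_haar_def)
qed simp

text \<open>The argument is inverted because the preimage of A under right translation by x is the
  translate of A by x^-1.\<close>

lemma distr_right_\<nu>:
  assumes x: "x \<in> carrier G"
  shows "distr \<nu> \<B> (\<lambda>y. y \<otimes> x) = density \<nu> (\<lambda>_. ennreal (\<Delta> (inv x)))"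
proof (rule measure_eqI)
  fix A assume "A \<in> sets (distr \<nu> \<B> (\<lambda>y. y \<otimes> x))"
  then have A: "A \<in> sets \<B>" by simp
  then show "emeasure (distr \<nu> \<B> (\<lambda>y. y \<otimes> x)) A = emeasure (density \<nu> (\<lambda>_. ennreal (\<Delta> (inv x)))) A"
    using right_mult_measurable[OF x] x
    by (subst emeasure_distr) (auto simp: right_translate_vimage sets_carrier \<nu>_right_translate emeasure_density_const)
qed simp

text \<open>\<open>modular_function\<close> does not state multiplicativity. Translating an
  exponential ball by x and back multiplies its measure, which is positive and finite, by both
  factors.\<close>

lemma \<Delta>_inv: "x \<in> carrier G \<Longrightarrow> \<Delta> (inv x) = 1 / \<Delta> x"
proof -
  assume x: "x \<in> carrier G"
  define A where "A = ex ` ball (0::real^'n) 1"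
  have A: "A \<in> sets \<B>" unfolding A_def by (rule ex_image_sets) simp
  have fin: "emeasure \<nu> A < \<infinity>" "0 < emeasure \<nu> A" unfolding A_def using haar_regular_ball[OF regular_\<nu>] by auto
  have "emeasure \<nu> A = emeasure \<nu> ((\<lambda>y. y \<otimes> inv x) ` (\<lambda>y. y \<otimes> x) ` A)"
  proof (rule arg_cong[of _ _ "emeasure \<nu>"])
    have "(\<lambda>y. y \<otimes> x \<otimes> inv x) ` A = (\<lambda>y. y) ` A"
      using x sets_carrier[OF A] by (intro image_cong refl) (auto simp: m_assoc)
    then show "A = (\<lambda>y. y \<otimes> inv x) ` (\<lambda>y. y \<otimes> x) ` A" by (simp add: image_image)
  qed
  also have "\<dots> = ennreal (\<Delta> (inv x)) * (ennreal (\<Delta> x) * emeasure \<nu> A)"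
  proof -
    have "(\<lambda>y. y \<otimes> x) ` A = (\<lambda>y. y \<otimes> inv x) -` A \<inter> carrier G"
      using right_translate_vimage[of "inv x" A] x sets_carrier[OF A] by simp
    then have "(\<lambda>y. y \<otimes> x) ` A \<in> sets \<B>"
      using measurable_sets[OF right_mult_measurable A, of "inv x"] x by (simp add: space_borel_of)
    then show ?thesis using x A by (simp add: \<nu>_right_translate)
  qed
  finally have "ennreal 1 * emeasure \<nu> A = ennreal (\<Delta> (inv x) * \<Delta> x) * emeasure \<nu> A"
    using x by (simp add: ennreal_mult less_imp_le mult.assoc)
  then have "ennreal 1 = ennreal (\<Delta> (inv x) * \<Delta> x)"
    using fin by (auto simp: mult.commute[of _ "emeasure \<nu> A"] ennreal_mult_cancel_left simp del: ennreal_1)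
  then have "\<Delta> (inv x) * \<Delta> x = 1"
    using x by (metis ennreal_inj inv_closed less_imp_le mult_nonneg_nonneg zero_le_one \<Delta>_pos)
  moreover have "\<Delta> x \<noteq> 0" using \<Delta>_pos[OF x] by linarith
  ultimately show ?thesis by (subst nonzero_eq_divide_eq)
qed

text \<open>The definition gives \<Delta> pointwise only. Written as the quotient of \<nu>(A x) by
  \<nu>(A) for a ball A, it becomes an integral depending on a parameter, which is measurable by
  Tonelli's theorem.\<close>

lemma \<Delta>_measurable [measurable]: "\<Delta> \<in> borel_measurable \<B>"
proof -
  define A where "A = ex ` ball (0::real^'n) 1"
  have A [measurable]: "A \<in> sets \<B>" unfolding A_def by (rule ex_image_sets) simp
  have fin: "emeasure \<nu> A < \<infinity>" "0 < emeasure \<nu> A" unfolding A_def using haar_regular_ball[OF regular_\<nu>] by auto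
  have "(\<lambda>x. \<integral>\<^sup>+y. indicator A (y \<otimes> inv x) \<partial>\<nu>) \<in> borel_measurable \<B>"
    by (rule l.borel_measurable_nn_integral) measurable
  then have "(\<lambda>x. enn2real ((\<integral>\<^sup>+y. indicator A (y \<otimes> inv x) \<partial>\<nu>) / emeasure \<nu> A)) \<in> borel_measurable \<B>"
    by measurable
  then show ?thesis
  proof (rule measurable_cong[THEN iffD1, rotated])
    fix x assume "x \<in> space \<B>"
    then have x: "x \<in> carrier G" by (simp add: space_borel_of)
    have "(\<integral>\<^sup>+y. indicator A (y \<otimes> inv x) \<partial>\<nu>) = emeasure (distr \<nu> \<B> (\<lambda>y. y \<otimes> inv x)) A"
      using right_mult_measurable[of "inv x"] x
      by (subst nn_integral_indicator[symmetric], simp add: A) (subst nn_integral_distr, auto)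
    also have "\<dots> = ennreal (\<Delta> x) * emeasure \<nu> A"
      using x by (simp add: distr_right_\<nu> emeasure_density_const A)
    finally have "(\<integral>\<^sup>+y. indicator A (y \<otimes> inv x) \<partial>\<nu>) / emeasure \<nu> A = ennreal (\<Delta> x)"
      using fin by (simp add: ennreal_mult_divide_eq)
    then show "enn2real ((\<integral>\<^sup>+y. indicator A (y \<otimes> inv x) \<partial>\<nu>) / emeasure \<nu> A) = \<Delta> x"
      using x by (simp add: less_imp_le)
  qed
qed

text \<open>Weil's uniqueness argument, applied to the pair \<open>\<nu>\<close>, \<open>\<mu>r\<close>: the integral of \<open>f(yx) g(y)\<close> is
  evaluated in two ways. Since \<open>\<nu>\<close> is the image of \<open>\<mu>r\<close> under inversion, the two constants
  involving \<open>g\<close> agree.\<close>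

lemma \<nu>_eq_density: "\<nu> = density \<mu>r (\<lambda>x. ennreal (\<Delta> x))"
proof (rule measure_eqI)
  fix A assume "A \<in> sets \<nu>"
  then have A [measurable]: "A \<in> sets \<B>" by simp
  define f :: "'g \<Rightarrow> ennreal" where "f = indicator A"
  define g :: "'g \<Rightarrow> ennreal" where "g = indicator (ex ` ball (0::real^'n) 1)"
  have [measurable]: "f \<in> borel_measurable \<B>" unfolding f_def by measurable
  have B1 [measurable]: "ex ` ball (0::real^'n) 1 \<in> sets \<B>" by (rule ex_image_sets) simp
  have [measurable]: "g \<in> borel_measurable \<B>" unfolding g_def by measurable
  define c where "c = (\<integral>\<^sup>+y. g y \<partial>\<mu>r)"
  have c: "c < \<infinity>" "0 < c"
    unfolding c_def g_def using haar_regular_ball[OF regular, of 1] B1 by auto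
  have "emeasure \<nu> A * c = (\<integral>\<^sup>+y. g y * (\<integral>\<^sup>+x. f x \<partial>\<nu>) \<partial>\<mu>r)"
    unfolding c_def f_def by (simp add: nn_integral_multc mult.commute)
  also have "\<dots> = (\<integral>\<^sup>+y. (\<integral>\<^sup>+x. g y * f (y \<otimes> x) \<partial>\<nu>) \<partial>\<mu>r)"
  proof (rule nn_integral_cong)
    fix y assume "y \<in> space \<mu>r"
    then have y: "y \<in> carrier G" by simp
    note [measurable] = left_mult_measurable[OF y]
    have "(\<integral>\<^sup>+x. f x \<partial>\<nu>) = (\<integral>\<^sup>+x. f (y \<otimes> x) \<partial>\<nu>)"
      by (subst distr_left_\<nu>[OF y, symmetric], subst nn_integral_distr) auto
    then show "g y * (\<integral>\<^sup>+x. f x \<partial>\<nu>) = (\<integral>\<^sup>+x. g y * f (y \<otimes> x) \<partial>\<nu>)"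
      by (simp add: nn_integral_cmult)
  qed
  also have "\<dots> = (\<integral>\<^sup>+x. (\<integral>\<^sup>+y. g y * f (y \<otimes> x) \<partial>\<mu>r) \<partial>\<nu>)"
    by (rule Fubini'[symmetric]) measurable
  also have "\<dots> = (\<integral>\<^sup>+x. (\<integral>\<^sup>+y. g (y \<otimes> inv x) * f y \<partial>\<mu>r) \<partial>\<nu>)"
  proof (rule nn_integral_cong)
    fix x assume "x \<in> space \<nu>"
    then have x: "x \<in> carrier G" by simp
    then have xi: "inv x \<in> carrier G" by simp
    note [measurable] = right_mult_measurable[OF x] right_mult_measurable[OF xi]
    have "(\<integral>\<^sup>+y. g (y \<otimes> inv x) * f y \<partial>\<mu>r) = (\<integral>\<^sup>+y. g (y \<otimes> x \<otimes> inv x) * f (y \<otimes> x) \<partial>\<mu>r)"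
      by (subst distr_right_\<mu>r[OF x, symmetric], subst nn_integral_distr) auto
    also have "\<dots> = (\<integral>\<^sup>+y. g y * f (y \<otimes> x) \<partial>\<mu>r)"
      using x by (intro nn_integral_cong) (simp add: m_assoc)
    finally show "(\<integral>\<^sup>+y. g y * f (y \<otimes> x) \<partial>\<mu>r) = (\<integral>\<^sup>+y. g (y \<otimes> inv x) * f y \<partial>\<mu>r)" ..
  qed
  also have "\<dots> = (\<integral>\<^sup>+y. (\<integral>\<^sup>+x. g (y \<otimes> inv x) * f y \<partial>\<nu>) \<partial>\<mu>r)"
    by (rule Fubini') measurable
  also have "\<dots> = (\<integral>\<^sup>+y. ennreal (\<Delta> y) * f y * c \<partial>\<mu>r)"
  proof (rule nn_integral_cong)
    fix y assume "y \<in> space \<mu>r"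
    then have y: "y \<in> carrier G" by simp
    then have yi: "inv y \<in> carrier G" by simp
    note [measurable] = right_mult_measurable[OF yi] left_mult_measurable[OF y]
    have [measurable]: "(\<lambda>x. g (y \<otimes> inv x)) \<in> borel_measurable \<B>"
      by (rule measurable_compose[OF measurable_compose[OF inv_measurable left_mult_measurable[OF y]]]) measurable
    \<comment> \<open>Since y x^-1 is the inverse of x y^-1, the inner integral becomes a right
      translate under \<nu>, and this is where the factor \<Delta>(y) appears.\<close>
    have "(\<integral>\<^sup>+x. g (y \<otimes> inv x) \<partial>\<nu>) = (\<integral>\<^sup>+x. g (inv (x \<otimes> inv y)) \<partial>\<nu>)"
      using y by (intro nn_integral_cong) (simp add: inv_mult_group)
    also have "\<dots> = (\<integral>\<^sup>+x. g (inv x) \<partial>distr \<nu> \<B> (\<lambda>x. x \<otimes> inv y))"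
      by (subst nn_integral_distr) auto
    also have "\<dots> = ennreal (\<Delta> y) * (\<integral>\<^sup>+x. g (inv x) \<partial>\<nu>)"
      unfolding distr_right_\<nu>[OF yi] using y by (subst nn_integral_density) (auto simp: nn_integral_cmult)
    also have "(\<integral>\<^sup>+x. g (inv x) \<partial>\<nu>) = (\<integral>\<^sup>+x. g (inv (inv x)) \<partial>\<mu>r)"
      unfolding \<nu>_def by (subst nn_integral_distr) auto
    also have "\<dots> = c" unfolding c_def by (intro nn_integral_cong) simp
    finally show "(\<integral>\<^sup>+x. g (y \<otimes> inv x) * f y \<partial>\<nu>) = ennreal (\<Delta> y) * f y * c"
      by (subst nn_integral_multc) (auto simp: mult_ac)
  qed
  also have "\<dots> = emeasure (density \<mu>r (\<lambda>x. ennreal (\<Delta> x))) A * c"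
    by (simp add: nn_integral_multc emeasure_density f_def)
  finally show "emeasure \<nu> A = emeasure (density \<mu>r (\<lambda>x. ennreal (\<Delta> x))) A"
    using c unfolding mult.commute[of _ c] ennreal_mult_cancel_left by auto
qed simp

lemma distr_inv: "distr \<mu>r \<B> (\<lambda>x. inv x) = density \<mu>r (\<lambda>x. ennreal (\<Delta> x))"
  using \<nu>_eq_density unfolding \<nu>_def .

text \<open>Inversion exchanges left translation of \<mu>r with right translation of \<nu>, whose
  factor is known. This factor governs the wavelet transforms of translated vectors.\<close>

lemma distr_left_\<mu>r:
  assumes x: "x \<in> carrier G"
  shows "distr \<mu>r \<B> (\<lambda>y. inv x \<otimes> y) = density \<mu>r (\<lambda>_. ennreal (1 / \<Delta> x))"
proof -
  have \<mu>r_eq: "\<mu>r = distr \<nu> \<B> (\<lambda>x. inv x)"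
  proof -
    have "distr \<nu> \<B> (\<lambda>x. inv x) = distr \<mu>r \<B> (\<lambda>x. x)"
      unfolding \<nu>_def by (subst distr_distr) (auto intro!: distr_cong simp: o_def)
    also have "\<dots> = \<mu>r" by (rule distr_id2) simp
    finally show ?thesis ..
  qed
  note [measurable] = left_mult_measurable[of "inv x"] right_mult_measurable[OF x]
  show ?thesis
  proof (rule measure_eqI)
    fix A assume "A \<in> sets (distr \<mu>r \<B> (\<lambda>y. inv x \<otimes> y))"
    then have A [measurable]: "A \<in> sets \<B>" by simp
    have "emeasure (distr \<mu>r \<B> (\<lambda>y. inv x \<otimes> y)) A = (\<integral>\<^sup>+y. indicator A (inv x \<otimes> y) \<partial>\<mu>r)"
      using x by (subst nn_integral_indicator[symmetric], simp) (subst nn_integral_distr, auto)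
    also have "\<dots> = (\<integral>\<^sup>+y. indicator A (inv x \<otimes> inv y) \<partial>\<nu>)"
      using x by (subst \<mu>r_eq, subst nn_integral_distr) auto
    also have "\<dots> = (\<integral>\<^sup>+y. indicator A (inv (y \<otimes> x)) \<partial>\<nu>)"
      using x by (intro nn_integral_cong) (simp add: inv_mult_group)
    also have "\<dots> = (\<integral>\<^sup>+y. indicator A (inv y) \<partial>distr \<nu> \<B> (\<lambda>y. y \<otimes> x))"
      by (subst nn_integral_distr) auto
    also have "\<dots> = ennreal (1 / \<Delta> x) * (\<integral>\<^sup>+y. indicator A (inv y) \<partial>\<nu>)"
      unfolding distr_right_\<nu>[OF x] using x by (subst nn_integral_density) (auto simp: nn_integral_cmult \<Delta>_inv)
    also have "(\<integral>\<^sup>+y. indicator A (inv y) \<partial>\<nu>) = (\<integral>\<^sup>+y. indicator A y \<partial>\<mu>r)"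
      by (subst \<mu>r_eq, subst nn_integral_distr) auto
    also have "ennreal (1 / \<Delta> x) * (\<integral>\<^sup>+y. indicator A y \<partial>\<mu>r) = emeasure (density \<mu>r (\<lambda>_. ennreal (1 / \<Delta> x))) A"
      by (simp add: emeasure_density_const)
    finally show "emeasure (distr \<mu>r \<B> (\<lambda>y. inv x \<otimes> y)) A = emeasure (density \<mu>r (\<lambda>_. ennreal (1 / \<Delta> x))) A" .
  qed simp
qed

lemma integral_inv:
  fixes h :: "'g \<Rightarrow> 'b::{banach,second_countable_topology}"
  assumes [measurable]: "h \<in> borel_measurable \<B>"
  shows "(\<integral>x. h (inv x) \<partial>\<mu>r) = (\<integral>x. \<Delta> x *\<^sub>R h x \<partial>\<mu>r)"
    and "integrable \<mu>r (\<lambda>x. h (inv x)) \<longleftrightarrow> integrable \<mu>r (\<lambda>x. \<Delta> x *\<^sub>R h x)"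
proof -
  have "(\<integral>x. h (inv x) \<partial>\<mu>r) = (\<integral>x. h x \<partial>distr \<mu>r \<B> (\<lambda>x. inv x))"
    by (subst integral_distr) auto
  also have "\<dots> = (\<integral>x. \<Delta> x *\<^sub>R h x \<partial>\<mu>r)"
    unfolding distr_inv by (subst integral_density) (auto intro!: AE_I2 less_imp_le)
  finally show "(\<integral>x. h (inv x) \<partial>\<mu>r) = (\<integral>x. \<Delta> x *\<^sub>R h x \<partial>\<mu>r)" .
  have "integrable \<mu>r (\<lambda>x. h (inv x)) \<longleftrightarrow> integrable (distr \<mu>r \<B> (\<lambda>x. inv x)) h"
    by (subst integrable_distr_eq) auto
  also have "\<dots> \<longleftrightarrow> integrable \<mu>r (\<lambda>x. \<Delta> x *\<^sub>R h x)"
    unfolding distr_inv by (subst integrable_density) (auto intro!: AE_I2 less_imp_le)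
  finally show "integrable \<mu>r (\<lambda>x. h (inv x)) \<longleftrightarrow> integrable \<mu>r (\<lambda>x. \<Delta> x *\<^sub>R h x)" .
qed

lemma integral_left_translate:
  fixes h :: "'g \<Rightarrow> 'b::{banach,second_countable_topology}"
  assumes [measurable]: "h \<in> borel_measurable \<B>" and x: "x \<in> carrier G"
  shows "(\<integral>y. h (inv x \<otimes> y) \<partial>\<mu>r) = (1 / \<Delta> x) *\<^sub>R (\<integral>y. h y \<partial>\<mu>r)"
    and "integrable \<mu>r h \<Longrightarrow> integrable \<mu>r (\<lambda>y. h (inv x \<otimes> y))"
proof -
  note [measurable] = left_mult_measurable[OF inv_closed[OF x]]
  have "(\<integral>y. h (inv x \<otimes> y) \<partial>\<mu>r) = (\<integral>y. h y \<partial>distr \<mu>r \<B> (\<lambda>y. inv x \<otimes> y))"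
    by (subst integral_distr) auto
  also have "\<dots> = (1 / \<Delta> x) *\<^sub>R (\<integral>y. h y \<partial>\<mu>r)"
    unfolding distr_left_\<mu>r[OF x] using x by (subst integral_density) (auto simp: less_imp_le)
  finally show "(\<integral>y. h (inv x \<otimes> y) \<partial>\<mu>r) = (1 / \<Delta> x) *\<^sub>R (\<integral>y. h y \<partial>\<mu>r)" .
  assume "integrable \<mu>r h"
  then have "integrable (distr \<mu>r \<B> (\<lambda>y. inv x \<otimes> y)) h"
    unfolding distr_left_\<mu>r[OF x] using x by (subst integrable_density) (auto simp: less_imp_le)
  then show "integrable \<mu>r (\<lambda>y. h (inv x \<otimes> y))"
    by (subst (asm) integrable_distr_eq) auto
qed

lemma AE_inv:
  assumes "AE x in \<mu>r. P x"
  shows "AE x in \<mu>r. P (inv x)"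
proof -
  have "AE x in distr \<mu>r \<B> (\<lambda>x. inv x). P x"
    unfolding distr_inv using assms by (subst AE_density) auto
  then show ?thesis by (rule AE_distrD[rotated]) measurable
qed

section \<open>The twisted involution on L2\<close>

definition sharp :: "('g \<Rightarrow> complex) \<Rightarrow> 'g \<Rightarrow> complex" where
  "sharp f x = complex_of_real (sqrt (\<Delta> x)) * cnj (f (inv x))"

lemma sharp_measurable:
  assumes [measurable]: "f \<in> borel_measurable \<B>"
  shows "sharp f \<in> borel_measurable \<B>"
  unfolding sharp_def[abs_def] by measurable

text \<open>The squared modulus of \<open>sharp f\<close> at x is \<open>h\<close> at x^-1;
  substituting x^-1 for x brings in a factor \<Delta>(x), which cancels the \<Delta>(x^-1) inside
  \<open>h\<close>.\<close>

lemma sharp_L2: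
  assumes f: "f \<in> L2 \<mu>r"
  shows "sharp f \<in> L2 \<mu>r" "L2_norm \<mu>r (sharp f) = L2_norm \<mu>r f"
proof -
  have [measurable]: "f \<in> borel_measurable \<B>" using L2_measurable[OF f] by simp
  define h where "h x = \<Delta> (inv x) * (cmod (f x))\<^sup>2" for x
  have [measurable]: "h \<in> borel_measurable \<B>" unfolding h_def[abs_def] by measurable
  have 1: "(cmod (sharp f x))\<^sup>2 = h (inv x)" if "x \<in> carrier G" for x
    using that less_imp_le[OF \<Delta>_pos[OF that]] by (simp add: sharp_def h_def norm_mult power_mult_distrib)
  have 2: "\<Delta> x *\<^sub>R h x = (cmod (f x))\<^sup>2" if "x \<in> carrier G" for x
    using that less_imp_neq[OF \<Delta>_pos[OF that]] by (simp add: h_def \<Delta>_inv)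
  have "integrable \<mu>r (\<lambda>x. \<Delta> x *\<^sub>R h x)"
    by (rule Bochner_Integration.integrable_cong[THEN iffD2, OF refl _ L2_integrable[OF f]]) (simp only: space_\<mu>r 2)
  then have "integrable \<mu>r (\<lambda>x. h (inv x))" using integral_inv(2)[of h] by simp
  then have "integrable \<mu>r (\<lambda>x. (cmod (sharp f x))\<^sup>2)"
    by (rule Bochner_Integration.integrable_cong[THEN iffD2, OF refl, rotated]) (simp only: space_\<mu>r 1)
  then show "sharp f \<in> L2 \<mu>r" using sharp_measurable[of f] by (simp add: L2_def)
  have "(\<integral>x. (cmod (sharp f x))\<^sup>2 \<partial>\<mu>r) = (\<integral>x. h (inv x) \<partial>\<mu>r)"
    by (rule Bochner_Integration.integral_cong[OF refl]) (simp only: space_\<mu>r 1)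
  also have "\<dots> = (\<integral>x. \<Delta> x *\<^sub>R h x \<partial>\<mu>r)" by (rule integral_inv) measurable
  also have "\<dots> = (\<integral>x. (cmod (f x))\<^sup>2 \<partial>\<mu>r)"
    by (rule Bochner_Integration.integral_cong[OF refl]) (simp only: space_\<mu>r 2)
  finally show "L2_norm \<mu>r (sharp f) = L2_norm \<mu>r f" by (simp add: L2_norm_def)
qed

lemma sharp_diff: "sharp (\<lambda>x. f x - g x) = (\<lambda>x. sharp f x - sharp g x)"
  by (simp add: sharp_def fun_eq_iff algebra_simps)

lemma sharp_limit:
  assumes "\<And>n. fs n \<in> L2 \<mu>r" "f \<in> L2 \<mu>r" "L2_limit \<mu>r fs f"
  shows "L2_limit \<mu>r (\<lambda>n. sharp (fs n)) (sharp f)"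
  using assms(3) sharp_L2(2)[OF L2_diff[OF assms(1,2)]] unfolding L2_limit_iff sharp_diff by simp

end

subsection \<open>The Fourier-Kirillov transform\<close>

locale exp_kirillov = exp_haar G \<A> ex \<mu>r \<Delta>
  for G :: "'g monoid" (structure) and \<A> :: "('g, real^'n::{finite,wellorder}) atlas" and ex :: "real^'n::_ \<Rightarrow> 'g"
    and \<mu>r :: "'g measure" and \<Delta> :: "'g \<Rightarrow> real" +
  fixes F :: "real^'n::_"
  assumes stab: "{g \<in> carrier G. coadjoint G ex g F = F} = {\<one>}"
    and \<mu>r_ex: "\<mu>r = distr (density lborel (\<lambda>X. ennreal (Theta G ex X))) (borel_of (atlas_topology \<A>)) ex"
    and distr_kappa: "distr \<mu>r borel (kappa G ex F) =
           density lborel (\<lambda>Y. ennreal (\<bar>Pf G ex F\<bar> * \<Delta> (inv_into (carrier G) (kappa G ex F) Y))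
                                 * indicator (coadjoint_orbit G ex F) Y)"
begin

abbreviation "\<Theta> \<equiv> Theta G ex"
abbreviation "\<kappa> \<equiv> kappa G ex F"
abbreviation "\<O> \<equiv> coadjoint_orbit G ex F"
abbreviation "pf \<equiv> \<bar>Pf G ex F\<bar>"
abbreviation "weight y \<equiv> sqrt (pf * \<Delta> y)"
abbreviation "KI \<equiv> kirillov_integral G ex \<mu>r \<Delta> F"

lemmas [measurable] = kappa_measurable

section \<open>Integration in exponential and orbit coordinates\<close>

lemma nn_integral_\<mu>r:
  assumes [measurable]: "h \<in> borel_measurable \<B>"
  shows "(\<integral>\<^sup>+x. h x \<partial>\<mu>r) = (\<integral>\<^sup>+X. ennreal (\<Theta> X) * h (ex X) \<partial>lborel)"
proof -
  have "(\<integral>\<^sup>+x. h x \<partial>\<mu>r) = (\<integral>\<^sup>+x. h x \<partial>distr (density lborel (\<lambda>X. ennreal (\<Theta> X))) \<B> ex)"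
    by (rule arg_cong[of _ _ "\<lambda>M. \<integral>\<^sup>+x. h x \<partial>M", OF \<mu>r_ex])
  also have "\<dots> = (\<integral>\<^sup>+X. h (ex X) \<partial>density lborel (\<lambda>X. ennreal (\<Theta> X)))"
    by (rule nn_integral_distr) measurable
  also have "\<dots> = (\<integral>\<^sup>+X. ennreal (\<Theta> X) * h (ex X) \<partial>lborel)"
    by (rule nn_integral_density) measurable
  finally show ?thesis .
qed

lemma AE_lborel_imp_AE_\<mu>r:
  assumes "AE X in lborel. P X"
  shows "AE x in \<mu>r. P (lg x)"
proof -
  have "AE X in density lborel (\<lambda>X. ennreal (\<Theta> X)). P X"
    using assms by (subst AE_density) auto
  also have "density lborel (\<lambda>X. ennreal (\<Theta> X)) = distr \<mu>r borel lg"
  proof -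
    have "distr \<mu>r borel lg = distr (density lborel (\<lambda>X. ennreal (\<Theta> X))) borel (\<lambda>X. X)"
      by (subst \<mu>r_ex, subst distr_distr) (auto simp: o_def)
    also have "\<dots> = density lborel (\<lambda>X. ennreal (\<Theta> X))" by (rule distr_id2) simp
    finally show ?thesis ..
  qed
  finally show ?thesis by (rule AE_distrD[rotated]) measurable
qed

text \<open>Both sides are Lebesgue densities of the image of \<mu>r under x to -log x. One is found
  by reflecting Lebesgue measure, the other by inverting on the group; densities are unique almost
  everywhere. No formula for the differential of the exponential map enters.\<close>

lemma Theta_uminus: "AE X in lborel. \<Theta> (- X) = \<Delta> (ex X) * \<Theta> X"
proof -
  have "density lborel (\<lambda>X. ennreal (\<Theta> (- X))) = density lborel (\<lambda>X. ennreal (\<Delta> (ex X) * \<Theta> X))"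
  proof (rule measure_eqI)
    fix S assume "S \<in> sets (density lborel (\<lambda>X. ennreal (\<Theta> (- X))))"
    then have [measurable]: "S \<in> sets borel" by simp
    have "emeasure (density lborel (\<lambda>X. ennreal (\<Theta> (- X)))) S = (\<integral>\<^sup>+X. ennreal (\<Theta> (- X)) * indicator S X \<partial>lborel)"
      by (simp add: emeasure_density)
    also have "\<dots> = (\<integral>\<^sup>+X. ennreal (\<Theta> X) * indicator S (- X) \<partial>distr lborel borel uminus)"
      by (subst nn_integral_distr) auto
    also have "\<dots> = (\<integral>\<^sup>+X. ennreal (\<Theta> X) * indicator S (- lg (ex X)) \<partial>lborel)"
      unfolding lborel_uminus by simp
    also have "\<dots> = (\<integral>\<^sup>+x. indicator S (- lg x) \<partial>\<mu>r)"
      by (rule nn_integral_\<mu>r[symmetric]) measurable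
    also have "\<dots> = (\<integral>\<^sup>+x. indicator S (lg (inv x)) \<partial>\<mu>r)"
      by (intro nn_integral_cong) (simp add: lg_inv)
    also have "\<dots> = (\<integral>\<^sup>+x. indicator S (lg x) \<partial>distr \<mu>r \<B> (\<lambda>x. inv x))"
      by (subst nn_integral_distr) auto
    also have "\<dots> = (\<integral>\<^sup>+x. ennreal (\<Delta> x) * indicator S (lg x) \<partial>\<mu>r)"
      unfolding distr_inv by (subst nn_integral_density) auto
    also have "\<dots> = (\<integral>\<^sup>+X. ennreal (\<Theta> X) * (ennreal (\<Delta> (ex X)) * indicator S (lg (ex X))) \<partial>lborel)"
      by (rule nn_integral_\<mu>r) measurable
    also have "\<dots> = (\<integral>\<^sup>+X. ennreal (\<Delta> (ex X) * \<Theta> X) * indicator S X \<partial>lborel)"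
      by (intro nn_integral_cong) (simp add: ennreal_mult Theta_nonneg less_imp_le mult_ac)
    also have "\<dots> = emeasure (density lborel (\<lambda>X. ennreal (\<Delta> (ex X) * \<Theta> X))) S"
      by (simp add: emeasure_density)
    finally show "emeasure (density lborel (\<lambda>X. ennreal (\<Theta> (- X)))) S
      = emeasure (density lborel (\<lambda>X. ennreal (\<Delta> (ex X) * \<Theta> X))) S" .
  qed simp
  then have "AE X in lborel. ennreal (\<Theta> (- X)) = ennreal (\<Delta> (ex X) * \<Theta> X)"
    by (rule sigma_finite_measure.density_unique[OF sigma_finite_lborel, rotated 2]) measurable
  then show ?thesis by eventually_elim (simp add: Theta_nonneg less_imp_le)
qed

text \<open>A total Borel inverse of the orbit map. Off the orbit it takes the identity of G as a
  default, which is harmless because \<open>dens\<close> vanishes there.\<close>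

definition kinv :: "real^'n::_ \<Rightarrow> 'g" where
  "kinv Y = ex (if Y \<in> \<O> then lg (inv_into (carrier G) \<kappa> Y) else 0)"

lemma open_orbit: "open \<O>" by (rule kappa_homeomorphism(1)[OF stab])

lemma kinv_measurable [measurable]: "kinv \<in> borel \<rightarrow>\<^sub>M \<B>"
proof -
  have [measurable]: "\<O> \<in> sets borel" using open_orbit by simp
  have "(\<lambda>Y. if Y \<in> \<O> then lg (inv_into (carrier G) \<kappa> Y) else 0) \<in> borel_measurable borel"
    by (rule borel_measurable_continuous_on_if) (use kappa_homeomorphism(2)[OF stab] in auto)
  then show ?thesis unfolding kinv_def[abs_def] by measurable
qed

lemma orbit_eq: "\<O> = \<kappa> ` carrier G"
  unfolding kappa_def coadjoint_orbit_def by (auto simp: image_iff) (metis inv_closed inv_inv)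

lemma kinv_eq: "Y \<in> \<O> \<Longrightarrow> kinv Y = inv_into (carrier G) \<kappa> Y"
  unfolding kinv_def orbit_eq by (simp add: inv_into_into)

lemma kinv_kappa: "x \<in> carrier G \<Longrightarrow> kinv (\<kappa> x) = x"
  by (subst kinv_eq) (auto simp: orbit_eq kappa_inj[OF stab])

lemma kinv_carrier [simp]: "kinv Y \<in> carrier G" by (simp add: kinv_def)

definition dens :: "real^'n::_ \<Rightarrow> real" where
  "dens Y = pf * \<Delta> (kinv Y) * indicator \<O> Y"

lemma dens_measurable [measurable]: "dens \<in> borel_measurable borel"
proof -
  have [measurable]: "\<O> \<in> sets borel" using open_orbit by simp
  show ?thesis unfolding dens_def[abs_def] by measurable
qed

lemma dens_nonneg: "0 \<le> dens Y" by (auto simp: dens_def less_imp_le)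

lemma distr_kappa': "distr \<mu>r borel \<kappa> = density lborel (\<lambda>Y. ennreal (dens Y))"
proof -
  have "(\<lambda>Y. ennreal (pf * \<Delta> (inv_into (carrier G) \<kappa> Y)) * indicator \<O> Y) = (\<lambda>Y. ennreal (dens Y))"
    by (auto simp: dens_def kinv_eq indicator_def fun_eq_iff)
  then show ?thesis unfolding distr_kappa by simp
qed

text \<open>With a vanishing Pfaffian the image of \<mu>r on the orbit would be the zero measure,
  although nonempty open sets have positive measure.\<close>

lemma pf_pos: "0 < pf"
proof (rule ccontr)
  assume "\<not> 0 < pf"
  then have "dens = (\<lambda>_. 0)" by (auto simp: dens_def fun_eq_iff)
  then have "emeasure (distr \<mu>r borel \<kappa>) UNIV = 0" unfolding distr_kappa' by (simp add: emeasure_density)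
  then have "emeasure \<mu>r (carrier G) = 0" by (subst (asm) emeasure_distr) auto
  moreover have "emeasure \<mu>r (ex ` ball 0 1) \<le> emeasure \<mu>r (carrier G)"
    by (intro emeasure_mono) (use sets.top[of \<mu>r] in auto)
  ultimately show False using haar_regular_ball(3)[OF regular, of 1] by simp
qed

text \<open>Transport by \<kappa> turns the integral over the group into a Euclidean Fourier
  transform of \<open>h\<close>, which carries the factor \<open>dens\<close>. Squaring produces
  \<open>dens\<close> twice: one copy converts Lebesgue measure back into \<mu>r, the other remains
  as the weight pf \<Delta>, and the denominator in the Kirillov transform is there to cancel
  it.\<close>

lemma fourier_orbit_bound:
  fixes u :: "'g \<Rightarrow> complex"
  assumes u: "integrable \<mu>r u"
  shows "(\<integral>\<^sup>+X. ennreal ((cmod (\<integral>y. u y * cis (- 2 * pi * (\<kappa> y \<bullet> X)) \<partial>\<mu>r))\<^sup>2) \<partial>lborel)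
    \<le> (\<integral>\<^sup>+y. ennreal (pf * \<Delta> y * (cmod (u y))\<^sup>2) \<partial>\<mu>r)"
proof -
  have [measurable]: "u \<in> borel_measurable \<B>" using borel_measurable_integrable[OF u] by simp
  define h where "h Y = dens Y *\<^sub>R u (kinv Y)" for Y
  have "integrable \<mu>r (\<lambda>y. u (kinv (\<kappa> y)))"
    by (rule Bochner_Integration.integrable_cong[THEN iffD2, OF refl _ u]) (simp add: kinv_kappa)
  then have "integrable (distr \<mu>r borel \<kappa>) (\<lambda>Y. u (kinv Y))"
    by (subst integrable_distr_eq) auto
  then have h: "integrable lborel h"
    unfolding distr_kappa' h_def[abs_def] by (subst (asm) integrable_density) (auto simp: dens_nonneg)
  have eq: "(\<integral>y. u y * cis (- 2 * pi * (\<kappa> y \<bullet> X)) \<partial>\<mu>r) = (\<integral>Y. h Y * cis (- 2 * pi * (Y \<bullet> X)) \<partial>lborel)" for X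
  proof -
    have "(\<integral>y. u y * cis (- 2 * pi * (\<kappa> y \<bullet> X)) \<partial>\<mu>r) = (\<integral>y. u (kinv (\<kappa> y)) * cis (- 2 * pi * (\<kappa> y \<bullet> X)) \<partial>\<mu>r)"
      by (intro Bochner_Integration.integral_cong refl) (simp add: kinv_kappa)
    also have "\<dots> = (\<integral>Y. u (kinv Y) * cis (- 2 * pi * (Y \<bullet> X)) \<partial>distr \<mu>r borel \<kappa>)"
      by (subst integral_distr) measurable
    also have "\<dots> = (\<integral>Y. dens Y *\<^sub>R (u (kinv Y) * cis (- 2 * pi * (Y \<bullet> X))) \<partial>lborel)"
      unfolding distr_kappa' by (subst integral_density) (measurable, auto simp: dens_nonneg)
    finally show ?thesis by (simp add: h_def)
  qed
  have "(\<integral>\<^sup>+X. ennreal ((cmod (\<integral>y. u y * cis (- 2 * pi * (\<kappa> y \<bullet> X)) \<partial>\<mu>r))\<^sup>2) \<partial>lborel)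
     \<le> (\<integral>\<^sup>+Y. ennreal ((cmod (h Y))\<^sup>2) \<partial>lborel)"
    unfolding eq by (rule plancherel_inequality[OF h])
  also have "\<dots> = (\<integral>\<^sup>+Y. ennreal (dens Y) * ennreal (pf * \<Delta> (kinv Y) * (cmod (u (kinv Y)))\<^sup>2) \<partial>lborel)"
  proof (intro nn_integral_cong)
    fix Y
    have "(cmod (h Y))\<^sup>2 = dens Y * (pf * \<Delta> (kinv Y) * (cmod (u (kinv Y)))\<^sup>2)"
      by (auto simp: h_def power_mult_distrib power2_eq_square dens_def indicator_def)
    then show "ennreal ((cmod (h Y))\<^sup>2) = ennreal (dens Y) * ennreal (pf * \<Delta> (kinv Y) * (cmod (u (kinv Y)))\<^sup>2)"
      by (simp add: ennreal_mult' dens_nonneg)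
  qed
  also have "\<dots> = (\<integral>\<^sup>+Y. ennreal (pf * \<Delta> (kinv Y) * (cmod (u (kinv Y)))\<^sup>2) \<partial>distr \<mu>r borel \<kappa>)"
    unfolding distr_kappa' by (subst nn_integral_density) auto
  also have "\<dots> = (\<integral>\<^sup>+y. ennreal (pf * \<Delta> (kinv (\<kappa> y)) * (cmod (u (kinv (\<kappa> y))))\<^sup>2) \<partial>\<mu>r)"
    by (subst nn_integral_distr) auto
  also have "\<dots> = (\<integral>\<^sup>+y. ennreal (pf * \<Delta> y * (cmod (u y))\<^sup>2) \<partial>\<mu>r)"
    by (intro nn_integral_cong) (simp add: kinv_kappa)
  finally show ?thesis .
qed

section \<open>The transform on absolutely convergent integrals\<close>

definition admissible :: "('g \<Rightarrow> complex) \<Rightarrow> bool" where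
  "admissible f \<longleftrightarrow> f \<in> L2 \<mu>r \<and> integrable \<mu>r (\<lambda>y. f y / complex_of_real (weight y))"

lemma KI_eq:
  "KI f x = complex_of_real (1 / sqrt (\<Theta> (lg x))) * (\<integral>y. f y / complex_of_real (weight y) * cis (- 2 * pi * (\<kappa> y \<bullet> lg x)) \<partial>\<mu>r)"
  unfolding kirillov_integral_def by simp

lemma KI_integrable:
  assumes "admissible f"
  shows "integrable \<mu>r (\<lambda>y. f y / complex_of_real (weight y) * cis (- 2 * pi * (\<kappa> y \<bullet> X)))"
proof -
  have i: "integrable \<mu>r (\<lambda>y. f y / complex_of_real (weight y))" using assms by (simp add: admissible_def)
  have m [measurable]: "(\<lambda>y. f y / complex_of_real (weight y)) \<in> borel_measurable \<B>"
    using borel_measurable_integrable[OF i] by simp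
  have c: "(\<lambda>y. cis (- 2 * pi * (\<kappa> y \<bullet> X))) \<in> borel_measurable \<B>" by measurable
  show ?thesis
  proof (rule Bochner_Integration.integrable_bound[OF i])
    show "(\<lambda>y. f y / complex_of_real (weight y) * cis (- 2 * pi * (\<kappa> y \<bullet> X))) \<in> borel_measurable \<mu>r"
      using borel_measurable_times[OF m c] by (simp cong: measurable_cong_sets)
  qed (rule AE_I2, simp add: norm_mult norm_divide)
qed

text \<open>The factor \<Theta>^(-1/2) cancels the Jacobian of the exponential coordinates, and
  dividing f by \<open>weight\<close> cancels the factor left over in
  \<open>fourier_orbit_bound\<close>.\<close>

lemma KI_L2:
  assumes f: "admissible f"
  shows "KI f \<in> L2 \<mu>r" "L2_norm \<mu>r (KI f) \<le> L2_norm \<mu>r f"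
proof -
  define u where "u y = f y / complex_of_real (weight y)" for y
  have fL: "f \<in> L2 \<mu>r" and u: "integrable \<mu>r u" using f by (auto simp: admissible_def u_def[abs_def])
  have [measurable]: "u \<in> borel_measurable \<B>" using borel_measurable_integrable[OF u] by simp
  define T where "T X = (\<integral>y. u y * cis (- 2 * pi * (\<kappa> y \<bullet> X)) \<partial>\<mu>r)" for X
  have [measurable]: "T \<in> borel_measurable borel"
    unfolding T_def[abs_def]
    by (rule r.borel_measurable_lebesgue_integral) measurable
  have KI: "KI f = (\<lambda>x. complex_of_real (1 / sqrt (\<Theta> (lg x))) * T (lg x))"
    unfolding KI_eq T_def u_def ..
  have m: "KI f \<in> borel_measurable \<mu>r" unfolding KI by measurable
  have "(\<integral>\<^sup>+x. ennreal ((cmod (KI f x))\<^sup>2) \<partial>\<mu>r) = (\<integral>\<^sup>+X. ennreal (\<Theta> X) * ennreal ((cmod (KI f (ex X)))\<^sup>2) \<partial>lborel)"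
    by (rule nn_integral_\<mu>r) (use m in measurable)
  also have "\<dots> \<le> (\<integral>\<^sup>+X. ennreal ((cmod (T X))\<^sup>2) \<partial>lborel)"
  proof (intro nn_integral_mono)
    fix X
    \<comment> \<open>Where \<Theta> vanishes the left side is 0, so in general this is only an
      inequality; a contraction needs no more.\<close>
    have "\<Theta> X * (cmod (KI f (ex X)))\<^sup>2 \<le> (cmod (T X))\<^sup>2"
    proof (cases "\<Theta> X = 0")
      case False
      then have "\<Theta> X > 0" using Theta_nonneg[of X] by simp
      then show ?thesis by (simp add: KI norm_mult norm_divide power_mult_distrib power_divide)
    qed simp
    then show "ennreal (\<Theta> X) * ennreal ((cmod (KI f (ex X)))\<^sup>2) \<le> ennreal ((cmod (T X))\<^sup>2)"
      by (simp add: ennreal_mult'[symmetric] Theta_nonneg ennreal_leI)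
  qed
  also have "\<dots> \<le> (\<integral>\<^sup>+y. ennreal (pf * \<Delta> y * (cmod (u y))\<^sup>2) \<partial>\<mu>r)"
    unfolding T_def by (rule fourier_orbit_bound[OF u])
  also have "\<dots> = (\<integral>\<^sup>+y. ennreal ((cmod (f y))\<^sup>2) \<partial>\<mu>r)"
  proof (intro nn_integral_cong)
    fix y assume "y \<in> space \<mu>r"
    then have pos: "0 < pf * \<Delta> y" using pf_pos by simp
    have "(cmod (u y))\<^sup>2 = (cmod (f y))\<^sup>2 / (pf * \<Delta> y)"
      using pos unfolding u_def norm_divide power_divide by (simp add: less_imp_le)
    then have "pf * \<Delta> y * (cmod (u y))\<^sup>2 = (cmod (f y))\<^sup>2"
      using pos nonzero_eq_divide_eq[of "pf * \<Delta> y"] by (metis less_irrefl mult.commute)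
    then show "ennreal (pf * \<Delta> y * (cmod (u y))\<^sup>2) = ennreal ((cmod (f y))\<^sup>2)" by simp
  qed
  also have "\<dots> = ennreal ((L2_norm \<mu>r f)\<^sup>2)" by (rule nn_integral_L2_norm[OF fL])
  finally have le: "(\<integral>\<^sup>+x. ennreal ((cmod (KI f x))\<^sup>2) \<partial>\<mu>r) \<le> ennreal ((L2_norm \<mu>r f)\<^sup>2)" .
  show "KI f \<in> L2 \<mu>r" by (rule L2_norm_nn_integral(1)[OF m le]) simp
  have "(L2_norm \<mu>r (KI f))\<^sup>2 \<le> (L2_norm \<mu>r f)\<^sup>2" by (rule L2_norm_nn_integral(2)[OF m le]) simp
  then show "L2_norm \<mu>r (KI f) \<le> L2_norm \<mu>r f" by (rule power2_le_imp_le) simp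
qed

lemma admissible_diff:
  assumes "admissible f" "admissible g"
  shows "admissible (\<lambda>x. f x - g x)"
  using assms L2_diff unfolding admissible_def by (auto simp: diff_divide_distrib)

lemma KI_diff:
  assumes "admissible f" "admissible g"
  shows "KI (\<lambda>x. f x - g x) = (\<lambda>x. KI f x - KI g x)"
  by (rule ext) (simp only: KI_eq diff_divide_distrib left_diff_distrib
      Bochner_Integration.integral_diff[OF KI_integrable[OF assms(1)] KI_integrable[OF assms(2)]] right_diff_distrib)

lemma admissible_cnj:
  assumes "admissible f"
  shows "admissible (\<lambda>x. cnj (f x))"
proof -
  have "integrable \<mu>r (\<lambda>y. cnj (f y / complex_of_real (weight y)))"
    using assms by (simp add: admissible_def integrable_cnj del: complex_cnj_divide)
  then show ?thesis using assms L2_cnj[of f \<mu>r] unfolding admissible_def by simp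
qed

text \<open>Conjugation reverses the sign of log x in the character, which amounts to replacing x by
  x^-1 while \<kappa> stays untouched. The prefactor changes from \<Theta>(log x) to \<Theta>(-log
  x), and the square root of \<Delta> in \<open>sharp\<close> makes up for exactly that.\<close>

lemma KI_cnj: "AE x in \<mu>r. KI (\<lambda>y. cnj (f y)) x = sharp (KI f) x"
  using AE_lborel_imp_AE_\<mu>r[OF Theta_uminus] AE_space
proof eventually_elim
  fix x assume Th: "\<Theta> (- lg x) = \<Delta> (ex (lg x)) * \<Theta> (lg x)" and "x \<in> space \<mu>r"
  then have x: "x \<in> carrier G" by simp
  have "sharp (KI f) x = complex_of_real (sqrt (\<Delta> x) / sqrt (\<Theta> (- lg x))) *
     cnj (\<integral>y. f y / complex_of_real (weight y) * cis (- 2 * pi * (\<kappa> y \<bullet> - lg x)) \<partial>\<mu>r)"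
    using x by (simp add: sharp_def KI_eq lg_inv)
  also have "sqrt (\<Delta> x) / sqrt (\<Theta> (- lg x)) = 1 / sqrt (\<Theta> (lg x))"
    using Th x less_imp_neq[OF \<Delta>_pos[OF x]] by (simp add: real_sqrt_mult)
  also have "cnj (\<integral>y. f y / complex_of_real (weight y) * cis (- 2 * pi * (\<kappa> y \<bullet> - lg x)) \<partial>\<mu>r)
     = (\<integral>y. cnj (f y / complex_of_real (weight y) * cis (- 2 * pi * (\<kappa> y \<bullet> - lg x))) \<partial>\<mu>r)"
    by (rule Bochner_Integration.integral_cnj[symmetric])
  also have "\<dots> = (\<integral>y. cnj (f y) / complex_of_real (weight y) * cis (- 2 * pi * (\<kappa> y \<bullet> lg x)) \<partial>\<mu>r)"
    by (intro Bochner_Integration.integral_cong refl) (simp add: cis_cnj)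
  finally show "KI (\<lambda>y. cnj (f y)) x = sharp (KI f) x" by (simp only: KI_eq[of "\<lambda>y. cnj (f y)"])
qed

text \<open>Truncate f to sets of finite measure on which \<Delta> is bounded below. There both 1
  and 1 / \<open>weight\<close> are square integrable, so f is integrable with or without the
  weight. The first property serves the Wigner transform, the second the Kirillov transform.\<close>

lemma L2_dense_admissible:
  assumes f: "f \<in> L2 \<mu>r"
  obtains fs where "\<And>n. admissible (fs n)" "\<And>n. integrable \<mu>r (fs n)" "L2_limit \<mu>r fs f"
proof -
  define S where "S n = {x \<in> carrier G. 1 / Suc n \<le> \<Delta> x} \<inter> ex ` ball 0 (real n)" for n
  have fs': "{x \<in> space \<B>. 1 / Suc n \<le> \<Delta> x} \<in> sets \<B>" for n by measurable
  have S [measurable]: "S n \<in> sets \<B>" for n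
    unfolding S_def using fs'[of n] ex_image_sets[of "ball 0 (real n)"] by (simp add: space_borel_of)
  have fin: "emeasure \<mu>r (S n) < \<infinity>" for n
  proof -
    have "emeasure \<mu>r (S n) \<le> emeasure \<mu>r (ex ` ball 0 (real n))"
      by (intro emeasure_mono) (auto simp: S_def ex_image_sets)
    also have "\<dots> < \<infinity>" by (rule haar_regular_ball(2)[OF regular])
    finally show ?thesis .
  qed
  have ev: "eventually (\<lambda>n. x \<in> S n) sequentially" if "x \<in> space \<mu>r" for x
  proof -
    have x: "x \<in> carrier G" using that by simp
    obtain N1 :: nat where N1: "norm (lg x) < real N1" using reals_Archimedean2 by blast
    obtain N2 :: nat where N2: "1 / \<Delta> x < real N2" using reals_Archimedean2 by blast
    show ?thesis unfolding eventually_sequentially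
    proof (intro exI[of _ "max N1 N2"] allI impI)
      fix n assume n: "max N1 N2 \<le> n"
      have "1 / \<Delta> x < real (Suc n)" using N2 n by linarith
      then have "1 / Suc n \<le> \<Delta> x" using \<Delta>_pos[OF x] by (simp add: field_simps)
      moreover have "lg x \<in> ball 0 (real n)" using N1 n by simp
      ultimately show "x \<in> S n" using x unfolding S_def ex_image by blast
    qed
  qed
  define fs where "fs n x = indicator (S n) x * f x" for n x
  have lim: "L2_limit \<mu>r fs f" and fsL: "fs n \<in> L2 \<mu>r" for n
    using L2_truncate[OF f, of S] S ev unfolding fs_def[abs_def] by auto
  have ind: "integrable \<mu>r (indicator (S n) :: 'g \<Rightarrow> real)" for n
    using fin[of n] by (intro integrable_real_indicator) auto
  have w1: "(\<lambda>x. indicator (S n) x) \<in> L2 \<mu>r" for n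
  proof -
    have "(\<lambda>x. (cmod (indicator (S n) x))\<^sup>2) = (indicator (S n) :: 'g \<Rightarrow> real)"
      by (auto simp: indicator_def fun_eq_iff)
    then show ?thesis unfolding L2_def using ind[of n] by auto
  qed
  have w2: "(\<lambda>x. indicator (S n) x / complex_of_real (weight x)) \<in> L2 \<mu>r" for n
    unfolding L2_def
  proof (intro CollectI conjI)
    show "integrable \<mu>r (\<lambda>x. (cmod (indicator (S n) x / complex_of_real (weight x)))\<^sup>2)"
    proof (rule Bochner_Integration.integrable_bound)
      show "integrable \<mu>r (\<lambda>x. (Suc n / pf) * indicator (S n) x)" using ind[of n] by simp
      show "AE x in \<mu>r. norm ((cmod (indicator (S n) x / complex_of_real (weight x)))\<^sup>2)
          \<le> norm (Suc n / pf * indicator (S n) x)"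
      proof (rule AE_I2)
        fix x assume "x \<in> space \<mu>r"
        then have x: "0 < \<Delta> x" by simp
        show "norm ((cmod (indicator (S n) x / complex_of_real (weight x)))\<^sup>2) \<le> norm (Suc n / pf * indicator (S n) x)"
        proof (cases "x \<in> S n")
          case True
          then have "1 / Suc n \<le> \<Delta> x" by (simp add: S_def)
          then have "pf * (1 / Suc n) \<le> pf * \<Delta> x" using pf_pos by (intro mult_left_mono) auto
          then have "1 / (pf * \<Delta> x) \<le> 1 / (pf * (1 / Suc n))" using pf_pos x by (intro divide_left_mono) auto
          then show ?thesis using True x pf_pos by (simp add: norm_divide power_divide)
        qed simp
      qed
    qed measurable
  qed measurable
  have "integrable \<mu>r (fs n)" for n
    using L2_mult_integrable[OF w1[of n] f] unfolding fs_def[abs_def] .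
  moreover have "admissible (fs n)" for n
    using L2_mult_integrable[OF w2[of n] f] fsL[of n] unfolding admissible_def fs_def[abs_def] by simp
  ultimately show ?thesis using that lim by blast
qed

section \<open>Extension to all of L2\<close>

definition kirillov_limit :: "('g \<Rightarrow> complex) \<Rightarrow> ('g \<Rightarrow> complex) \<Rightarrow> bool" where
  "kirillov_limit f g \<longleftrightarrow> g \<in> L2 \<mu>r \<and>
     (\<exists>fs. (\<forall>n. admissible (fs n)) \<and> L2_limit \<mu>r fs f \<and> L2_limit \<mu>r (\<lambda>n. KI (fs n)) g)"

text \<open>The requirement that the approximating transforms be square integrable is automatic by
  \<open>KI_L2\<close>.\<close>

lemma inv_fourier_kirillov_eq: "inv_fourier_kirillov G ex \<mu>r \<Delta> F f = (SOME g. kirillov_limit f g)"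
proof -
  have "(\<forall>n. fs n \<in> L2 \<mu>r \<and> integrable \<mu>r (\<lambda>y. fs n y / complex_of_real (weight y)) \<and> KI (fs n) \<in> L2 \<mu>r)
    \<longleftrightarrow> (\<forall>n. admissible (fs n))" for fs :: "nat \<Rightarrow> 'g \<Rightarrow> complex"
    using KI_L2(1) unfolding admissible_def by blast
  then show ?thesis unfolding inv_fourier_kirillov_def kirillov_limit_def by simp
qed

text \<open>The contraction, applied to differences of approximants, makes their transforms a Cauchy
  sequence.\<close>

lemma kirillov_limit_exists:
  assumes f: "f \<in> L2 \<mu>r"
  shows "\<exists>g. kirillov_limit f g"
proof -
  obtain fs where fs: "\<And>n. admissible (fs n)" "L2_limit \<mu>r fs f" using L2_dense_admissible[OF f] by metis
  have fsL: "fs n \<in> L2 \<mu>r" for n using fs(1) by (simp add: admissible_def)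
  have le: "L2_norm \<mu>r (\<lambda>x. KI (fs m) x - KI (fs n) x) \<le> L2_norm \<mu>r (\<lambda>x. fs m x - f x) + L2_norm \<mu>r (\<lambda>x. fs n x - f x)" for m n
  proof -
    have "L2_norm \<mu>r (\<lambda>x. KI (fs m) x - KI (fs n) x) \<le> L2_norm \<mu>r (\<lambda>x. fs m x - fs n x)"
      using KI_L2(2)[OF admissible_diff[OF fs(1) fs(1)]] unfolding KI_diff[OF fs(1) fs(1)] .
    also have "\<dots> \<le> L2_norm \<mu>r (\<lambda>x. fs m x - f x) + L2_norm \<mu>r (\<lambda>x. f x - fs n x)"
      by (rule L2_norm_triangle_diff[OF fsL f fsL])
    finally show ?thesis using L2_norm_minus_commute[of \<mu>r f "fs n"] by simp
  qed
  obtain g where "g \<in> L2 \<mu>r" "L2_limit \<mu>r (\<lambda>n. KI (fs n)) g"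
  proof (rule L2_complete)
    show "KI (fs n) \<in> L2 \<mu>r" for n by (rule KI_L2(1)[OF fs(1)])
    fix e :: real assume "e > 0"
    then have "eventually (\<lambda>n. L2_norm \<mu>r (\<lambda>x. fs n x - f x) < e / 2) sequentially"
      using fs(2) unfolding L2_limit_iff by (intro order_tendstoD(2)) auto
    then obtain N where N: "\<And>n. n \<ge> N \<Longrightarrow> L2_norm \<mu>r (\<lambda>x. fs n x - f x) < e / 2"
      unfolding eventually_sequentially by blast
    show "\<exists>N. \<forall>m\<ge>N. \<forall>n\<ge>N. L2_norm \<mu>r (\<lambda>x. KI (fs m) x - KI (fs n) x) < e"
    proof (intro exI allI impI)
      fix m n assume "m \<ge> N" "n \<ge> N"
      from N[OF this(1)] N[OF this(2)] le[of m n] show "L2_norm \<mu>r (\<lambda>x. KI (fs m) x - KI (fs n) x) < e" by linarith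
    qed
  qed
  then show ?thesis using fs unfolding kirillov_limit_def by blast
qed

text \<open>Two approximations of the same f become close to each other, and by the contraction so
  do their transforms.\<close>

lemma kirillov_limit_unique:
  assumes "kirillov_limit f g" "kirillov_limit f g'" and f: "f \<in> L2 \<mu>r"
  shows "AE x in \<mu>r. g x = g' x"
proof -
  from assms(1) obtain fs where fs: "\<And>n. admissible (fs n)" "L2_limit \<mu>r fs f" "L2_limit \<mu>r (\<lambda>n. KI (fs n)) g"
    and g: "g \<in> L2 \<mu>r" unfolding kirillov_limit_def by blast
  from assms(2) obtain hs where hs: "\<And>n. admissible (hs n)" "L2_limit \<mu>r hs f" "L2_limit \<mu>r (\<lambda>n. KI (hs n)) g'"
    and g': "g' \<in> L2 \<mu>r" unfolding kirillov_limit_def by blast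
  have L: "fs n \<in> L2 \<mu>r" "hs n \<in> L2 \<mu>r" for n using fs(1) hs(1) by (auto simp: admissible_def)
  have le: "L2_norm \<mu>r (\<lambda>x. KI (fs n) x - KI (hs n) x) \<le> L2_norm \<mu>r (\<lambda>x. fs n x - f x) + L2_norm \<mu>r (\<lambda>x. hs n x - f x)" for n
  proof -
    have "L2_norm \<mu>r (\<lambda>x. KI (fs n) x - KI (hs n) x) \<le> L2_norm \<mu>r (\<lambda>x. fs n x - hs n x)"
      using KI_L2(2)[OF admissible_diff[OF fs(1) hs(1)]] unfolding KI_diff[OF fs(1) hs(1)] .
    also have "\<dots> \<le> L2_norm \<mu>r (\<lambda>x. fs n x - f x) + L2_norm \<mu>r (\<lambda>x. f x - hs n x)"
      by (rule L2_norm_triangle_diff[OF L(1) f L(2)])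
    finally show ?thesis using L2_norm_minus_commute[of \<mu>r f "hs n"] by simp
  qed
  have "(\<lambda>n. L2_norm \<mu>r (\<lambda>x. fs n x - f x) + L2_norm \<mu>r (\<lambda>x. hs n x - f x)) \<longlonglongrightarrow> 0"
    using tendsto_add[OF fs(2)[unfolded L2_limit_iff] hs(2)[unfolded L2_limit_iff]] by simp
  from tendsto_sandwich[OF _ _ tendsto_const this] have "(\<lambda>n. L2_norm \<mu>r (\<lambda>x. KI (fs n) x - KI (hs n) x)) \<longlonglongrightarrow> 0"
    by (simp add: le)
  then show ?thesis
    by (rule L2_limit_unique_AE[OF KI_L2(1)[OF fs(1)] KI_L2(1)[OF hs(1)] g g' fs(3) hs(3)])
qed

text \<open>Conjugating the approximants turns their transforms into \<open>sharp\<close> of the old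
  ones by \<open>KI_cnj\<close>; since \<open>sharp\<close> preserves the norm of differences, the
  limit follows.\<close>

lemma kirillov_limit_cnj:
  assumes "kirillov_limit f g"
  shows "kirillov_limit (\<lambda>x. cnj (f x)) (sharp g)"
proof -
  from assms obtain fs where fs: "\<And>n. admissible (fs n)" "L2_limit \<mu>r fs f" "L2_limit \<mu>r (\<lambda>n. KI (fs n)) g"
    and g: "g \<in> L2 \<mu>r" unfolding kirillov_limit_def by blast
  have adm: "admissible (\<lambda>x. cnj (fs n x))" for n by (rule admissible_cnj[OF fs(1)])
  have "L2_limit \<mu>r (\<lambda>n x. cnj (fs n x)) (\<lambda>x. cnj (f x))"
    using fs(2) unfolding L2_limit_def by (simp flip: complex_cnj_diff)
  moreover have "L2_limit \<mu>r (\<lambda>n. KI (\<lambda>x. cnj (fs n x))) (sharp g)"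
  proof -
    have "L2_norm \<mu>r (\<lambda>x. KI (\<lambda>x. cnj (fs n x)) x - sharp g x) = L2_norm \<mu>r (\<lambda>x. sharp (KI (fs n)) x - sharp g x)" for n
    proof (rule L2_norm_cong_AE)
      show "(\<lambda>x. KI (\<lambda>x. cnj (fs n x)) x - sharp g x) \<in> borel_measurable \<mu>r"
        by (rule L2_measurable[OF L2_diff[OF KI_L2(1)[OF adm] sharp_L2(1)[OF g]]])
      show "(\<lambda>x. sharp (KI (fs n)) x - sharp g x) \<in> borel_measurable \<mu>r"
        by (rule L2_measurable[OF L2_diff[OF sharp_L2(1)[OF KI_L2(1)[OF fs(1)]] sharp_L2(1)[OF g]]])
      show "AE x in \<mu>r. KI (\<lambda>x. cnj (fs n x)) x - sharp g x = sharp (KI (fs n)) x - sharp g x"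
        using KI_cnj[of "fs n"] by eventually_elim simp
    qed
    then show ?thesis
      using sharp_limit[OF KI_L2(1)[OF fs(1)] g fs(3)] unfolding L2_limit_iff by simp
  qed
  ultimately show ?thesis
    unfolding kirillov_limit_def using adm sharp_L2(1)[OF g] by (intro conjI exI[of _ "\<lambda>n x. cnj (fs n x)"]) auto
qed

text \<open>The representatives that \<open>SOME\<close> picks for f and for its conjugate are
  unrelated, so equality can hold only almost everywhere.\<close>

lemma inv_fourier_kirillov_cnj:
  assumes f: "f \<in> L2 \<mu>r"
  shows "inv_fourier_kirillov G ex \<mu>r \<Delta> F f \<in> L2 \<mu>r"
    and "inv_fourier_kirillov G ex \<mu>r \<Delta> F (\<lambda>x. cnj (f x)) \<in> L2 \<mu>r"
    and "AE x in \<mu>r. inv_fourier_kirillov G ex \<mu>r \<Delta> F (\<lambda>x. cnj (f x)) x = sharp (inv_fourier_kirillov G ex \<mu>r \<Delta> F f) x"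
proof -
  have 1: "kirillov_limit f (inv_fourier_kirillov G ex \<mu>r \<Delta> F f)"
    unfolding inv_fourier_kirillov_eq by (rule someI_ex[OF kirillov_limit_exists[OF f]])
  have 2: "kirillov_limit (\<lambda>x. cnj (f x)) (inv_fourier_kirillov G ex \<mu>r \<Delta> F (\<lambda>x. cnj (f x)))"
    unfolding inv_fourier_kirillov_eq by (rule someI_ex[OF kirillov_limit_exists[OF L2_cnj[OF f]]])
  show "inv_fourier_kirillov G ex \<mu>r \<Delta> F f \<in> L2 \<mu>r"
    "inv_fourier_kirillov G ex \<mu>r \<Delta> F (\<lambda>x. cnj (f x)) \<in> L2 \<mu>r"
    using 1 2 by (auto simp: kirillov_limit_def)
  show "AE x in \<mu>r. inv_fourier_kirillov G ex \<mu>r \<Delta> F (\<lambda>x. cnj (f x)) x = sharp (inv_fourier_kirillov G ex \<mu>r \<Delta> F f) x"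
    by (rule kirillov_limit_unique[OF 2 kirillov_limit_cnj[OF 1] L2_cnj[OF f]])
qed

end

section \<open>The Duflo-Moore operator\<close>

locale exp_duflo = exp_kirillov G \<A> ex \<mu>r \<Delta> F
  for G :: "'g monoid" (structure) and \<A> :: "('g, real^'n::{finite,wellorder}) atlas" and ex :: "real^'n::_ \<Rightarrow> 'g"
    and \<mu>r :: "'g measure" and \<Delta> :: "'g \<Rightarrow> real" and F :: "real^'n::_" +
  fixes \<pi> :: "'g \<Rightarrow> 'h::chilbert_space \<Rightarrow> 'h" and Dinv :: "('h \<times> 'h) set"
  assumes unitary: "unitary_rep G (atlas_topology \<A>) \<pi>"
    and duflo_moore: "duflo_moore_inverse \<mu>r \<pi> Dinv"
begin

lemma \<pi>_bounded_clinear: "x \<in> carrier G \<Longrightarrow> bounded_clinear (\<pi> x)"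
  and \<pi>_norm [simp]: "x \<in> carrier G \<Longrightarrow> norm (\<pi> x v) = norm v"
  and \<pi>_one [simp]: "\<pi> \<one> v = v"
  and \<pi>_mult: "x \<in> carrier G \<Longrightarrow> y \<in> carrier G \<Longrightarrow> \<pi> (x \<otimes> y) v = \<pi> x (\<pi> y v)"
  using unitary by (auto simp: unitary_rep_def)

lemma \<pi>_linear: "x \<in> carrier G \<Longrightarrow> linear (\<pi> x)"
  by (rule bounded_linear.linear[OF bounded_clinear_bounded_linear[OF \<pi>_bounded_clinear]])

lemma \<pi>_scaleC: "x \<in> carrier G \<Longrightarrow> \<pi> x (scaleC c v) = scaleC c (\<pi> x v)"
  by (rule bounded_clinear_scaleC[OF \<pi>_bounded_clinear])

lemma \<pi>_inv [simp]:
  assumes "x \<in> carrier G"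
  shows "\<pi> x (\<pi> (inv x) v) = v" "\<pi> (inv x) (\<pi> x v) = v"
  using assms by (simp_all flip: \<pi>_mult)

lemma \<pi>_cinner: "x \<in> carrier G \<Longrightarrow> cinner (\<pi> x u) (\<pi> x v) = cinner u v"
  by (rule isometry_cinner[OF \<pi>_bounded_clinear]) auto

lemma \<pi>_cinner_left: "x \<in> carrier G \<Longrightarrow> cinner (\<pi> x u) v = cinner u (\<pi> (inv x) v)"
  using \<pi>_cinner[of x u "\<pi> (inv x) v"] by simp

text \<open>\<open>cadjoint\<close> is a definite description; unitarity shows that \<pi>(x^-1)
  satisfies it and so gives it a value.\<close>

lemma wavelet_eq: "x \<in> carrier G \<Longrightarrow> wavelet \<pi> \<phi> \<psi> x = cinner \<psi> (\<pi> (inv x) \<phi>)"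
  unfolding wavelet_def by (subst cadjoint_eqI[OF \<pi>_cinner_left]) auto

lemma continuous_matrix_coefficient: "continuous_map \<T> euclidean (\<lambda>x. cinner \<psi> (\<pi> x \<phi>))"
proof -
  have "continuous_map \<T> euclidean (\<lambda>x. \<pi> x \<phi>)" using unitary by (simp add: unitary_rep_def)
  moreover have "continuous_map euclidean euclidean (\<lambda>v. cinner \<psi> v)"
    unfolding continuous_map_iff_continuous2 by (intro continuous_on_cinner continuous_intros)
  ultimately show ?thesis by (rule continuous_map_compose[unfolded o_def])
qed

lemma matrix_coefficient_measurable [measurable]: "(\<lambda>x. cinner \<psi> (\<pi> x \<phi>)) \<in> borel_measurable \<B>"
proof (rule borel_measurableI)
  fix S :: "complex set" assume "open S"
  then have "openin \<T> {x \<in> topspace \<T>. cinner \<psi> (\<pi> x \<phi>) \<in> S}"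
    by (intro openin_continuous_map_preimage[OF continuous_matrix_coefficient]) simp
  from openin_sets[OF this] show "(\<lambda>x. cinner \<psi> (\<pi> x \<phi>)) -` S \<inter> space \<B> \<in> sets \<B>"
    by (simp add: vimage_def Int_def topspace_T space_borel_of conj_commute)
qed

lemma wavelet_measurable [measurable]: "wavelet \<pi> \<phi> \<psi> \<in> borel_measurable \<B>"
proof -
  have "(\<lambda>x. cinner \<psi> (\<pi> (inv x) \<phi>)) \<in> borel_measurable \<B>" by measurable
  then show ?thesis by (rule measurable_cong[THEN iffD1, rotated]) (simp add: space_borel_of wavelet_eq)
qed

section \<open>The graph of the inverse Duflo-Moore operator\<close>

lemma relations: "duflo_moore_relations \<mu>r \<pi> Dinv"
  and relations_unique: "duflo_moore_relations \<mu>r \<pi> T \<Longrightarrow> T = Dinv"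
  using duflo_moore unfolding duflo_moore_inverse_def by blast+

lemma positive_Dinv: "positive_operator Dinv"
  and Domain_Dinv: "Domain Dinv = {\<phi>. \<forall>\<psi>. wavelet \<pi> \<phi> \<psi> \<in> L2 \<mu>r}"
  using relations by (simp_all add: duflo_moore_relations_def)

lemma orthogonality:
  assumes "(x, y) \<in> Dinv" "(x', y') \<in> Dinv"
  shows "(\<integral>z. wavelet \<pi> x \<psi> z * cnj (wavelet \<pi> x' \<psi>' z) \<partial>\<mu>r) = cinner \<psi> \<psi>' * cnj (cinner y y')"
proof -
  have "\<forall>(\<phi>1, \<eta>1)\<in>Dinv. \<forall>(\<phi>2, \<eta>2)\<in>Dinv. \<forall>\<psi>1 \<psi>2.
        (\<integral>x. wavelet \<pi> \<phi>1 \<psi>1 x * cnj (wavelet \<pi> \<phi>2 \<psi>2 x) \<partial>\<mu>r)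
          = cinner \<psi>1 \<psi>2 * cnj (cinner \<eta>1 \<eta>2)"
    using relations by (simp add: duflo_moore_relations_def)
  from bspec[OF this assms(1)] have "\<forall>(\<phi>2, \<eta>2)\<in>Dinv. \<forall>\<psi>1 \<psi>2.
        (\<integral>z. wavelet \<pi> x \<psi>1 z * cnj (wavelet \<pi> \<phi>2 \<psi>2 z) \<partial>\<mu>r)
          = cinner \<psi>1 \<psi>2 * cnj (cinner y \<eta>2)" by simp
  from bspec[OF this assms(2)] show ?thesis by simp
qed

lemma Dinv_0: "(0, 0) \<in> Dinv"
  and Dinv_single_valued: "single_valued Dinv"
  and Dinv_dense: "closure (Domain Dinv) = UNIV"
  and Dinv_self_adjoint: "graph_adjoint Dinv = Dinv"
  using positive_Dinv by (simp_all add: positive_operator_def)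

lemma Dinv_add: "(x, y) \<in> Dinv \<Longrightarrow> (x', y') \<in> Dinv \<Longrightarrow> (x + x', y + y') \<in> Dinv"
  using positive_Dinv unfolding positive_operator_def by fast

lemma Dinv_scaleC: "(x, y) \<in> Dinv \<Longrightarrow> (scaleC c x, scaleC c y) \<in> Dinv"
  using positive_Dinv unfolding positive_operator_def by fast

lemma Dinv_nonneg: "(x, y) \<in> Dinv \<Longrightarrow> 0 \<le> Re (cinner y x)"
  using positive_Dinv unfolding positive_operator_def by fast

lemma wavelet_L2: "(x, y) \<in> Dinv \<Longrightarrow> wavelet \<pi> x \<psi> \<in> L2 \<mu>r"
  using Domain_Dinv by blast

lemma Dinv_symmetric: "(a, b) \<in> Dinv \<Longrightarrow> (c, d) \<in> Dinv \<Longrightarrow> cinner b c = cinner a d"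
  using Dinv_self_adjoint unfolding graph_adjoint_def by blast

lemma Dinv_diff: "(x, y) \<in> Dinv \<Longrightarrow> (x', y') \<in> Dinv \<Longrightarrow> (x - x', y - y') \<in> Dinv"
  using Dinv_add[OF _ Dinv_scaleC[of x' y' "complex_of_real (- 1)"], of x y] by (simp only: scaleC_of_real) simp

text \<open>By the orthogonality relations the wavelet transform of \<phi> against itself vanishes
  almost everywhere. It is continuous and nonempty open sets have positive measure, so it vanishes
  everywhere; at the identity its value is the squared norm of \<phi>.\<close>

lemma Dinv_injective:
  assumes "(\<phi>, 0) \<in> Dinv"
  shows "\<phi> = 0"
proof -
  define W where "W = wavelet \<pi> \<phi> \<phi>"
  have W: "W \<in> L2 \<mu>r" unfolding W_def by (rule wavelet_L2[OF assms])
  have "complex_of_real ((L2_norm \<mu>r W)\<^sup>2) = (\<integral>x. complex_of_real ((cmod (W x))\<^sup>2) \<partial>\<mu>r)"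
    unfolding L2_norm_power2 by (rule integral_complex_of_real[symmetric])
  also have "\<dots> = (\<integral>x. W x * cnj (W x) \<partial>\<mu>r)" by (simp only: complex_norm_square)
  also have "\<dots> = 0" unfolding W_def by (simp add: orthogonality[OF assms assms])
  finally have "L2_norm \<mu>r W = 0" by simp
  from L2_norm_eq_0_AE[OF W this] have ae: "AE x in \<mu>r. W x = 0" .
  define U where "U = {x \<in> topspace \<T>. cinner \<phi> (\<pi> (inv x) \<phi>) \<in> - {0}}"
  have "continuous_map \<T> euclidean (\<lambda>x. cinner \<phi> (\<pi> (inv x) \<phi>))"
    using continuous_map_compose[OF inv_continuous continuous_matrix_coefficient] by (simp add: o_def)
  then have U: "openin \<T> U" unfolding U_def by (rule openin_continuous_map_preimage) (simp add: open_Compl)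
  have "emeasure \<mu>r U = 0"
  proof -
    have "U = {x \<in> space \<mu>r. W x \<noteq> 0}"
      unfolding U_def W_def by (auto simp: topspace_T wavelet_eq)
    moreover have "U \<in> sets \<mu>r" using openin_sets[OF U] by simp
    ultimately show ?thesis using ae by (subst (asm) AE_iff_measurable) auto
  qed
  then have "U = {}" using regular U unfolding haar_regular_def by (metis less_irrefl)
  then have "cinner \<phi> (\<pi> (inv \<one>) \<phi>) = 0" unfolding U_def topspace_T by blast
  then show ?thesis by (simp add: cinner_self)
qed

lemma Range_Dinv_csubspace: "csubspace (Range Dinv)"
  unfolding csubspace_def using Dinv_0 Dinv_add Dinv_scaleC by blast

text \<open>A vector u orthogonal to the range gives the pair (u, 0) in the adjoint graph, hence in
  \<open>Dinv\<close> by self-adjointness, and injectivity forces u = 0. So D itself is densely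
  defined.\<close>

lemma Range_Dinv_dense: "closure (Range Dinv) = UNIV"
proof (rule dense_if_orthogonal_trivial[OF Range_Dinv_csubspace])
  fix u assume u: "\<And>v. v \<in> Range Dinv \<Longrightarrow> cinner u v = 0"
  have "cinner y u = 0" if "(x, y) \<in> Dinv" for x y
    using u[of y] that cinner_commute[of y u] by force
  then have "(u, 0) \<in> graph_adjoint Dinv" unfolding graph_adjoint_def by auto
  then show "u = 0" using Dinv_self_adjoint Dinv_injective by simp
qed

section \<open>Translated vectors and semi-invariance\<close>

lemma wavelet_translate:
  "g \<in> carrier G \<Longrightarrow> x \<in> carrier G \<Longrightarrow> wavelet \<pi> (\<pi> g \<phi>) \<psi> x = wavelet \<pi> \<phi> \<psi> (inv g \<otimes> x)"
  by (simp add: wavelet_eq inv_mult_group \<pi>_mult)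

lemma Domain_Dinv_invariant:
  assumes \<phi>: "\<phi> \<in> Domain Dinv" and g: "g \<in> carrier G"
  shows "\<pi> g \<phi> \<in> Domain Dinv"
  unfolding Domain_Dinv
proof (intro CollectI allI)
  fix \<psi>
  have "wavelet \<pi> \<phi> \<psi> \<in> L2 \<mu>r" using \<phi> Domain_Dinv by blast
  from integral_left_translate(2)[OF _ g L2_integrable[OF this]]
  have "integrable \<mu>r (\<lambda>x. (cmod (wavelet \<pi> \<phi> \<psi> (inv g \<otimes> x)))\<^sup>2)" by simp
  then have "integrable \<mu>r (\<lambda>x. (cmod (wavelet \<pi> (\<pi> g \<phi>) \<psi> x))\<^sup>2)"
    by (rule Bochner_Integration.integrable_cong[THEN iffD2, OF refl, rotated]) (simp add: wavelet_translate[OF g])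
  then show "wavelet \<pi> (\<pi> g \<phi>) \<psi> \<in> L2 \<mu>r" by (simp add: L2_def)
qed

text \<open>The translate of the graph satisfies the orthogonality relations as well, so semi-invariance
  follows from the uniqueness of the Duflo-Moore operator.\<close>

lemma Dinv_semi_invariant:
  assumes \<phi>: "(\<phi>, \<eta>) \<in> Dinv" and g: "g \<in> carrier G"
  shows "(\<pi> g \<phi>, (1 / sqrt (\<Delta> g)) *\<^sub>R \<pi> g \<eta>) \<in> Dinv"
proof -
  \<comment> \<open>The square of this scaling is 1 / \<Delta>(g), the factor that
    \<open>integral_left_translate\<close> puts in front of the orthogonality relations when both
    vectors are moved by g.\<close>
  define r where "r = 1 / sqrt (\<Delta> g)"
  have r: "r > 0" "r * r = 1 / \<Delta> g" using \<Delta>_pos[OF g] by (auto simp: r_def)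
  define T where "T = {(\<pi> g u, r *\<^sub>R \<pi> g w) |u w. (u, w) \<in> Dinv}"
  have T_iff: "(x, y) \<in> T \<longleftrightarrow> (\<pi> (inv g) x, (1 / r) *\<^sub>R \<pi> (inv g) y) \<in> Dinv" for x y
  proof
    assume "(x, y) \<in> T"
    then show "(\<pi> (inv g) x, (1 / r) *\<^sub>R \<pi> (inv g) y) \<in> Dinv"
      using r g by (auto simp: T_def linear_scale[OF \<pi>_linear])
  next
    assume *: "(\<pi> (inv g) x, (1 / r) *\<^sub>R \<pi> (inv g) y) \<in> Dinv"
    have "x = \<pi> g (\<pi> (inv g) x)" "y = r *\<^sub>R \<pi> g ((1 / r) *\<^sub>R \<pi> (inv g) y)"
      using r g by (auto simp: linear_scale[OF \<pi>_linear])
    with * show "(x, y) \<in> T" unfolding T_def by blast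
  qed
  \<comment> \<open>The relations prescribe the domain as the set of all admissible vectors, so the
    translated graph must have the same one.\<close>
  have Dom: "Domain T = Domain Dinv"
  proof (intro Set.set_eqI iffI)
    fix x assume "x \<in> Domain T"
    then show "x \<in> Domain Dinv" using Domain_Dinv_invariant[OF _ g] unfolding T_def by blast
  next
    fix x assume "x \<in> Domain Dinv"
    then have "\<pi> (inv g) x \<in> Domain Dinv" using Domain_Dinv_invariant g by blast
    then obtain w where "(\<pi> (inv g) x, w) \<in> Dinv" by blast
    then have "(\<pi> g (\<pi> (inv g) x), r *\<^sub>R \<pi> g w) \<in> T" unfolding T_def by blast
    then show "x \<in> Domain T" using g by auto
  qed
  have "positive_operator T"
    unfolding positive_operator_def
  proof (intro conjI)
    have "(\<pi> g 0, r *\<^sub>R \<pi> g 0) \<in> T" unfolding T_def using Dinv_0 by blast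
    then show "(0, 0) \<in> T" by (simp add: linear_0[OF \<pi>_linear[OF g]])
    have "(x + x', y + y') \<in> T" if "(x, y) \<in> T" "(x', y') \<in> T" for x y x' y'
      using that Dinv_add unfolding T_iff
      by (simp add: linear_add[OF \<pi>_linear] g scaleR_add_right)
    then show "\<forall>(x, y)\<in>T. \<forall>(x', y')\<in>T. (x + x', y + y') \<in> T" by blast
    have "(scaleC c x, scaleC c y) \<in> T" if "(x, y) \<in> T" for c x y
    proof -
      have "(1 / r) *\<^sub>R scaleC c (\<pi> (inv g) y) = scaleC c ((1 / r) *\<^sub>R \<pi> (inv g) y)"
        unfolding scaleC_of_real[symmetric] scaleC_scaleC by (simp add: mult.commute)
      then show ?thesis using that Dinv_scaleC unfolding T_iff by (simp add: \<pi>_scaleC g)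
    qed
    then show "\<forall>c. \<forall>(x, y)\<in>T. (scaleC c x, scaleC c y) \<in> T" by blast
    show "single_valued T"
    proof (rule single_valuedI)
      fix x y z assume "(x, y) \<in> T" "(x, z) \<in> T"
      then have "(1 / r) *\<^sub>R \<pi> (inv g) y = (1 / r) *\<^sub>R \<pi> (inv g) z"
        unfolding T_iff using Dinv_single_valued by (blast dest: single_valuedD)
      then have "\<pi> g (\<pi> (inv g) y) = \<pi> g (\<pi> (inv g) z)" using r by simp
      then show "y = z" using g by simp
    qed
    show "closure (Domain T) = UNIV" unfolding Dom by (rule Dinv_dense)
    show "graph_adjoint T = T"
    proof -
      \<comment> \<open>Forming the adjoint commutes with conjugation by the unitary \<pi>(g) and
        with the real factor \<open>r\<close>.\<close>
      have "(u, w) \<in> graph_adjoint T \<longleftrightarrow> (u, w) \<in> T" for u w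
      proof -
        have "(u, w) \<in> graph_adjoint T \<longleftrightarrow> (\<forall>(x, y)\<in>Dinv. cinner (r *\<^sub>R \<pi> g y) u = cinner (\<pi> g x) w)"
          unfolding graph_adjoint_def T_def by blast
        also have "\<dots> \<longleftrightarrow> (\<forall>(x, y)\<in>Dinv. cinner y (\<pi> (inv g) u) = cinner x ((1 / r) *\<^sub>R \<pi> (inv g) w))"
          using r g by (simp add: cinner_scaleR_left cinner_scaleR_right \<pi>_cinner_left field_simps)
        also have "\<dots> \<longleftrightarrow> (\<pi> (inv g) u, (1 / r) *\<^sub>R \<pi> (inv g) w) \<in> graph_adjoint Dinv"
          unfolding graph_adjoint_def by blast
        finally show ?thesis unfolding Dinv_self_adjoint T_iff .
      qed
      then show ?thesis by (auto simp: subset_antisym)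
    qed
    show "\<forall>(x, y)\<in>T. 0 \<le> Re (cinner y x)"
      using Dinv_nonneg r g unfolding T_def by (auto simp: cinner_scaleR_left \<pi>_cinner)
  qed
  moreover have "(\<integral>x. wavelet \<pi> \<phi>1 \<psi>1 x * cnj (wavelet \<pi> \<phi>2 \<psi>2 x) \<partial>\<mu>r) = cinner \<psi>1 \<psi>2 * cnj (cinner \<eta>1 \<eta>2)"
    if "(\<phi>1, \<eta>1) \<in> T" "(\<phi>2, \<eta>2) \<in> T" for \<phi>1 \<eta>1 \<phi>2 \<eta>2 \<psi>1 \<psi>2
  proof -
    from that obtain u1 w1 u2 w2 where uw: "(u1, w1) \<in> Dinv" "(u2, w2) \<in> Dinv"
      "\<phi>1 = \<pi> g u1" "\<eta>1 = r *\<^sub>R \<pi> g w1" "\<phi>2 = \<pi> g u2" "\<eta>2 = r *\<^sub>R \<pi> g w2" unfolding T_def by blast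
    define h where "h x = wavelet \<pi> u1 \<psi>1 x * cnj (wavelet \<pi> u2 \<psi>2 x)" for x
    have h: "h \<in> borel_measurable \<B>" unfolding h_def[abs_def] by measurable
    have "(\<integral>x. wavelet \<pi> \<phi>1 \<psi>1 x * cnj (wavelet \<pi> \<phi>2 \<psi>2 x) \<partial>\<mu>r) = (\<integral>x. h (inv g \<otimes> x) \<partial>\<mu>r)"
      by (rule Bochner_Integration.integral_cong[OF refl]) (simp add: h_def uw wavelet_translate[OF g])
    also have "\<dots> = (1 / \<Delta> g) *\<^sub>R (\<integral>x. h x \<partial>\<mu>r)" by (rule integral_left_translate(1)[OF h g])
    also have "(\<integral>x. h x \<partial>\<mu>r) = cinner \<psi>1 \<psi>2 * cnj (cinner w1 w2)"
      unfolding h_def by (rule orthogonality[OF uw(1,2)])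
    also have "(1 / \<Delta> g) *\<^sub>R (cinner \<psi>1 \<psi>2 * cnj (cinner w1 w2)) = cinner \<psi>1 \<psi>2 * cnj (cinner \<eta>1 \<eta>2)"
      unfolding r(2)[symmetric] uw(4,6)
      by (simp add: cinner_scaleR_left cinner_scaleR_right \<pi>_cinner[OF g] scaleR_conv_of_real)
    finally show ?thesis .
  qed
  ultimately have "duflo_moore_relations \<mu>r \<pi> T"
    unfolding duflo_moore_relations_def Dom using Domain_Dinv by blast
  then have "T = Dinv" by (rule relations_unique)
  then show ?thesis using \<phi> unfolding r_def[symmetric] T_def by blast
qed

subsection \<open>The Fourier-Wigner transform\<close>

abbreviation "is_op f A \<equiv> integrated_operator G \<mu>r \<pi> (Dinv\<inverse>) f A"

text \<open>The matrix coefficient under the integral in \<open>integrated_operator\<close>. It is a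
  conjugated wavelet transform, hence square integrable for \<eta> in the domain of
  \<open>Dinv\<close>, with inner products given by the orthogonality relations.\<close>

definition mcoeff :: "'h \<Rightarrow> 'h \<Rightarrow> 'g \<Rightarrow> complex" where
  "mcoeff \<eta> \<psi> x = cinner (\<pi> (inv x) \<eta>) \<psi>"

lemma is_op_iff:
  "is_op f A \<longleftrightarrow> bounded_clinear A \<and>
     (\<forall>\<eta> \<phi> \<psi>. (\<eta>, \<phi>) \<in> Dinv \<longrightarrow> cinner (A \<phi>) \<psi> = (\<integral>x. f x * mcoeff \<eta> \<psi> x \<partial>\<mu>r))"
  unfolding integrated_operator_def mcoeff_def by blast

lemma is_opD:
  assumes "is_op f A"
  shows "bounded_clinear A"
    and "(\<eta>, \<phi>) \<in> Dinv \<Longrightarrow> cinner (A \<phi>) \<psi> = (\<integral>x. f x * mcoeff \<eta> \<psi> x \<partial>\<mu>r)"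
  using assms unfolding is_op_iff by blast+

lemma mcoeff_wavelet: "x \<in> carrier G \<Longrightarrow> mcoeff \<eta> \<psi> x = cnj (wavelet \<pi> \<eta> \<psi> x)"
  by (simp add: mcoeff_def wavelet_eq cinner_commute[of _ \<psi>])

lemma mcoeff_measurable [measurable]: "mcoeff \<eta> \<psi> \<in> borel_measurable \<B>"
proof -
  have "(\<lambda>x. cnj (wavelet \<pi> \<eta> \<psi> x)) \<in> borel_measurable \<B>" by measurable
  then show ?thesis by (rule measurable_cong[THEN iffD1, rotated]) (simp add: space_borel_of mcoeff_wavelet)
qed

lemma mcoeff_L2:
  assumes "(\<eta>, \<phi>) \<in> Dinv"
  shows "mcoeff \<eta> \<psi> \<in> L2 \<mu>r"
proof -
  have "integrable \<mu>r (\<lambda>x. (cmod (wavelet \<pi> \<eta> \<psi> x))\<^sup>2)" by (rule L2_integrable[OF wavelet_L2[OF assms]])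
  then have "integrable \<mu>r (\<lambda>x. (cmod (mcoeff \<eta> \<psi> x))\<^sup>2)"
    by (rule Bochner_Integration.integrable_cong[THEN iffD2, OF refl, rotated]) (simp add: mcoeff_wavelet)
  then show ?thesis by (simp add: L2_def)
qed

lemma mcoeff_orthogonality:
  assumes "(\<eta>, \<phi>) \<in> Dinv" "(\<eta>', \<phi>') \<in> Dinv"
  shows "(\<integral>x. mcoeff \<eta> \<psi> x * cnj (mcoeff \<eta>' \<psi>' x) \<partial>\<mu>r) = cinner \<psi>' \<psi> * cinner \<phi> \<phi>'"
proof -
  have "(\<integral>x. mcoeff \<eta> \<psi> x * cnj (mcoeff \<eta>' \<psi>' x) \<partial>\<mu>r) = (\<integral>x. wavelet \<pi> \<eta>' \<psi>' x * cnj (wavelet \<pi> \<eta> \<psi> x) \<partial>\<mu>r)"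
    by (rule Bochner_Integration.integral_cong[OF refl]) (simp add: mcoeff_wavelet mult.commute)
  also have "\<dots> = cinner \<psi>' \<psi> * cinner \<phi> \<phi>'"
    by (simp add: orthogonality[OF assms(2,1)] cinner_commute[of \<phi> \<phi>'])
  finally show ?thesis .
qed

text \<open>The right side is the squared Hilbert-Schmidt norm of the finite-rank operator that
  sends v to the sum of \<open>cinner v (\<phi> i)\<close> times \<psi> i: the orthogonality
  relations are an isometry onto Hilbert-Schmidt operators in disguise.\<close>

lemma mcoeff_sum_L2_norm:
  assumes I: "finite I" and D: "\<And>i. i \<in> I \<Longrightarrow> (\<eta> i, \<phi> i) \<in> Dinv"
  shows "(L2_norm \<mu>r (\<lambda>x. \<Sum>i\<in>I. mcoeff (\<eta> i) (\<psi> i) x))\<^sup>2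
    = Re (\<Sum>i\<in>I. \<Sum>j\<in>I. cinner (\<psi> j) (\<psi> i) * cinner (\<phi> i) (\<phi> j))"
proof -
  have "complex_of_real ((L2_norm \<mu>r (\<lambda>x. \<Sum>i\<in>I. mcoeff (\<eta> i) (\<psi> i) x))\<^sup>2)
    = (\<integral>x. complex_of_real ((cmod (\<Sum>i\<in>I. mcoeff (\<eta> i) (\<psi> i) x))\<^sup>2) \<partial>\<mu>r)"
    unfolding L2_norm_power2 by (rule integral_complex_of_real[symmetric])
  also have "\<dots> = (\<integral>x. (\<Sum>i\<in>I. \<Sum>j\<in>I. mcoeff (\<eta> i) (\<psi> i) x * cnj (mcoeff (\<eta> j) (\<psi> j) x)) \<partial>\<mu>r)"
    unfolding complex_norm_square cnj_sum sum_product ..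
  also have "\<dots> = (\<Sum>i\<in>I. \<integral>x. (\<Sum>j\<in>I. mcoeff (\<eta> i) (\<psi> i) x * cnj (mcoeff (\<eta> j) (\<psi> j) x)) \<partial>\<mu>r)"
    by (intro Bochner_Integration.integral_sum Bochner_Integration.integrable_sum L2_mult_integrable L2_cnj mcoeff_L2[OF D])
  also have "\<dots> = (\<Sum>i\<in>I. \<Sum>j\<in>I. \<integral>x. mcoeff (\<eta> i) (\<psi> i) x * cnj (mcoeff (\<eta> j) (\<psi> j) x) \<partial>\<mu>r)"
    by (intro sum.cong refl Bochner_Integration.integral_sum L2_mult_integrable L2_cnj mcoeff_L2[OF D])
  also have "\<dots> = (\<Sum>i\<in>I. \<Sum>j\<in>I. cinner (\<psi> j) (\<psi> i) * cinner (\<phi> i) (\<phi> j))"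
    by (intro sum.cong refl mcoeff_orthogonality D)
  finally show ?thesis by (metis Re_complex_of_real)
qed

text \<open>Cauchy-Schwarz on the group. With a single term it bounds the operator of f; with
  approximately orthonormal \<phi> i it bounds the Hilbert-Schmidt norm.\<close>

lemma mcoeff_pairing_bound:
  assumes f: "f \<in> L2 \<mu>r" and I: "finite I" and D: "\<And>i. i \<in> I \<Longrightarrow> (\<eta> i, \<phi> i) \<in> Dinv"
  shows "cmod (\<Sum>i\<in>I. \<integral>x. f x * mcoeff (\<eta> i) (\<psi> i) x \<partial>\<mu>r)
    \<le> L2_norm \<mu>r f * sqrt (Re (\<Sum>i\<in>I. \<Sum>j\<in>I. cinner (\<psi> j) (\<psi> i) * cinner (\<phi> i) (\<phi> j)))"
proof -
  have "(\<Sum>i\<in>I. \<integral>x. f x * mcoeff (\<eta> i) (\<psi> i) x \<partial>\<mu>r) = (\<integral>x. (\<Sum>i\<in>I. f x * mcoeff (\<eta> i) (\<psi> i) x) \<partial>\<mu>r)"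
    by (intro Bochner_Integration.integral_sum[symmetric] L2_mult_integrable f mcoeff_L2[OF D])
  also have "\<dots> = (\<integral>x. f x * (\<Sum>i\<in>I. mcoeff (\<eta> i) (\<psi> i) x) \<partial>\<mu>r)" by (simp only: sum_distrib_left)
  finally have "cmod (\<Sum>i\<in>I. \<integral>x. f x * mcoeff (\<eta> i) (\<psi> i) x \<partial>\<mu>r)
     \<le> L2_norm \<mu>r f * L2_norm \<mu>r (\<lambda>x. \<Sum>i\<in>I. mcoeff (\<eta> i) (\<psi> i) x)"
    using L2_cauchy_schwarz[OF f L2_sum, of I "\<lambda>i. mcoeff (\<eta> i) (\<psi> i)"] mcoeff_L2[OF D] by simp
  also have "L2_norm \<mu>r (\<lambda>x. \<Sum>i\<in>I. mcoeff (\<eta> i) (\<psi> i) x)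
      = sqrt (Re (\<Sum>i\<in>I. \<Sum>j\<in>I. cinner (\<psi> j) (\<psi> i) * cinner (\<phi> i) (\<phi> j)))"
    by (rule real_sqrt_unique[OF mcoeff_sum_L2_norm[OF I D], symmetric]) simp_all
  finally show ?thesis .
qed

text \<open>Although D is unbounded, the weak integral \<open>B\<close> is bounded by the product of
  the norms of f, \<phi> and \<psi>, since orthogonality measures the coefficient of D \<phi> by the
  norm of \<phi>. Riesz's theorem yields a vector for each \<phi> in the range of
  \<open>Dinv\<close>, and the resulting map extends to the whole space.\<close>

lemma is_op_exists:
  assumes f: "f \<in> L2 \<mu>r"
  shows "\<exists>A. is_op f A"
proof -
  \<comment> \<open>The choice is harmless: preimages under \<open>Dinv\<close> are unique, and this
    is also what makes \<open>D\<close> linear on the range.\<close>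
  define D where "D \<phi> = (SOME \<eta>. (\<eta>, \<phi>) \<in> Dinv)" for \<phi>
  have D: "(D \<phi>, \<phi>) \<in> Dinv" if "\<phi> \<in> Range Dinv" for \<phi>
  proof -
    from that obtain \<eta> where "(\<eta>, \<phi>) \<in> Dinv" by blast
    then show ?thesis unfolding D_def by (rule someI[of "\<lambda>\<eta>. (\<eta>, \<phi>) \<in> Dinv"])
  qed
  have D_eq: "D \<phi> = \<eta>" if "(\<eta>, \<phi>) \<in> Dinv" for \<eta> \<phi>
  proof -
    have "\<phi> \<in> Range Dinv" using that by blast
    from Dinv_diff[OF D[OF this] that] show ?thesis using Dinv_injective[of "D \<phi> - \<eta>"] by simp
  qed
  define B where "B \<phi> \<psi> = (\<integral>x. f x * mcoeff (D \<phi>) \<psi> x \<partial>\<mu>r)" for \<phi> \<psi>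
  have int: "integrable \<mu>r (\<lambda>x. f x * mcoeff (D \<phi>) \<psi> x)" if "\<phi> \<in> Range Dinv" for \<phi> \<psi>
    by (rule L2_mult_integrable[OF f mcoeff_L2[OF D[OF that]]])
  have bound: "cmod (B \<phi> \<psi>) \<le> L2_norm \<mu>r f * norm \<phi> * norm \<psi>" if "\<phi> \<in> Range Dinv" for \<phi> \<psi>
  proof -
    have "cinner \<psi> \<psi> * cinner \<phi> \<phi> = complex_of_real ((norm \<phi> * norm \<psi>)\<^sup>2)"
      by (simp add: cinner_self power_mult_distrib mult.commute)
    then have "sqrt (Re (cinner \<psi> \<psi> * cinner \<phi> \<phi>)) = norm \<phi> * norm \<psi>" by simp
    then show ?thesis
      using mcoeff_pairing_bound[OF f, of "{()}" "\<lambda>_. D \<phi>" "\<lambda>_. \<phi>" "\<lambda>_. \<psi>"] D[OF that]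
      by (simp add: B_def mult.assoc)
  qed
  have "\<exists>v. \<forall>\<psi>. cinner \<psi> v = cnj (B \<phi> \<psi>)" if \<phi>: "\<phi> \<in> Range Dinv" for \<phi>
  proof (rule riesz_representation)
    have add: "B \<phi> (\<psi> + \<psi>') = B \<phi> \<psi> + B \<phi> \<psi>'" for \<psi> \<psi>'
    proof -
      have "B \<phi> (\<psi> + \<psi>') = (\<integral>x. f x * mcoeff (D \<phi>) \<psi> x + f x * mcoeff (D \<phi>) \<psi>' x \<partial>\<mu>r)"
        unfolding B_def by (simp add: mcoeff_def cinner_add_right distrib_left)
      also have "\<dots> = B \<phi> \<psi> + B \<phi> \<psi>'"
        unfolding B_def by (rule Bochner_Integration.integral_add[OF int[OF \<phi>] int[OF \<phi>]])
      finally show ?thesis .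
    qed
    have scale: "B \<phi> (scaleC c \<psi>) = cnj c * B \<phi> \<psi>" for c \<psi>
    proof -
      have "B \<phi> (scaleC c \<psi>) = (\<integral>x. cnj c * (f x * mcoeff (D \<phi>) \<psi> x) \<partial>\<mu>r)"
        unfolding B_def by (simp add: mcoeff_def cinner_scaleC_right mult_ac)
      then show ?thesis by (simp add: B_def)
    qed
    show "cnj (B \<phi> (scaleC c \<psi>)) = c * cnj (B \<phi> \<psi>)" for c \<psi> by (simp add: scale)
    show "bounded_linear (\<lambda>\<psi>. cnj (B \<phi> \<psi>))"
    proof (rule bounded_linear_intro)
      show "norm (cnj (B \<phi> \<psi>)) \<le> norm \<psi> * (L2_norm \<mu>r f * norm \<phi>)" for \<psi>
        using bound[OF \<phi>, of \<psi>] by (simp add: mult_ac)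
      show "cnj (B \<phi> (r *\<^sub>R \<psi>)) = r *\<^sub>R cnj (B \<phi> \<psi>)" for r \<psi>
        using scale[of "complex_of_real r" \<psi>] by (simp add: scaleC_of_real scaleR_conv_of_real)
    qed (simp add: add)
  qed
  then obtain A0 where A0: "\<And>\<phi> \<psi>. \<phi> \<in> Range Dinv \<Longrightarrow> cinner \<psi> (A0 \<phi>) = cnj (B \<phi> \<psi>)" by metis
  have mcoeff_lin: "mcoeff (\<eta> + \<eta>') \<psi> x = mcoeff \<eta> \<psi> x + mcoeff \<eta>' \<psi> x"
    "mcoeff (scaleC c \<eta>) \<psi> x = c * mcoeff \<eta> \<psi> x" if "x \<in> carrier G" for \<eta> \<eta>' \<psi> x c
    using that by (auto simp: mcoeff_def linear_add[OF \<pi>_linear] \<pi>_scaleC cinner_add_left cinner_scaleC_left)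
  obtain A where A: "bounded_clinear A" "\<And>\<phi>. \<phi> \<in> Range Dinv \<Longrightarrow> A \<phi> = A0 \<phi>"
  proof (rule bounded_clinear_extension[OF Range_Dinv_csubspace Range_Dinv_dense])
    show "A0 (x + y) = A0 x + A0 y" if xy: "x \<in> Range Dinv" "y \<in> Range Dinv" for x y
    proof (rule cinner_eqI)
      fix z
      have xy': "x + y \<in> Range Dinv" using Range_Dinv_csubspace xy by (auto simp: csubspace_def)
      have "D (x + y) = D x + D y" by (rule D_eq[OF Dinv_add[OF D[OF xy(1)] D[OF xy(2)]]])
      then have "B (x + y) z = (\<integral>u. f u * mcoeff (D x) z u + f u * mcoeff (D y) z u \<partial>\<mu>r)"
        unfolding B_def by (intro Bochner_Integration.integral_cong refl) (simp add: mcoeff_lin distrib_left)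
      also have "\<dots> = B x z + B y z"
        unfolding B_def by (rule Bochner_Integration.integral_add[OF int[OF xy(1)] int[OF xy(2)]])
      finally show "cinner z (A0 (x + y)) = cinner z (A0 x + A0 y)"
        by (simp add: A0 xy xy' cinner_add_right)
    qed
    show "A0 (scaleC c x) = scaleC c (A0 x)" if x: "x \<in> Range Dinv" for c x
    proof (rule cinner_eqI)
      fix z
      have cx: "scaleC c x \<in> Range Dinv" using Range_Dinv_csubspace x by (auto simp: csubspace_def)
      have "D (scaleC c x) = scaleC c (D x)" by (rule D_eq[OF Dinv_scaleC[OF D[OF x]]])
      then have "B (scaleC c x) z = (\<integral>u. c * (f u * mcoeff (D x) z u) \<partial>\<mu>r)"
        unfolding B_def by (intro Bochner_Integration.integral_cong refl) (simp add: mcoeff_lin)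
      also have "\<dots> = c * B x z" unfolding B_def by simp
      finally show "cinner z (A0 (scaleC c x)) = cinner z (scaleC c (A0 x))"
        by (simp add: A0 x cx cinner_scaleC_right)
    qed
    show "norm (A0 x) \<le> L2_norm \<mu>r f * norm x" if x: "x \<in> Range Dinv" for x
    proof (cases "A0 x = 0")
      case False
      have "(norm (A0 x))\<^sup>2 = cmod (B x (A0 x))"
        using arg_cong[OF A0[OF x, of "A0 x"], of cmod] by (simp add: cinner_self norm_power)
      also have "\<dots> \<le> L2_norm \<mu>r f * norm x * norm (A0 x)" by (rule bound[OF x])
      finally show ?thesis using False by (simp add: power2_eq_square)
    qed simp
    show "0 \<le> L2_norm \<mu>r f" by simp
    show thesis if "bounded_clinear A" "\<And>x. x \<in> Range Dinv \<Longrightarrow> A x = A0 x" for A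
      by (rule \<open>\<And>A. bounded_clinear A \<Longrightarrow> (\<And>\<phi>. \<phi> \<in> Range Dinv \<Longrightarrow> A \<phi> = A0 \<phi>) \<Longrightarrow> thesis\<close>[OF that])
  qed
  have "cinner (A \<phi>) \<psi> = (\<integral>x. f x * mcoeff \<eta> \<psi> x \<partial>\<mu>r)" if "(\<eta>, \<phi>) \<in> Dinv" for \<eta> \<phi> \<psi>
  proof -
    have "\<phi> \<in> Range Dinv" using that by blast
    then have "cinner (A \<phi>) \<psi> = B \<phi> \<psi>" by (subst cinner_commute) (simp add: A A0)
    then show ?thesis by (simp add: B_def D_eq[OF that])
  qed
  then show ?thesis using A(1) unfolding is_op_iff by blast
qed

section \<open>Uniqueness and the Hilbert-Schmidt norm\<close>

lemma bounded_clinear_eqI: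
  assumes A: "bounded_clinear A" and B: "bounded_clinear B"
    and eq: "\<And>\<phi> \<psi>. \<phi> \<in> Range Dinv \<Longrightarrow> cinner (A \<phi>) \<psi> = cinner (B \<phi>) \<psi>"
  shows "A = (B :: 'h \<Rightarrow> 'h)"
proof
  fix x
  show "A x = B x"
  proof (rule continuous_eq_on_dense[of A B, OF _ _ Range_Dinv_dense])
    show "continuous_on UNIV A" "continuous_on UNIV B"
      using A B by (auto intro!: linear_continuous_on bounded_clinear_bounded_linear)
    fix \<phi> assume "\<phi> \<in> Range Dinv"
    from eq[OF this] show "A \<phi> = B \<phi>" by (intro cinner_eqI) (metis cinner_commute)
  qed
qed

lemma is_op_unique:
  assumes "is_op f A" "is_op f B"
  shows "A = B"
  by (rule bounded_clinear_eqI[OF is_opD(1)[OF assms(1)] is_opD(1)[OF assms(2)]])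
    (auto simp: is_opD(2)[OF assms(1)] is_opD(2)[OF assms(2)])

lemma is_op_cong_AE:
  assumes f: "f \<in> L2 \<mu>r" and g: "g \<in> L2 \<mu>r" and eq: "AE x in \<mu>r. f x = g x"
  shows "is_op f A \<longleftrightarrow> is_op g A"
proof -
  note [measurable] = L2_measurable[OF f] L2_measurable[OF g]
  have "(\<integral>x. f x * mcoeff \<eta> \<psi> x \<partial>\<mu>r) = (\<integral>x. g x * mcoeff \<eta> \<psi> x \<partial>\<mu>r)" for \<eta> \<psi>
  proof (rule integral_cong_AE)
    show "AE x in \<mu>r. f x * mcoeff \<eta> \<psi> x = g x * mcoeff \<eta> \<psi> x" using eq by eventually_elim simp
  qed measurable
  then show ?thesis unfolding is_op_iff by simp
qed

lemma is_op_diff: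
  assumes f: "f \<in> L2 \<mu>r" and g: "g \<in> L2 \<mu>r" and A: "is_op f A" and B: "is_op g B"
  shows "is_op (\<lambda>x. f x - g x) (\<lambda>v. A v - B v)"
  unfolding is_op_iff
proof (intro conjI allI impI)
  show "bounded_clinear (\<lambda>v. A v - B v)"
    by (rule bounded_clinear_diff[OF is_opD(1)[OF A] is_opD(1)[OF B]])
  fix \<eta> \<phi> \<psi> assume D: "(\<eta>, \<phi>) \<in> Dinv"
  show "cinner (A \<phi> - B \<phi>) \<psi> = (\<integral>x. (f x - g x) * mcoeff \<eta> \<psi> x \<partial>\<mu>r)"
    unfolding cinner_diff_left is_opD(2)[OF A D] is_opD(2)[OF B D] left_diff_distrib
    by (rule Bochner_Integration.integral_diff[symmetric]) (intro L2_mult_integrable f g mcoeff_L2[OF D])+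
qed

text \<open>The bound on \<open>\<Sum>\<parallel>A e\<parallel>\<^sup>2\<close> comes from duality: the sum is the limit of pairings of \<open>f\<close> with
  \<open>\<Sum> mcoeff \<eta> (A e)\<close>, where \<open>Dinv \<eta>\<close> approximates \<open>e\<close>, since \<open>e\<close> need not lie in the range.\<close>

lemma is_op_hilbert_schmidt:
  assumes f: "f \<in> L2 \<mu>r" and A: "is_op f A"
  shows "hilbert_schmidt A" and "hs_norm A \<le> L2_norm \<mu>r f"
proof -
  define E where "E = (some_orthonormal_basis :: 'h set)"
  have E: "\<And>e e'. e \<in> E \<Longrightarrow> e' \<in> E \<Longrightarrow> cinner e e' = (if e = e' then 1 else 0)"
    using orthonormal_basis_some unfolding orthonormal_basis_def E_def by blast
  have Acont: "(\<lambda>n. A (u n)) \<longlonglongrightarrow> A x" if "u \<longlonglongrightarrow> x" for u x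
    by (rule bounded_linear.tendsto[OF bounded_clinear_bounded_linear[OF is_opD(1)[OF A]] that])
  have fin: "(\<Sum>e\<in>I. (norm (A e))\<^sup>2) \<le> (L2_norm \<mu>r f)\<^sup>2" if I: "finite I" "I \<subseteq> E" for I
  proof -
    have "\<forall>e. \<exists>u. (\<forall>n. u n \<in> Range Dinv) \<and> u \<longlonglongrightarrow> e"
      using dense_approx_seq[OF Range_Dinv_dense] by metis
    then obtain u where u: "\<And>e n. u e n \<in> Range Dinv" "\<And>e. u e \<longlonglongrightarrow> e" by metis
    have "\<forall>e n. \<exists>\<eta>. (\<eta>, u e n) \<in> Dinv" using u(1) by blast
    then obtain \<eta> where \<eta>: "\<And>e n. (\<eta> e n, u e n) \<in> Dinv" by metis
    define S where "S = (\<Sum>e\<in>I. (norm (A e))\<^sup>2)"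
    have le: "cmod (\<Sum>e\<in>I. cinner (A (u e n)) (A e))
       \<le> L2_norm \<mu>r f * sqrt (Re (\<Sum>e\<in>I. \<Sum>e'\<in>I. cinner (A e') (A e) * cinner (u e n) (u e' n)))" for n
      unfolding is_opD(2)[OF A \<eta>] by (rule mcoeff_pairing_bound[OF f I(1) \<eta>])
    have "(\<lambda>n. cmod (\<Sum>e\<in>I. cinner (A (u e n)) (A e))) \<longlonglongrightarrow> cmod (\<Sum>e\<in>I. cinner (A e) (A e))"
      by (intro tendsto_norm tendsto_sum tendsto_cinner Acont u(2) tendsto_const)
    moreover have "(\<lambda>n. L2_norm \<mu>r f * sqrt (Re (\<Sum>e\<in>I. \<Sum>e'\<in>I. cinner (A e') (A e) * cinner (u e n) (u e' n))))
       \<longlonglongrightarrow> L2_norm \<mu>r f * sqrt (Re (\<Sum>e\<in>I. \<Sum>e'\<in>I. cinner (A e') (A e) * cinner e e'))"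
      by (intro tendsto_mult tendsto_const tendsto_real_sqrt tendsto_Re tendsto_sum tendsto_cinner u(2))
    ultimately have lim: "cmod (\<Sum>e\<in>I. cinner (A e) (A e))
       \<le> L2_norm \<mu>r f * sqrt (Re (\<Sum>e\<in>I. \<Sum>e'\<in>I. cinner (A e') (A e) * cinner e e'))"
      by (rule LIMSEQ_le) (use le in blast)
    have s1: "(\<Sum>e\<in>I. cinner (A e) (A e)) = complex_of_real S"
      by (simp add: S_def cinner_self)
    \<comment> \<open>Orthonormality leaves only the diagonal, so the Gram sum is \<open>S\<close>
      again and the estimate becomes S \<le> |f| sqrt S, with |f| the L2 norm.\<close>
    have "(\<Sum>e'\<in>I. cinner (A e') (A e) * cinner e e') = cinner (A e) (A e)" if e: "e \<in> I" for e
    proof -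
      have "(\<Sum>e'\<in>I. cinner (A e') (A e) * cinner e e') = (\<Sum>e'\<in>I. if e' = e then cinner (A e) (A e) else 0)"
        using I e by (intro sum.cong refl) (auto simp: E subsetD)
      then show ?thesis using I e by simp
    qed
    then have s2: "(\<Sum>e\<in>I. \<Sum>e'\<in>I. cinner (A e') (A e) * cinner e e') = complex_of_real S"
      using s1 by simp
    have S0: "S \<ge> 0" unfolding S_def by (simp add: sum_nonneg)
    have "S \<le> L2_norm \<mu>r f * sqrt S" using lim S0 unfolding s1 s2 by simp
    then have "sqrt S * sqrt S \<le> L2_norm \<mu>r f * sqrt S" using S0 by simp
    then have "sqrt S \<le> L2_norm \<mu>r f"
      using S0 by (cases "S = 0") (auto dest: mult_right_le_imp_le simp del: real_sqrt_mult_self)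
    then have "(sqrt S)\<^sup>2 \<le> (L2_norm \<mu>r f)\<^sup>2" using S0 by (intro power_mono) auto
    then show ?thesis using S0 by (simp add: S_def)
  qed
  have sm: "(\<lambda>e. (norm (A e))\<^sup>2) summable_on E"
    by (rule nonneg_bdd_above_summable_on) (auto intro!: bdd_aboveI2[of _ _ "(L2_norm \<mu>r f)\<^sup>2"] fin)
  then show "hilbert_schmidt A" using is_opD(1)[OF A] by (simp add: hilbert_schmidt_def E_def)
  have "(\<Sum>\<^sub>\<infinity>e\<in>E. (norm (A e))\<^sup>2) \<le> (L2_norm \<mu>r f)\<^sup>2"
    by (rule infsum_le_finite_sums[OF sm]) (use fin in auto)
  then have "sqrt (\<Sum>\<^sub>\<infinity>e\<in>E. (norm (A e))\<^sup>2) \<le> sqrt ((L2_norm \<mu>r f)\<^sup>2)" by (rule real_sqrt_le_mono)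
  then show "hs_norm A \<le> L2_norm \<mu>r f" by (simp add: hs_norm_def E_def)
qed

text \<open>The defining description asks for a Hilbert-Schmidt limit of operators of functions in
  L1 and L2. Such a limit satisfies the weak formula for f, because both sides pass to the limit,
  and the weak formula has only one solution; truncations of f show that this solution is such a
  limit. From here on \<open>is_op\<close> stands in for the transform.\<close>

lemma inv_fourier_wigner_is_op:
  assumes f: "f \<in> L2 \<mu>r"
  shows "is_op f (inv_fourier_wigner G \<mu>r \<pi> (Dinv\<inverse>) f)"
proof -
  define R where "R A \<longleftrightarrow> hilbert_schmidt A \<and>
        (\<exists>fs As. (\<forall>n. fs n \<in> L2 \<mu>r \<and> integrable \<mu>r (fs n) \<and> hilbert_schmidt (As n) \<and> is_op (fs n) (As n)) \<and>
           L2_limit \<mu>r fs f \<and> (\<lambda>n. hs_norm (\<lambda>v. As n v - A v)) \<longlonglongrightarrow> 0)" for A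
  have R_imp: "is_op f A" if "R A" for A
    unfolding is_op_iff
  proof (intro conjI allI impI)
    from that obtain fs As where
      fs: "\<And>n. fs n \<in> L2 \<mu>r" "\<And>n. hilbert_schmidt (As n)" "\<And>n. is_op (fs n) (As n)"
      and lim: "L2_limit \<mu>r fs f" "(\<lambda>n. hs_norm (\<lambda>v. As n v - A v)) \<longlonglongrightarrow> 0"
      and A: "hilbert_schmidt A" unfolding R_def by blast
    show "bounded_clinear A" using A by (simp add: hilbert_schmidt_def)
    fix \<eta> \<phi> \<psi> assume D: "(\<eta>, \<phi>) \<in> Dinv"
    have "(\<lambda>n. As n \<phi> - A \<phi>) \<longlonglongrightarrow> 0"
    proof (rule Lim_null_comparison)
      show "\<forall>\<^sub>F n in sequentially. norm (As n \<phi> - A \<phi>) \<le> hs_norm (\<lambda>v. As n v - A v) * norm \<phi>"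
        by (intro always_eventually allI norm_le_hs_norm[OF hilbert_schmidt_diff[OF fs(2) A]])
      show "(\<lambda>n. hs_norm (\<lambda>v. As n v - A v) * norm \<phi>) \<longlonglongrightarrow> 0" by (rule tendsto_mult_left_zero[OF lim(2)])
    qed
    then have "(\<lambda>n. As n \<phi>) \<longlonglongrightarrow> A \<phi>" by (rule LIM_zero_cancel)
    then have "(\<lambda>n. cinner (As n \<phi>) \<psi>) \<longlonglongrightarrow> cinner (A \<phi>) \<psi>" by (intro tendsto_cinner tendsto_const)
    moreover have "(\<lambda>n. cinner (As n \<phi>) \<psi>) \<longlonglongrightarrow> (\<integral>x. f x * mcoeff \<eta> \<psi> x \<partial>\<mu>r)"
      unfolding is_opD(2)[OF fs(3) D] by (rule L2_limit_integral_mult[OF fs(1) f mcoeff_L2[OF D] lim(1)])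
    ultimately show "cinner (A \<phi>) \<psi> = (\<integral>x. f x * mcoeff \<eta> \<psi> x \<partial>\<mu>r)" by (rule LIMSEQ_unique)
  qed
  obtain A where A: "is_op f A" using is_op_exists[OF f] by blast
  obtain fs where fs: "\<And>n. admissible (fs n)" "\<And>n. integrable \<mu>r (fs n)" "L2_limit \<mu>r fs f"
    using L2_dense_admissible[OF f] by metis
  have fsL: "fs n \<in> L2 \<mu>r" for n using fs(1) by (simp add: admissible_def)
  obtain As where As: "\<And>n. is_op (fs n) (As n)" using is_op_exists[OF fsL] by metis
  have "(\<lambda>n. hs_norm (\<lambda>v. As n v - A v)) \<longlonglongrightarrow> 0"
  proof (rule tendsto_sandwich[OF _ _ tendsto_const fs(3)[unfolded L2_limit_iff]])
    show "\<forall>\<^sub>F n in sequentially. hs_norm (\<lambda>v. As n v - A v) \<le> L2_norm \<mu>r (\<lambda>x. fs n x - f x)"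
      by (intro always_eventually allI is_op_hilbert_schmidt(2)[OF L2_diff[OF fsL f] is_op_diff[OF fsL f As A]])
    show "\<forall>\<^sub>F n in sequentially. 0 \<le> hs_norm (\<lambda>v. As n v - A v)"
      by (auto simp: hs_norm_def intro!: always_eventually infsum_nonneg)
  qed
  then have "R A"
    unfolding R_def using fs fsL As is_op_hilbert_schmidt(1)[OF f A] is_op_hilbert_schmidt(1)[OF fsL As] by blast
  then have "(THE A. R A) = A" using R_imp is_op_unique A by (intro the_equality) blast+
  then show ?thesis using A unfolding inv_fourier_wigner_def R_def[symmetric] by simp
qed

text \<open>For \<phi> = Dinv \<eta> and \<psi> = Dinv \<zeta>, symmetry and semi-invariance move
  \<open>Dinv\<close> from \<zeta> onto the translate of \<eta>, so that \<phi> and \<zeta> are left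
  in the coefficient in place of \<eta> and \<psi>. Substituting x^-1 for x turns the integral for
  \<open>sharp f\<close> into the one for f.\<close>

lemma is_op_adjoint:
  assumes f: "f \<in> L2 \<mu>r" and A: "is_op f A" and B: "is_op (sharp f) B"
  shows "cadjoint A = B"
proof (rule cadjoint_eqI)
  have [measurable]: "f \<in> borel_measurable \<B>" using L2_measurable[OF f] by simp
  have cont: "continuous_on UNIV A" "continuous_on UNIV B"
    using is_opD(1)[OF A] is_opD(1)[OF B] by (auto intro!: linear_continuous_on bounded_clinear_bounded_linear)
  have eq: "cinner (A \<phi>) \<psi> = cinner \<phi> (B \<psi>)" if "\<phi> \<in> Range Dinv" "\<psi> \<in> Range Dinv" for \<phi> \<psi>
  proof -
    from that obtain \<eta> \<zeta> where \<eta>: "(\<eta>, \<phi>) \<in> Dinv" and \<zeta>: "(\<zeta>, \<psi>) \<in> Dinv" by blast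
    \<comment> \<open>The conjugated integrand for \<open>sharp f\<close>, read at x^-1, so that
      \<open>integral_inv\<close> applies in the form in which it is stated.\<close>
    define k where "k x = complex_of_real (sqrt (\<Delta> (inv x))) * f x * cinner \<phi> (\<pi> x \<zeta>)" for x
    have [measurable]: "k \<in> borel_measurable \<B>" unfolding k_def[abs_def] by measurable
    have semi: "mcoeff \<eta> \<psi> x = complex_of_real (sqrt (\<Delta> x)) * cinner \<phi> (\<pi> x \<zeta>)" if x: "x \<in> carrier G" for x
    proof -
      have s: "1 / sqrt (\<Delta> (inv x)) = sqrt (\<Delta> x)" using x by (simp add: \<Delta>_inv real_sqrt_divide)
      have "mcoeff \<eta> \<psi> x = cinner (sqrt (\<Delta> x) *\<^sub>R \<pi> (inv x) \<phi>) \<zeta>"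
        unfolding mcoeff_def using Dinv_symmetric[OF Dinv_semi_invariant[OF \<eta> inv_closed[OF x]] \<zeta>] s by simp
      then show ?thesis using x by (simp add: cinner_scaleR_left \<pi>_cinner_left)
    qed
    have "cinner \<phi> (B \<psi>) = cnj (\<integral>x. sharp f x * mcoeff \<zeta> \<phi> x \<partial>\<mu>r)"
      by (subst cinner_commute) (simp only: is_opD(2)[OF B \<zeta>])
    also have "\<dots> = (\<integral>x. cnj (sharp f x * mcoeff \<zeta> \<phi> x) \<partial>\<mu>r)"
      by (rule Bochner_Integration.integral_cnj[symmetric])
    also have "\<dots> = (\<integral>x. k (inv x) \<partial>\<mu>r)"
    proof (rule Bochner_Integration.integral_cong[OF refl])
      fix x assume "x \<in> space \<mu>r"
      then show "cnj (sharp f x * mcoeff \<zeta> \<phi> x) = k (inv x)"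
        by (simp add: sharp_def k_def mcoeff_def cinner_commute[of _ \<phi>])
    qed
    also have "\<dots> = (\<integral>x. \<Delta> x *\<^sub>R k x \<partial>\<mu>r)" by (rule integral_inv(1)) measurable
    also have "\<dots> = (\<integral>x. f x * mcoeff \<eta> \<psi> x \<partial>\<mu>r)"
    proof (rule Bochner_Integration.integral_cong[OF refl])
      fix x assume "x \<in> space \<mu>r"
      then have x: "x \<in> carrier G" by simp
      \<comment> \<open>The first factor comes from inverting \<mu>r, the second from
        \<open>sharp\<close>; their product is the factor that semi-invariance puts into
        \<open>mcoeff\<close>.\<close>
      have "\<Delta> x * sqrt (\<Delta> (inv x)) = sqrt (\<Delta> x)"
        using \<Delta>_pos[OF x] by (simp add: \<Delta>_inv[OF x] real_sqrt_divide real_div_sqrt)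
      then have "complex_of_real (\<Delta> x) * complex_of_real (sqrt (\<Delta> (inv x))) = complex_of_real (sqrt (\<Delta> x))"
        by (simp flip: of_real_mult)
      then show "\<Delta> x *\<^sub>R k x = f x * mcoeff \<eta> \<psi> x"
        unfolding k_def semi[OF x] scaleR_conv_of_real by (simp add: mult.assoc[symmetric])
    qed
    finally show ?thesis using is_opD(2)[OF A \<eta>] by simp
  qed
  \<comment> \<open>As for additivity of extensions, the identity is carried from the range of
    \<open>Dinv\<close> to the whole space one argument at a time.\<close>
  have eq1: "cinner (A \<phi>) y = cinner \<phi> (B y)" if "\<phi> \<in> Range Dinv" for \<phi> y
    by (rule continuous_eq_on_dense[of "\<lambda>y. cinner (A \<phi>) y" "\<lambda>y. cinner \<phi> (B y)", OF _ _ Range_Dinv_dense])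
      (auto intro!: continuous_on_cinner continuous_intros cont eq[OF that])
  show "cinner (A x) y = cinner x (B y)" for x y
    by (rule continuous_eq_on_dense[of "\<lambda>x. cinner (A x) y" "\<lambda>x. cinner x (B y)", OF _ _ Range_Dinv_dense])
      (auto intro!: continuous_on_cinner continuous_intros cont eq1)
qed

lemma quantization_adjoint:
  assumes f: "f \<in> L2 \<mu>r"
  shows "cadjoint (quantization G ex \<mu>r \<Delta> F \<pi> (Dinv\<inverse>) f)
           = quantization G ex \<mu>r \<Delta> F \<pi> (Dinv\<inverse>) (\<lambda>x. cnj (f x))"
proof -
  define g where "g = inv_fourier_kirillov G ex \<mu>r \<Delta> F f"
  define g' where "g' = inv_fourier_kirillov G ex \<mu>r \<Delta> F (\<lambda>x. cnj (f x))"
  have g: "g \<in> L2 \<mu>r" and g': "g' \<in> L2 \<mu>r" and eq: "AE x in \<mu>r. g' x = sharp g x"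
    using inv_fourier_kirillov_cnj[OF f] unfolding g_def g'_def by auto
  \<comment> \<open>\<open>g'\<close> and \<open>sharp g\<close> agree only almost everywhere, but
    \<open>is_op\<close> does not distinguish square integrable functions that agree almost
    everywhere.\<close>
  have "is_op (sharp g) (inv_fourier_wigner G \<mu>r \<pi> (Dinv\<inverse>) g')"
    using inv_fourier_wigner_is_op[OF g'] is_op_cong_AE[OF g' sharp_L2(1)[OF g] eq] by simp
  from is_op_adjoint[OF g inv_fourier_wigner_is_op[OF g] this] show ?thesis
    unfolding quantization_def g_def g'_def .
qed

end

theorem proposition4p5:
  fixes G :: "'g monoid"
    and \<A> :: "('g, real^'n::{finite,wellorder}) atlas"
    and ex :: "real^'n::_ \<Rightarrow> 'g"
    and F :: "real^'n::_"
    and \<mu>l \<mu>r :: "'g measure" and \<Delta> :: "'g \<Rightarrow> real"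
    and \<pi> :: "'g \<Rightarrow> 'h::chilbert_space \<Rightarrow> 'h" and Dinv :: "('h \<times> 'h) set"
    and f :: "'g \<Rightarrow> complex"
  assumes "exponential_lie_group G \<A> ex"
    and "{g \<in> carrier G. coadjoint G ex g F = F} = {\<one>\<^bsub>G\<^esub>}"
    and "left_haar G (atlas_topology \<A>) \<mu>l"
    and "right_haar G (atlas_topology \<A>) \<mu>r"
    and "modular_function G (atlas_topology \<A>) \<Delta>"
    and "\<mu>l = density \<mu>r (\<lambda>x. ennreal (\<Delta> x))"
    and "\<mu>r = distr (density lborel (\<lambda>X. ennreal (Theta G ex X))) (borel_of (atlas_topology \<A>)) ex"
    and "distr \<mu>r borel (kappa G ex F) =
           density lborel (\<lambda>Y. ennreal (\<bar>Pf G ex F\<bar> * \<Delta> (inv_into (carrier G) (kappa G ex F) Y))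
                                 * indicator (coadjoint_orbit G ex F) Y)"
    and "unitary_rep G (atlas_topology \<A>) \<pi>"
    and "irreducible_rep G \<pi>"
    and "orbit_method_rep G (atlas_topology \<A>) ex F \<pi>"
    and "square_integrable_rep \<mu>r \<pi>"
    and "duflo_moore_inverse \<mu>r \<pi> Dinv"
    and "f \<in> L2 \<mu>r"
  shows "cadjoint (quantization G ex \<mu>r \<Delta> F \<pi> (Dinv\<inverse>) f)
           = quantization G ex \<mu>r \<Delta> F \<pi> (Dinv\<inverse>) (\<lambda>x. cnj (f x))"
proof -
  interpret exp_duflo G \<A> ex \<mu>r \<Delta> F \<pi> Dinv
    using assms by unfold_locales
  show ?thesis by (rule quantization_adjoint[OF assms(14)])
qed

end
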